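(* Let $k$ be a fixed natural number. As $n\to\infty$, there exists a $k$-sparse partial Steiner triple system $\mathcal{S}$ on $n$ vertices with $|\mathcal{S}|=(1/6-o(1))n^2$. (That is, there are $k$-sparse partial Steiner triple systems $\mathcal{S}_n$ on $n$ vertices, one for each $n$, such that $|\mathcal{S}_n|/n^2\to 1/6$ as $n\to\infty$.)
   Context: A partial Steiner triple system on a vertex set $X$ with $|X|=n$ is a set $\mathcal{S}$ of $3$-subsets (triples) of $X$ such that every $2$-subset of $X$ is contained in at most one triple of $\mathcal{S}$. A $(j,\ell)$-configuration is a set of $\ell$ triples on $j$ points every two of which intersect in at most one point. A (partial) Steiner triple system is $k$-sparse if it does not contain any $(j+2,j)$-configuration for $2\le j\le k$. *)

theory Defs
  imports Complex_Main
begin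

definition partial_steiner_triple_system :: "'a set \<Rightarrow> 'a set set \<Rightarrow> bool" where
  "partial_steiner_triple_system X S \<longleftrightarrow>
     finite X \<and> (\<forall>T\<in>S. T \<subseteq> X \<and> card T = 3) \<and>
     (\<forall>e. e \<subseteq> X \<and> card e = 2 \<longrightarrow> (\<exists>\<^sub>\<le>\<^sub>1 T. T \<in> S \<and> e \<subseteq> T))"

text \<open>
  "On \<open>j\<close> points" means that the triples are subsets of some set of \<open>j\<close> points; they need
  not cover it. The notion of \<open>k\<close>-sparseness below is the same as with the covering version:
  a set of \<open>j \<ge> 2\<close> triples on \<open>j + 2\<close> points with \<open>j\<close> minimal covers its points. (If it does
  not and \<open>j \<ge> 3\<close>, delete a triple and an uncovered point; two triples sharing at most one
  point cover at least five points.)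
\<close>

definition configuration :: "nat \<Rightarrow> nat \<Rightarrow> 'a set set \<Rightarrow> bool" where
  "configuration j l C \<longleftrightarrow>
     finite C \<and> card C = l \<and>
     (\<exists>P. finite P \<and> card P = j \<and> (\<forall>T\<in>C. T \<subseteq> P \<and> card T = 3)) \<and>
     (\<forall>T\<in>C. \<forall>T'\<in>C. T \<noteq> T' \<longrightarrow> card (T \<inter> T') \<le> 1)"

definition sparse_triple_system :: "nat \<Rightarrow> 'a set set \<Rightarrow> bool" where
  "sparse_triple_system k S \<longleftrightarrow>
     \<not> (\<exists>j C. 2 \<le> j \<and> j \<le> k \<and> C \<subseteq> S \<and> configuration (j + 2) j C)"

end

theory Submission
  imports Defs
begin

text \<open>
  Call a set \<open>C\<close> of at least two triples a conflict (\<open>tight\<close>) if it spans at most \<open>card C + 2\<close> points and is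
  minimal with that property; two triples sharing a pair are the smallest conflict. Propose every
  triple with probability \<open>\<epsilon> / n\<close> in each of \<open>r\<close> rounds (\<open>\<epsilon>\<close>, \<open>r\<close> constant, \<open>c = r \<epsilon>\<close> large) and
  select it unless this completes a conflict with selected or simultaneously proposed triples.
  Whether a triple gets selected depends on proposed triples linked to it by chains of conflicts.
  Adding a conflict to a linked set never increases the number of points minus triples, and two
  chains that meet lower it, so the first moment method makes the fates of different triples
  independent up to \<open>O(1/n)\<close>. Hence a triple stays selectable with probability at least
  \<open>u^3 \<kappa> - o(1)\<close>, where \<open>u\<close> is the probability that a pair is uncovered and \<open>\<kappa> > 0\<close> depends only
  on \<open>k\<close>: a triple is expected to be selected with probability \<open>O(1/n)\<close> only, so the expected number
  of conflicts blocking a triple is bounded independently of \<open>c\<close>. Since a pair is covered at most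
  once, \<open>c u^3 \<kappa>\<close> stays bounded, and \<open>u\<close> is small for large \<open>c\<close>.
\<close>


section \<open>Linked sets of triples\<close>

text \<open>A single triple and a conflict both have excess 2 of points over triples. A cluster
  grown from a fixed triple therefore brings at most one new point per new triple, which the
  proposal probability O(1/n) just balances; excess 1 gains a factor 1/n. Covariance is controlled
  through proposals pivotal for both events, since these create such a cluster.

  This works only if the traced chains do not run through the very conflict under test. Hence, for a
  fixed triple \<open>T\<close>, the process is compared with one that ignores all conflicts
  containing \<open>T\<close>; the two agree unless \<open>T\<close> is proposed.

  Pair conflicts and larger conflicts at \<open>T\<close> must be treated differently. The larger
  ones may be bounded crudely: their expected number is bounded, and a constant survival probability
  is enough. For pairs a constant lower bound is impossible, since then c times a positive constant
  would be bounded; so the true probability u enters, once for each pair in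
  \<open>T\<close>.\<close>

definition tight :: "'a set set \<Rightarrow> bool" where
  "tight C \<longleftrightarrow> finite C \<and> (\<forall>T\<in>C. card T = 3) \<and> 2 \<le> card C \<and> card (\<Union>C) \<le> card C + 2 \<and>
     (\<forall>D. D \<subset> C \<longrightarrow> 2 \<le> card D \<longrightarrow> card D + 3 \<le> card (\<Union>D))"

text \<open>Connectivity of the hypergraph that \<open>\<D>\<close> induces on \<open>F\<close>,
  stated by cuts: any proper nonempty part can be enlarged by a conflict that stays inside
  \<open>F\<close>.\<close>

definition linked :: "'a set set \<Rightarrow> 'a set \<Rightarrow> bool" where
  "linked \<D> F \<longleftrightarrow> (\<forall>G. G \<subseteq> F \<and> G \<noteq> {} \<and> G \<noteq> F \<longrightarrow> (\<exists>D\<in>\<D>. D \<subseteq> F \<and> D \<inter> G \<noteq> {} \<and> \<not> D \<subseteq> G))"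

lemma finite_Union_triples: "finite F \<Longrightarrow> \<forall>T\<in>F. card T = 3 \<Longrightarrow> finite (\<Union>F)"
  by (metis card.infinite finite_Union zero_neq_numeral)

lemma card_two_triples:
  assumes "card a = 3" "card b = 3" "a \<noteq> b"
  shows "4 \<le> card (a \<union> b)"
proof -
  have fin: "finite a" "finite b" using assms by (metis card.infinite zero_neq_numeral)+
  have "\<not> b \<subseteq> a" using card_subset_eq[OF fin(1), of b] assms by auto
  then have "a \<subset> a \<union> b" by blast
  then have "card a < card (a \<union> b)" using fin by (intro psubset_card_mono) auto
  then show ?thesis using assms by simp
qed

text \<open>Minimality gives even one point more for proper parts with at least two triples; for
  \<open>C\<close> itself, delete a triple. With \<open>tight_le\<close>, a conflict has exactly two
  more points than triples.\<close>

lemma tight_sub: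
  assumes C: "tight C" and D: "D \<subseteq> C" "D \<noteq> {}"
  shows "card D + 2 \<le> card (\<Union>D)"
proof -
  have fC: "finite C" and t: "\<forall>T\<in>C. card T = 3" and c2: "2 \<le> card C"
    and m: "\<And>D. D \<subset> C \<Longrightarrow> 2 \<le> card D \<Longrightarrow> card D + 3 \<le> card (\<Union>D)"
    using C unfolding tight_def by blast+
  have fD: "finite D" using fC D finite_subset by blast
  show ?thesis
  proof (cases "card D = 1")
    case True
    then obtain a where "D = {a}" by (metis card_1_singletonE)
    then show ?thesis using t D by auto
  next
    case False
    moreover have "card D \<noteq> 0" using D fD by simp
    ultimately have D2: "2 \<le> card D" by linarith
    show ?thesis
    proof (cases "D = C")
      case False
      then have "card D + 3 \<le> card (\<Union>D)" using D(1) D2 by (intro m) blast+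
      then show ?thesis by simp
    next
      case True
      show ?thesis
      proof (cases "card C = 2")
        case c: True
        then obtain a b where ab: "C = {a,b}" "a \<noteq> b" by (meson card_2_iff)
        then show ?thesis using card_two_triples[of a b] t True c by auto
      next
        case False
        obtain X where X: "X \<in> C" using D by auto
        have cc: "card (C - {X}) = card C - 1" using X by simp
        have "card (C - {X}) + 3 \<le> card (\<Union>(C - {X}))"
        proof (rule m)
          show "C - {X} \<subset> C" using X by blast
          show "2 \<le> card (C - {X})" using cc False c2 by linarith
        qed
        also have "\<dots> \<le> card (\<Union>C)"
          by (rule card_mono[OF finite_Union_triples[OF fC t] Union_mono[OF Diff_subset]])
        finally show ?thesis using cc c2 True by simp
      qed
    qed
  qed
qed

lemma tight_psub: "tight C \<Longrightarrow> D \<subseteq> C \<Longrightarrow> D \<noteq> C \<Longrightarrow> 2 \<le> card D \<Longrightarrow> card D + 3 \<le> card (\<Union>D)"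
  unfolding tight_def by (simp add: psubset_eq)

lemma tight_finite: "tight C \<Longrightarrow> finite C" and tight_card3: "tight C \<Longrightarrow> T \<in> C \<Longrightarrow> card T = 3"
  and tight_le: "tight C \<Longrightarrow> card (\<Union>C) \<le> card C + 2" and tight_2: "tight C \<Longrightarrow> 2 \<le> card C"
  unfolding tight_def by blast+

lemma tight_subset_eq: "tight C \<Longrightarrow> tight C' \<Longrightarrow> C \<subseteq> C' \<Longrightarrow> C = C'"
  using tight_psub[of C' C] tight_le[of C] tight_2[of C] by linarith

lemma card_Un_Union:
  assumes "finite H" "\<forall>T\<in>H. card T = 3" "finite C" "\<forall>T\<in>C. card T = 3"
  shows "card (\<Union>(H \<union> C)) + card (\<Union>H \<inter> \<Union>C) = card (\<Union>H) + card (\<Union>C)"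
  using card_Un_Int[OF finite_Union_triples[OF assms(1,2)] finite_Union_triples[OF assms(3,4)]]
  by (simp add: Union_Un_distrib)

text \<open>Inclusion-exclusion for points and for triples: \<open>C\<close> contributes excess 2,
  and the overlap takes \<open>s\<close> away.\<close>

lemma attach_strict:
  assumes H: "finite H" "\<forall>T\<in>H. card T = 3" and C: "tight C"
    and le: "card (\<Union>H) \<le> card H + t" and ov: "card (H \<inter> C) + s \<le> card (\<Union>H \<inter> \<Union>C)"
  shows "card (\<Union>(H \<union> C)) + s \<le> card (H \<union> C) + t + 2"
proof -
  have "card (\<Union>(H \<union> C)) + card (\<Union>H \<inter> \<Union>C) = card (\<Union>H) + card (\<Union>C)"
    using card_Un_Union[OF H tight_finite[OF C]] tight_card3[OF C] by blast
  moreover have "card (H \<union> C) + card (H \<inter> C) = card H + card C"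
    using card_Un_Int[OF H(1) tight_finite[OF C]] by simp
  ultimately show ?thesis using le ov tight_le[OF C] by linarith
qed

lemma finite_Int_Union: "tight C \<Longrightarrow> finite (A \<inter> \<Union>C)"
  using finite_Union_triples[OF tight_finite] tight_card3 by blast

text \<open>The common triples have excess at least 2 by \<open>tight_sub\<close>, which cancels the
  excess 2 of \<open>C\<close>.\<close>

lemma attach:
  assumes H: "finite H" "\<forall>T\<in>H. card T = 3" and C: "tight C" and i: "H \<inter> C \<noteq> {}"
    and le: "card (\<Union>H) \<le> card H + t"
  shows "card (\<Union>(H \<union> C)) \<le> card (H \<union> C) + t"
proof -
  have "card (H \<inter> C) + 2 \<le> card (\<Union>(H \<inter> C))" by (rule tight_sub[OF C inf_le2 i])
  also have "\<dots> \<le> card (\<Union>H \<inter> \<Union>C)"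
    by (rule card_mono[OF finite_Int_Union[OF C]]) blast
  finally show ?thesis using attach_strict[OF H C le] by fastforce
qed

text \<open>If the new conflict meets the old part in more points than a single triple or a full
  conflict would force, the excess of points over triples drops.\<close>
lemma attach_overlap:
  assumes H: "finite H" "\<forall>T\<in>H. card T = 3" and C: "tight C" and i: "H \<inter> C \<noteq> {}" and ns: "\<not> C \<subseteq> H"
    and e: "e \<subseteq> \<Union>H \<inter> \<Union>C" "\<And>T. H \<inter> C = {T} \<Longrightarrow> \<not> e \<subseteq> T"
    and le: "card (\<Union>H) \<le> card H + Suc t"
  shows "card (\<Union>(H \<union> C)) \<le> card (H \<union> C) + t"
proof -
  have "card (H \<inter> C) + 3 \<le> card (\<Union>H \<inter> \<Union>C)"
  proof (cases "card (H \<inter> C) = 1")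
    case True
    then obtain T where T: "H \<inter> C = {T}" by (metis card_1_singletonE)
    then have "card T = 3" using H by blast
    have "T \<subset> \<Union>H \<inter> \<Union>C" using T e by blast
    then have "card T < card (\<Union>H \<inter> \<Union>C)" by (rule psubset_card_mono[OF finite_Int_Union[OF C]])
    then show ?thesis using True \<open>card T = 3\<close> by simp
  next
    case False
    moreover have "card (H \<inter> C) \<noteq> 0" using i H(1) by simp
    ultimately have "2 \<le> card (H \<inter> C)" by linarith
    then have "card (H \<inter> C) + 3 \<le> card (\<Union>(H \<inter> C))" using ns by (intro tight_psub[OF C inf_le2]) blast
    also have "\<dots> \<le> card (\<Union>H \<inter> \<Union>C)"
    by (rule card_mono[OF finite_Int_Union[OF C]]) blast
    finally show ?thesis .
  qed
  from attach_strict[OF H C le this] show ?thesis by simp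
qed

section \<open>Connectivity through conflicts and its effect on the excess\<close>

lemma linkedD:
  "linked \<D> F \<Longrightarrow> G \<subseteq> F \<Longrightarrow> G \<noteq> {} \<Longrightarrow> G \<noteq> F \<Longrightarrow> \<exists>D\<in>\<D>. D \<subseteq> F \<and> D \<inter> G \<noteq> {} \<and> \<not> D \<subseteq> G"
  unfolding linked_def by blast

lemma linked_mono: "linked \<D> F \<Longrightarrow> \<D> \<subseteq> \<E> \<Longrightarrow> linked \<E> F"
  unfolding linked_def by (intro allI impI) (metis subsetD)

lemma linked_single: "linked \<D> {x}"
  unfolding linked_def by blast

lemma linked_conflict: "C \<in> \<D> \<Longrightarrow> linked \<D> C"
  unfolding linked_def by blast

lemma linked_Un:
  assumes "linked \<D> F" "linked \<D> F'" "F \<inter> F' \<noteq> {}"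
  shows "linked \<D> (F \<union> F')"
  unfolding linked_def
proof (intro allI impI)
  fix G assume G: "G \<subseteq> F \<union> F' \<and> G \<noteq> {} \<and> G \<noteq> F \<union> F'"
  have *: "\<exists>D\<in>\<D>. D \<subseteq> F \<union> F' \<and> D \<inter> G \<noteq> {} \<and> \<not> D \<subseteq> G"
    if lA: "linked \<D> A" and B: "A \<inter> G \<noteq> {}" "\<not> A \<subseteq> G" "A \<subseteq> F \<union> F'" for A
  proof -
    obtain D where "D \<in> \<D>" "D \<subseteq> A" "D \<inter> (A \<inter> G) \<noteq> {}" "\<not> D \<subseteq> A \<inter> G"
      using linkedD[OF lA, of "A \<inter> G"] B by blast
    then show ?thesis using B(3) by blast
  qed
  show "\<exists>D\<in>\<D>. D \<subseteq> F \<union> F' \<and> D \<inter> G \<noteq> {} \<and> \<not> D \<subseteq> G"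
    using *[OF assms(1)] *[OF assms(2)] G assms(3) by blast
qed

text \<open>The excess of any part bounds that of the whole: as long as the part is proper, some
  conflict crosses its boundary and can be attached without raising the excess.\<close>

lemma linked_extend:
  assumes "finite F" "\<forall>T\<in>F. card T = 3" "\<forall>D\<in>\<D>. tight D" "linked \<D> F"
    and "G \<subseteq> F" "G \<noteq> {}" "card (\<Union>G) \<le> card G + t"
  shows "card (\<Union>F) \<le> card F + t"
  using assms(5-7)
proof (induction "card (F - G)" arbitrary: G rule: less_induct)
  case less
  show ?case
  proof (cases "G = F")
    case False
    then obtain D where D: "D \<in> \<D>" "D \<subseteq> F" "D \<inter> G \<noteq> {}" "\<not> D \<subseteq> G"
      using linkedD[OF assms(4) less.prems(1,2)] by blast
    have fG: "finite G" "\<forall>T\<in>G. card T = 3"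
      using finite_subset[OF less.prems(1) assms(1)] less.prems(1) assms(2) by blast+
    show ?thesis
    proof (rule less.hyps[of "G \<union> D"])
      show "card (F - (G \<union> D)) < card (F - G)"
        by (rule psubset_card_mono) (use assms(1) D in auto)
      show "card (\<Union>(G \<union> D)) \<le> card (G \<union> D) + t"
        by (rule attach[OF fG]) (use D assms(3) less.prems in \<open>simp_all add: Int_commute\<close>)
    qed (use D less.prems in auto)
  qed (use less.prems in simp)
qed

lemma ex_maximal_card:
  assumes "P H0" "finite F" "\<And>H. P H \<Longrightarrow> H \<subseteq> F"
  shows "\<exists>H. P H \<and> (\<forall>H'. P H' \<longrightarrow> \<not> H \<subset> H')"
proof -
  have "\<forall>H. P H \<longrightarrow> card H < Suc (card F)"
    using card_mono[OF assms(2)] assms(3) by (simp add: less_Suc_eq_le)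
  with assms(1) obtain H where "P H" "\<forall>H'. P H' \<longrightarrow> card H' \<le> card H"
    using ex_has_greatest_nat[of P H0 card "Suc (card F)"] by blast
  then show ?thesis
    using psubset_card_mono[OF finite_subset[OF assms(3) assms(2)]] by (meson linorder_not_le)
qed

text \<open>A chain of other conflicts that joins two triples of \<open>C\<close> closes a cycle
  with \<open>C\<close>, and a point is saved where the cycle closes.\<close>

lemma linked_through_conflict:
  assumes F: "finite F" "\<forall>T\<in>F. card T = 3" and C: "tight C" "3 \<le> card C" "C \<notin> \<D>"
    and \<D>: "\<forall>D\<in>\<D>. tight D" and l: "linked \<D> F"
    and XY: "X \<in> F" "X \<in> C" "Y \<in> F" "Y \<in> C" "X \<noteq> Y"
  shows "card (\<Union>(F \<union> C)) \<le> card (F \<union> C) + 1"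
proof -
  \<comment> \<open>Grow from \<open>X\<close> while \<open>X\<close> is the only triple of
    \<open>C\<close> that is met. Past a maximal such part, the next conflict \<open>D\<close> must
    bring in another triple of \<open>C\<close>.\<close>
  define P where "P = (\<lambda>H. H \<subseteq> F \<and> H \<inter> C = {X} \<and> card (\<Union>H) \<le> card H + 2)"
  have "P {X}" using XY F by (auto simp: P_def)
  moreover have "\<And>H. P H \<Longrightarrow> H \<subseteq> F" by (simp add: P_def)
  ultimately obtain H where PH: "P H" and mx: "\<And>H'. P H' \<Longrightarrow> \<not> H \<subset> H'"
    using ex_maximal_card[of P "{X}" F, OF _ F(1)] by blast
  have H: "H \<subseteq> F" "H \<inter> C = {X}" "card (\<Union>H) \<le> card H + 2" using PH by (auto simp: P_def)
  have "H \<noteq> F" using H XY by blast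
  then obtain D where D: "D \<in> \<D>" "D \<subseteq> F" "D \<inter> H \<noteq> {}" "\<not> D \<subseteq> H"
    using linkedD[OF l, of H] H by blast
  have tD: "tight D" using D \<D> by auto
  have fH: "finite H" "\<forall>T\<in>H. card T = 3" using finite_subset[OF H(1) F(1)] H(1) F(2) by blast+
  let ?H = "H \<union> D"
  have fH': "finite ?H" "\<forall>T\<in>?H. card T = 3" using finite_subset[of ?H F] H(1) D(2) F by blast+
  have le': "card (\<Union>?H) \<le> card ?H + 2" by (rule attach[OF fH tD]) (use D H in \<open>simp_all add: Int_commute\<close>)
  have "H \<subset> ?H" using D by auto
  then have "\<not> P ?H" using mx by auto
  then have ne: "?H \<inter> C \<noteq> {X}" using le' D H by (auto simp: P_def)
  have X: "X \<in> ?H \<inter> C" using H by auto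
  then have fi: "finite (?H \<inter> C)" using fH' by auto
  then obtain Z where "Z \<in> ?H \<inter> C" "Z \<noteq> X" using ne X by auto
  then have two: "2 \<le> card (?H \<inter> C)" using X fi card_mono[of "?H \<inter> C" "{X,Z}"] by auto
  have strict: "card (\<Union>(?H \<union> C)) \<le> card (?H \<union> C) + 1"
  proof (cases "C \<subseteq> ?H")
    case False
    have "card (\<Union>(?H \<inter> C)) \<ge> card (?H \<inter> C) + 3"
      by (rule tight_psub) (use C False two in auto)
    moreover have "card (\<Union>(?H \<inter> C)) \<le> card (\<Union>?H \<inter> \<Union>C)"
      by (rule card_mono) (use finite_Int_Union[OF C(1)] in auto)
    ultimately show ?thesis using attach_strict[OF fH' C(1) le', of 3] by simp
  next
    \<comment> \<open>Here \<open>D\<close> swallows all of \<open>C\<close> except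
      \<open>X\<close>, so the saving occurs when \<open>D\<close> is attached. As a proper part of
      the conflict \<open>D\<close> with at least two triples, \<open>C - {X}\<close> spans all
      points of \<open>C\<close>; thus \<open>D\<close> meets the old part in the points of
      \<open>X\<close> without containing \<open>X\<close>.\<close>
    case CH: True
    have CD: "Z \<in> D" if "Z \<in> C" "Z \<noteq> X" for Z
      using that by (metis CH H(2) IntI UnE singletonD subsetD)
    have XD: "X \<notin> D"
    proof
      assume "X \<in> D"
      then have "C \<subseteq> D" using CD by blast
      then show False using tight_subset_eq[OF C(1) tD] C D by auto
    qed
    have sub: "C - {X} \<subseteq> D" using CD by blast
    obtain T where T: "T \<in> H" "T \<in> D" using D by auto
    have "T \<noteq> X" using XD T by auto
    then have "T \<notin> C" using T H by auto
    then have neq: "C - {X} \<noteq> D" using T by auto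
    have cc: "card (C - {X}) = card C - 1" using XY by simp
    have "card C + 2 \<le> card (\<Union>(C - {X}))"
      using tight_psub[OF tD sub neq] cc C(2) by simp
    then have "\<Union>(C - {X}) = \<Union>C"
      using card_seteq[of "\<Union>C" "\<Union>(C - {X})"] tight_le[OF C(1)] finite_Int_Union[OF C(1), of UNIV]
      by (metis Int_UNIV_left Diff_subset Union_mono le_trans)
    then have "X \<subseteq> \<Union>D" using sub XY by blast
    moreover have "X \<subseteq> \<Union>H" using H(2) by (intro Union_upper) (metis IntD1 insertI1)
    ultimately have "card (\<Union>?H) \<le> card ?H + 1"
    proof (intro attach_overlap[where e = X])
      fix T' assume "H \<inter> D = {T'}" 
      then have "T' \<noteq> X" "card T' = 3" using XD fH by auto
      then show "\<not> X \<subseteq> T'" using XY F by (metis card_subset_eq card_ge_0_finite zero_less_numeral)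
    qed (use fH tD D H XY in \<open>simp_all add: Int_commute\<close>)
    moreover have "?H \<union> C = ?H" using CH by auto
    ultimately show ?thesis by simp
  qed
  have l': "linked (insert C \<D>) (F \<union> C)"
  proof (rule linked_Un)
    show "linked (insert C \<D>) F" by (rule linked_mono[OF l]) blast
    show "linked (insert C \<D>) C" by (rule linked_conflict) blast
    show "F \<inter> C \<noteq> {}" using XY by blast
  qed
  have "finite (F \<union> C)" using F(1) tight_finite[OF C(1)] by simp
  moreover have "\<forall>T\<in>F \<union> C. card T = 3" using F(2) tight_card3[OF C(1)] by blast
  moreover have "\<forall>D\<in>insert C \<D>. tight D" using C(1) \<D> by blast
  moreover have "?H \<union> C \<subseteq> F \<union> C" "?H \<union> C \<noteq> {}" using H D by blast+
  ultimately show ?thesis using linked_extend[of "F \<union> C" "insert C \<D>" "?H \<union> C"] l' strict by blast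
qed

text \<open>The analogue for pair conflicts. Since \<open>nd\<close> excludes direct conflicts
  between \<open>T\<close> and another triple over \<open>e\<close>, such a triple is reached by a
  detour, and \<open>e\<close> becomes an extra overlap.\<close>

lemma linked_through_edge:
  assumes F: "finite F" "\<forall>T\<in>F. card T = 3" and \<D>: "\<forall>D\<in>\<D>. tight D" and l: "linked \<D> F"
    and T: "T \<in> F" "T1 \<in> F" "T1 \<noteq> T" and e: "e \<subseteq> T" "e \<subseteq> T1" "card e = 2"
    and nd: "\<And>T'. e \<subseteq> T' \<Longrightarrow> {T,T'} \<notin> \<D>"
  shows "card (\<Union>F) \<le> card F + 1"
proof -
  define P where "P = (\<lambda>H. H \<subseteq> F \<and> T \<in> H \<and> (\<forall>T'\<in>H. e \<subseteq> T' \<longrightarrow> T' = T) \<and> card (\<Union>H) \<le> card H + 2)"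
  have "P {T}" using T F by (auto simp: P_def)
  moreover have "\<And>H. P H \<Longrightarrow> H \<subseteq> F" by (simp add: P_def)
  ultimately obtain H where PH: "P H" and mx: "\<And>H'. P H' \<Longrightarrow> \<not> H \<subset> H'"
    using ex_maximal_card[of P "{T}" F, OF _ F(1)] by blast
  have H: "H \<subseteq> F" "T \<in> H" "\<forall>T'\<in>H. e \<subseteq> T' \<longrightarrow> T' = T" "card (\<Union>H) \<le> card H + 2"
    using PH by (auto simp: P_def)
  have "H \<noteq> F" using H T e by blast
  then obtain D where D: "D \<in> \<D>" "D \<subseteq> F" "D \<inter> H \<noteq> {}" "\<not> D \<subseteq> H"
    using linkedD[OF l, of H] H by blast
  have tD: "tight D" using D \<D> by auto
  have fH: "finite H" "\<forall>T\<in>H. card T = 3" using finite_subset[OF H(1) F(1)] H(1) F(2) by blast+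
  let ?H = "H \<union> D"
  have le': "card (\<Union>?H) \<le> card ?H + 2" by (rule attach[OF fH tD]) (use D H in \<open>simp_all add: Int_commute\<close>)
  have "H \<subset> ?H" using D by auto
  then have "\<not> P ?H" using mx by auto
  then obtain T' where T': "T' \<in> D" "T' \<notin> H" "e \<subseteq> T'" "T' \<noteq> T" using le' D H by (auto simp: P_def)
  \<comment> \<open>Otherwise \<open>{T, T'}\<close> would be a proper part of \<open>D\<close> by
    \<open>nd\<close> and span five points, but two triples sharing \<open>e\<close> span at most
    four.\<close>
  have TD: "T \<notin> D"
  proof
    assume TD: "T \<in> D"
    show False
    proof (cases "D = {T,T'}")
      case True then show False using nd T' D by auto
    next
      case False
      have c3: "card T = 3" "card T' = 3" using TD T' tD tight_card3 by auto
      then have fin: "finite T" "finite T'" by (auto intro: card_ge_0_finite)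
      have "card {T,T'} + 3 \<le> card (\<Union>{T,T'})" by (rule tight_psub[OF tD]) (use False TD T' in auto)
      then have "5 \<le> card (T \<union> T')" using T' by simp
      moreover have "card e \<le> card (T \<inter> T')" by (rule card_mono) (use fin e T' in auto)
      ultimately show False using card_Un_Int[OF fin] c3 e by simp
    qed
  qed
  have "card (\<Union>?H) \<le> card ?H + 1"
  proof (rule attach_overlap[where e = e])
    show "e \<subseteq> \<Union>H \<inter> \<Union>D" using H e T' by blast
    fix S assume "H \<inter> D = {S}" then show "\<not> e \<subseteq> S" using H TD by auto
  qed (use fH tD D H in \<open>simp_all add: Int_commute\<close>)
  moreover have "?H \<subseteq> F" "?H \<noteq> {}" using H D by blast+
  ultimately show ?thesis using linked_extend[OF F \<D> l] by blast
qed

section \<open>Product measures on finite sets\<close>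

text \<open>The Bernoulli product measure as a finite weighted sum, so that single coordinates can
  be split off and inductions run over \<open>I\<close>.\<close>

definition expect :: "real \<Rightarrow> 'i set \<Rightarrow> ('i set \<Rightarrow> real) \<Rightarrow> real" where
  "expect p I f = (\<Sum>\<omega>\<in>Pow I. p ^ card \<omega> * (1 - p) ^ card (I - \<omega>) * f \<omega>)"

lemma expect_empty [simp]: "expect p {} f = f {}"
  by (simp add: expect_def)

lemma expect_insert:
  assumes "finite I" "x \<notin> I"
  shows "expect p (insert x I) f = (1 - p) * expect p I f + p * expect p I (\<lambda>\<omega>. f (insert x \<omega>))"
proof -
  have disj: "Pow I \<inter> insert x ` Pow I = {}" using assms(2) by auto
  have inj: "inj_on (insert x) (Pow I)" using assms(2) by (auto simp: inj_on_def)
  have a: "p ^ card \<omega> * (1 - p) ^ card (insert x I - \<omega>) * f \<omega> =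
      (1 - p) * (p ^ card \<omega> * (1 - p) ^ card (I - \<omega>) * f \<omega>)" if "\<omega> \<in> Pow I" for \<omega>
  proof -
    have "insert x I - \<omega> = insert x (I - \<omega>)" "x \<notin> I - \<omega>" "finite (I - \<omega>)" using that assms by auto
    then show ?thesis by simp
  qed
  have b: "p ^ card (insert x \<omega>) * (1 - p) ^ card (insert x I - insert x \<omega>) * f (insert x \<omega>) =
      p * (p ^ card \<omega> * (1 - p) ^ card (I - \<omega>) * f (insert x \<omega>))" if "\<omega> \<in> Pow I" for \<omega>
  proof -
    have "insert x I - insert x \<omega> = I - \<omega>" "x \<notin> \<omega>" "finite \<omega>"
      using that assms by (auto intro: finite_subset)
    then show ?thesis by simp
  qed
  let ?w = "\<lambda>\<omega>. p ^ card \<omega> * (1 - p) ^ card (insert x I - \<omega>) * f \<omega>"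
  have "expect p (insert x I) f = sum ?w (Pow I) + sum ?w (insert x ` Pow I)"
    unfolding expect_def Pow_insert using assms(1) disj by (intro sum.union_disjoint) auto
  also have "sum ?w (Pow I) = (1 - p) * expect p I f"
    unfolding expect_def sum_distrib_left by (rule sum.cong[OF refl a])
  also have "sum ?w (insert x ` Pow I) = p * expect p I (\<lambda>\<omega>. f (insert x \<omega>))"
    unfolding expect_def sum_distrib_left sum.reindex[OF inj] o_def by (rule sum.cong[OF refl b])
  finally show ?thesis .
qed

lemma expect_cong: "(\<And>\<omega>. \<omega> \<subseteq> I \<Longrightarrow> f \<omega> = g \<omega>) \<Longrightarrow> expect p I f = expect p I g"
  by (auto simp: expect_def intro: sum.cong)

lemma expect_mono:
  "0 \<le> p \<Longrightarrow> p \<le> 1 \<Longrightarrow> (\<And>\<omega>. \<omega> \<subseteq> I \<Longrightarrow> f \<omega> \<le> g \<omega>) \<Longrightarrow> expect p I f \<le> expect p I g"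
  unfolding expect_def by (intro sum_mono mult_left_mono) auto

lemma expect_add: "expect p I (\<lambda>\<omega>. f \<omega> + g \<omega>) = expect p I f + expect p I g"
  by (simp add: expect_def sum.distrib distrib_left)

lemma expect_diff: "expect p I (\<lambda>\<omega>. f \<omega> - g \<omega>) = expect p I f - expect p I g"
  by (simp add: expect_def sum_subtractf right_diff_distrib)

lemma expect_sum: "expect p I (\<lambda>\<omega>. \<Sum>a\<in>A. f a \<omega>) = (\<Sum>a\<in>A. expect p I (f a))"
  by (simp add: expect_def sum_distrib_left sum.swap[of _ _ A])

lemma expect_const [simp]: "finite I \<Longrightarrow> expect p I (\<lambda>_. c) = c"
  by (induction I rule: finite_induct) (simp_all add: expect_insert algebra_simps)

lemma expect_nonneg: "0 \<le> p \<Longrightarrow> p \<le> 1 \<Longrightarrow> (\<And>\<omega>. \<omega> \<subseteq> I \<Longrightarrow> 0 \<le> f \<omega>) \<Longrightarrow> 0 \<le> expect p I f"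
  unfolding expect_def by (intro sum_nonneg mult_nonneg_nonneg) auto

lemma expect_le_1:
  assumes "finite I" "0 \<le> p" "p \<le> 1" "\<And>\<omega>. \<omega> \<subseteq> I \<Longrightarrow> f \<omega> \<le> 1"
  shows "expect p I f \<le> 1"
  using expect_mono[of p I f "\<lambda>_. 1"] assms by simp

lemma expect_contains:
  assumes "finite I"
  shows "expect p I (\<lambda>\<omega>. of_bool (F \<inter> I \<subseteq> \<omega>)) = p ^ card (F \<inter> I)"
  using assms
proof (induction I rule: finite_induct)
  case (insert x I)
  show ?case
  proof (cases "x \<in> F")
    case True
    have "expect p I (\<lambda>\<omega>. of_bool (F \<inter> insert x I \<subseteq> \<omega>)) = expect p I (\<lambda>_. 0)"
      by (rule expect_cong) (use True insert in auto)
    moreover have "expect p I (\<lambda>\<omega>. of_bool (F \<inter> insert x I \<subseteq> insert x \<omega>)) = expect p I (\<lambda>\<omega>. of_bool (F \<inter> I \<subseteq> \<omega>))"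
      by (rule expect_cong) (use True insert in auto)
    moreover have "F \<inter> insert x I = insert x (F \<inter> I)" using True by auto
    ultimately show ?thesis using insert by (simp add: expect_insert)
  next
    case False
    have "expect p I (\<lambda>\<omega>. of_bool (F \<inter> I \<subseteq> insert x \<omega>)) = expect p I (\<lambda>\<omega>. of_bool (F \<inter> I \<subseteq> \<omega>))"
      by (rule expect_cong) (use False insert in auto)
    moreover have "F \<inter> insert x I = F \<inter> I" using False by auto
    ultimately show ?thesis using insert by (simp add: expect_insert algebra_simps)
  qed
qed simp

lemma expect_subset: "finite I \<Longrightarrow> F \<subseteq> I \<Longrightarrow> expect p I (\<lambda>\<omega>. of_bool (F \<subseteq> \<omega>)) = p ^ card F"
  using expect_contains[of I p F] by (simp add: Int_absorb2)

lemma expect_indep: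
  assumes I: "finite I" "x \<in> I" and f: "\<And>\<omega>. \<omega> \<subseteq> I \<Longrightarrow> x \<notin> \<omega> \<Longrightarrow> f (insert x \<omega>) = f \<omega>"
  shows "expect p I (\<lambda>\<omega>. of_bool (x \<in> \<omega>) * f \<omega>) = p * expect p I f"
proof -
  define J where "J = I - {x}"
  have J: "I = insert x J" "finite J" "x \<notin> J" using I by (auto simp: J_def)
  have a: "expect p J (\<lambda>\<omega>. of_bool (x \<in> \<omega>) * f \<omega>) = expect p J (\<lambda>_. 0)"
    by (rule expect_cong) (use J in auto)
  have b: "expect p J (\<lambda>\<omega>. f (insert x \<omega>)) = expect p J f"
    by (rule expect_cong) (use J f in auto)
  show ?thesis using J a b by (simp add: expect_insert algebra_simps)
qed

lemma expect_reindex: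
  assumes I: "finite I" and \<phi>: "bij_betw \<phi> I I"
  shows "expect p I f = expect p I (\<lambda>\<omega>. f (\<phi> ` \<omega>))"
proof -
  have bij: "bij_betw ((`) \<phi>) (Pow I) (Pow I)" using \<phi> by (rule bij_betw_Pow)
  have "card (\<phi> ` \<omega>) = card \<omega>" "card (I - \<phi> ` \<omega>) = card (I - \<omega>)" if "\<omega> \<in> Pow I" for \<omega>
  proof -
    have inj: "inj_on \<phi> I" and im: "\<phi> ` I = I" using \<phi> by (auto simp: bij_betw_def)
    show "card (\<phi> ` \<omega>) = card \<omega>" using that inj by (auto intro!: card_image intro: inj_on_subset)
    have "I - \<phi> ` \<omega> = \<phi> ` (I - \<omega>)" using inj_on_image_set_diff[OF inj, of I \<omega>] that im by auto
    then show "card (I - \<phi> ` \<omega>) = card (I - \<omega>)" using inj by (auto intro!: card_image intro: inj_on_subset)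
  qed
  then show ?thesis unfolding expect_def
    by (subst sum.reindex_bij_betw[OF bij, symmetric]) (auto intro: sum.cong)
qed

lemma expect_union_bound:
  assumes I: "finite I" "0 \<le> p" "p \<le> 1" and \<F>: "finite \<F>"
    and f: "\<And>\<omega>. \<omega> \<subseteq> I \<Longrightarrow> f \<omega> \<le> 1" "\<And>\<omega>. \<omega> \<subseteq> I \<Longrightarrow> 0 < f \<omega> \<Longrightarrow> \<exists>F\<in>\<F>. F \<inter> I \<subseteq> \<omega>"
  shows "expect p I f \<le> (\<Sum>F\<in>\<F>. p ^ card (F \<inter> I))"
proof -
  have "expect p I f \<le> expect p I (\<lambda>\<omega>. \<Sum>F\<in>\<F>. of_bool (F \<inter> I \<subseteq> \<omega>))"
  proof (rule expect_mono[OF I(2,3)])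
    fix \<omega> assume \<omega>: "\<omega> \<subseteq> I"
    show "f \<omega> \<le> (\<Sum>F\<in>\<F>. of_bool (F \<inter> I \<subseteq> \<omega>))"
    proof (cases "0 < f \<omega>")
      case True
      then obtain F where F: "F \<in> \<F>" "F \<inter> I \<subseteq> \<omega>" using f \<omega> by blast
      have "f \<omega> \<le> of_bool (F \<inter> I \<subseteq> \<omega>)" using f(1)[OF \<omega>] F by simp
      also have "\<dots> \<le> (\<Sum>F\<in>\<F>. of_bool (F \<inter> I \<subseteq> \<omega>))"
        by (rule member_le_sum) (use F \<F> in auto)
      finally show ?thesis .
    next
      case False
      moreover have "0 \<le> (\<Sum>F\<in>\<F>. of_bool (F \<inter> I \<subseteq> \<omega>) :: real)" by (rule sum_nonneg) simp
      ultimately show ?thesis by linarith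
    qed
  qed
  also have "\<dots> = (\<Sum>F\<in>\<F>. p ^ card (F \<inter> I))"
    by (simp add: expect_sum expect_contains I)
  finally show ?thesis .
qed

text \<open>The witnesses \<open>F\<close> are intersected with the shrinking index set \<open>I\<close> so that the same
  families serve through the induction, whatever was revealed about the removed coordinates.\<close>
lemma covariance_le_witnesses:
  fixes f g :: "'i set \<Rightarrow> real"
  assumes "finite I" "0 \<le> p" "p \<le> 1"
    and "\<And>x. finite (\<F> x)" "\<And>x. finite (\<G> x)"
    and "\<And>\<omega>. \<omega> \<subseteq> I \<Longrightarrow> 0 \<le> f \<omega> \<and> f \<omega> \<le> 1" "\<And>\<omega>. \<omega> \<subseteq> I \<Longrightarrow> 0 \<le> g \<omega> \<and> g \<omega> \<le> 1"
    and "\<And>x \<omega>. x \<in> I \<Longrightarrow> \<omega> \<subseteq> I - {x} \<Longrightarrow> f (insert x \<omega>) \<noteq> f \<omega> \<Longrightarrow> \<exists>F\<in>\<F> x. F \<inter> (I - {x}) \<subseteq> \<omega>"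
    and "\<And>x \<omega>. x \<in> I \<Longrightarrow> \<omega> \<subseteq> I - {x} \<Longrightarrow> g (insert x \<omega>) \<noteq> g \<omega> \<Longrightarrow> \<exists>F\<in>\<G> x. F \<inter> (I - {x}) \<subseteq> \<omega>"
  shows "\<bar>expect p I (\<lambda>\<omega>. f \<omega> * g \<omega>) - expect p I f * expect p I g\<bar>
    \<le> (\<Sum>x\<in>I. p * (\<Sum>F\<in>\<F> x. \<Sum>G\<in>\<G> x. p ^ card ((F \<union> G) \<inter> (I - {x}))))"
  using assms
proof (induction I arbitrary: f g \<F> \<G> rule: finite_induct)
  case empty
  then show ?case by simp
next
  case (insert v I)
  define f1 where "f1 = (\<lambda>\<omega>. f (insert v \<omega>))"
  define g1 where "g1 = (\<lambda>\<omega>. g (insert v \<omega>))"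
  \<comment> \<open>Once \<open>v\<close> is known to be absent, only witnesses avoiding
    \<open>v\<close> can occur.\<close>
  define \<F>0 where "\<F>0 = (\<lambda>x. {F \<in> \<F> x. v \<notin> F})"
  define \<G>0 where "\<G>0 = (\<lambda>x. {F \<in> \<G> x. v \<notin> F})"
  note p = \<open>0 \<le> p\<close> \<open>p \<le> 1\<close>
  note fin = \<open>\<And>x. finite (\<F> x)\<close> \<open>\<And>x. finite (\<G> x)\<close>
  note fr = insert.prems(5) note gr = insert.prems(6)
  note fp = insert.prems(7) note gp = insert.prems(8)
  have fin0: "finite (\<F>0 x)" "finite (\<G>0 x)" for x using fin by (auto simp: \<F>0_def \<G>0_def)
  define W where "W = (\<lambda>(I' :: 'i set) \<F>' \<G>' x. \<Sum>F\<in>\<F>' x. \<Sum>G\<in>\<G>' x. p ^ card ((F \<union> G) \<inter> (I' - {x})))"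
  have cov0: "\<bar>expect p I (\<lambda>\<omega>. f \<omega> * g \<omega>) - expect p I f * expect p I g\<bar> \<le> (\<Sum>x\<in>I. p * W I \<F>0 \<G>0 x)"
    unfolding W_def
  proof (rule insert.IH[OF p fin0])
    show "0 \<le> f \<omega> \<and> f \<omega> \<le> 1" "0 \<le> g \<omega> \<and> g \<omega> \<le> 1" if "\<omega> \<subseteq> I" for \<omega>
      using fr[of \<omega>] gr[of \<omega>] that by auto
    fix x \<omega> assume x: "x \<in> I" "\<omega> \<subseteq> I - {x}"
    then have xv: "x \<noteq> v" "v \<notin> \<omega>" using insert by auto
    show "\<exists>F\<in>\<F>0 x. F \<inter> (I - {x}) \<subseteq> \<omega>" if "f (insert x \<omega>) \<noteq> f \<omega>"
      using fp[of x \<omega>] that x xv unfolding \<F>0_def by blast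
    show "\<exists>F\<in>\<G>0 x. F \<inter> (I - {x}) \<subseteq> \<omega>" if "g (insert x \<omega>) \<noteq> g \<omega>"
      using gp[of x \<omega>] that x xv unfolding \<G>0_def by blast
  qed
  have cov1: "\<bar>expect p I (\<lambda>\<omega>. f1 \<omega> * g1 \<omega>) - expect p I f1 * expect p I g1\<bar> \<le> (\<Sum>x\<in>I. p * W I \<F> \<G> x)"
    unfolding W_def
  proof (rule insert.IH[OF p fin])
    show "0 \<le> f1 \<omega> \<and> f1 \<omega> \<le> 1" "0 \<le> g1 \<omega> \<and> g1 \<omega> \<le> 1" if "\<omega> \<subseteq> I" for \<omega>
      using fr[of "insert v \<omega>"] gr[of "insert v \<omega>"] that by (auto simp: f1_def g1_def)
    fix x \<omega> assume x: "x \<in> I" "\<omega> \<subseteq> I - {x}"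
    then have xv: "x \<noteq> v" "v \<notin> \<omega>" using insert by auto
    have sub: "insert v \<omega> \<subseteq> insert v I - {x}" using x xv by auto
    show "\<exists>F\<in>\<F> x. F \<inter> (I - {x}) \<subseteq> \<omega>" if "f1 (insert x \<omega>) \<noteq> f1 \<omega>"
    proof -
      have "f (insert x (insert v \<omega>)) \<noteq> f (insert v \<omega>)" using that by (simp add: f1_def insert_commute)
      then obtain F where "F \<in> \<F> x" "F \<inter> (insert v I - {x}) \<subseteq> insert v \<omega>" using fp[of x "insert v \<omega>"] x sub by blast
      then show ?thesis using insert(2) by blast
    qed
    show "\<exists>F\<in>\<G> x. F \<inter> (I - {x}) \<subseteq> \<omega>" if "g1 (insert x \<omega>) \<noteq> g1 \<omega>"
    proof -
      have "g (insert x (insert v \<omega>)) \<noteq> g (insert v \<omega>)" using that by (simp add: g1_def insert_commute)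
      then obtain F where "F \<in> \<G> x" "F \<inter> (insert v I - {x}) \<subseteq> insert v \<omega>" using gp[of x "insert v \<omega>"] x sub by blast
      then show ?thesis using insert(2) by blast
    qed
  qed
  \<comment> \<open>Averaging the two conditional bounds restores the full weight exactly: a pair of
    witnesses using \<open>v\<close> survives only if \<open>v\<close> is present, at cost
    \<open>p\<close>; any other pair survives in both cases.\<close>
  have comb: "(1 - p) * W I \<F>0 \<G>0 x + p * W I \<F> \<G> x = W (insert v I) \<F> \<G> x" if x: "x \<in> I" for x
  proof -
    have xv: "x \<noteq> v" using x insert by auto
    have w0: "W I \<F>0 \<G>0 x = (\<Sum>F\<in>\<F> x. \<Sum>G\<in>\<G> x. of_bool (v \<notin> F \<union> G) * p ^ card ((F \<union> G) \<inter> (I - {x})))"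
      unfolding W_def \<F>0_def \<G>0_def
      by (auto simp: sum.inter_filter[OF fin(1)] sum.inter_filter[OF fin(2)] intro!: sum.cong sum.neutral split: if_splits)
    have "(1 - p) * (of_bool (v \<notin> F \<union> G) * p ^ card ((F \<union> G) \<inter> (I - {x}))) + p * p ^ card ((F \<union> G) \<inter> (I - {x}))
        = p ^ card ((F \<union> G) \<inter> (insert v I - {x}))" for F G
    proof (cases "v \<in> F \<union> G")
      case True
      have "(F \<union> G) \<inter> (insert v I - {x}) = insert v ((F \<union> G) \<inter> (I - {x}))" using True xv by auto
      moreover have "v \<notin> (F \<union> G) \<inter> (I - {x})" "finite ((F \<union> G) \<inter> (I - {x}))" using insert by auto
      ultimately have "card ((F \<union> G) \<inter> (insert v I - {x})) = Suc (card ((F \<union> G) \<inter> (I - {x})))"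
        by (metis card_insert_disjoint)
      then show ?thesis using True by simp
    next
      case False
      have "(F \<union> G) \<inter> (insert v I - {x}) = (F \<union> G) \<inter> (I - {x})" using False by auto
      then show ?thesis using False by (simp add: algebra_simps)
    qed
    then show ?thesis unfolding w0 unfolding W_def
      by (simp add: sum_distrib_left flip: sum.distrib)
  qed
  have vI: "insert v I - {v} = I" using insert by auto
  have d: "\<bar>expect p I h1 - expect p I h0\<bar> \<le> (\<Sum>F\<in>\<H>. p ^ card (F \<inter> I))"
    if H: "finite \<H>" and h: "\<And>\<omega>. \<omega> \<subseteq> I \<Longrightarrow> 0 \<le> h1 \<omega> \<and> h1 \<omega> \<le> 1 \<and> 0 \<le> h0 \<omega> \<and> h0 \<omega> \<le> 1"
      "\<And>\<omega>. \<omega> \<subseteq> I \<Longrightarrow> h1 \<omega> \<noteq> h0 \<omega> \<Longrightarrow> \<exists>F\<in>\<H>. F \<inter> I \<subseteq> \<omega>" for h1 h0 :: "'i set \<Rightarrow> real" and \<H>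
  proof -
    have "\<bar>expect p I h1 - expect p I h0\<bar> \<le> expect p I (\<lambda>\<omega>. \<bar>h1 \<omega> - h0 \<omega>\<bar>)"
    proof -
      have "expect p I (\<lambda>\<omega>. h1 \<omega> - h0 \<omega>) \<le> expect p I (\<lambda>\<omega>. \<bar>h1 \<omega> - h0 \<omega>\<bar>)"
        "expect p I (\<lambda>\<omega>. h0 \<omega> - h1 \<omega>) \<le> expect p I (\<lambda>\<omega>. \<bar>h1 \<omega> - h0 \<omega>\<bar>)"
        by (rule expect_mono; use p in force)+
      then show ?thesis by (simp add: expect_diff)
    qed
    also have "\<dots> \<le> (\<Sum>F\<in>\<H>. p ^ card (F \<inter> I))"
    proof (rule expect_union_bound[OF insert(1) p H])
      fix \<omega> assume "\<omega> \<subseteq> I"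
      then show "\<bar>h1 \<omega> - h0 \<omega>\<bar> \<le> 1" using h(1)[of \<omega>] by auto
      assume "0 < \<bar>h1 \<omega> - h0 \<omega>\<bar>" then show "\<exists>F\<in>\<H>. F \<inter> I \<subseteq> \<omega>" using h(2) \<open>\<omega> \<subseteq> I\<close> by auto
    qed
    finally show ?thesis .
  qed
  have df: "\<bar>expect p I f1 - expect p I f\<bar> \<le> (\<Sum>F\<in>\<F> v. p ^ card (F \<inter> I))"
  proof (rule d[OF fin(1)])
    fix \<omega> assume w: "\<omega> \<subseteq> I"
    then show "0 \<le> f1 \<omega> \<and> f1 \<omega> \<le> 1 \<and> 0 \<le> f \<omega> \<and> f \<omega> \<le> 1"
      using fr[of \<omega>] fr[of "insert v \<omega>"] unfolding f1_def by blast
    show "\<exists>F\<in>\<F> v. F \<inter> I \<subseteq> \<omega>" if "f1 \<omega> \<noteq> f \<omega>" using fp[of v \<omega>] that w vI by (simp add: f1_def)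
  qed
  have dg: "\<bar>expect p I g1 - expect p I g\<bar> \<le> (\<Sum>F\<in>\<G> v. p ^ card (F \<inter> I))"
  proof (rule d[OF fin(2)])
    fix \<omega> assume w: "\<omega> \<subseteq> I"
    then show "0 \<le> g1 \<omega> \<and> g1 \<omega> \<le> 1 \<and> 0 \<le> g \<omega> \<and> g \<omega> \<le> 1"
      using gr[of \<omega>] gr[of "insert v \<omega>"] unfolding g1_def by blast
    show "\<exists>F\<in>\<G> v. F \<inter> I \<subseteq> \<omega>" if "g1 \<omega> \<noteq> g \<omega>" using gp[of v \<omega>] that w vI by (simp add: g1_def)
  qed
  have prod: "\<bar>(expect p I f1 - expect p I f) * (expect p I g1 - expect p I g)\<bar> \<le> W (insert v I) \<F> \<G> v"
  proof -
    have "\<bar>(expect p I f1 - expect p I f) * (expect p I g1 - expect p I g)\<bar>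
        \<le> (\<Sum>F\<in>\<F> v. p ^ card (F \<inter> I)) * (\<Sum>G\<in>\<G> v. p ^ card (G \<inter> I))"
      unfolding abs_mult by (rule mult_mono) (use df dg p in \<open>auto intro: sum_nonneg\<close>)
    also have "\<dots> = (\<Sum>F\<in>\<F> v. \<Sum>G\<in>\<G> v. p ^ (card (F \<inter> I) + card (G \<inter> I)))"
      by (simp add: sum_product power_add)
    also have "\<dots> \<le> W (insert v I) \<F> \<G> v"
      unfolding W_def vI
      by (intro sum_mono power_decreasing p) (simp add: Int_Un_distrib2 card_Un_le)
    finally show ?thesis .
  qed
  \<comment> \<open>The law of total covariance for the coordinate \<open>v\<close>: two conditional
    covariances, and the covariance of the conditional means, which is the product of the influences
    of \<open>v\<close> on \<open>f\<close> and \<open>g\<close>.\<close>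
  have eq: "expect p (insert v I) (\<lambda>\<omega>. f \<omega> * g \<omega>) - expect p (insert v I) f * expect p (insert v I) g
     = (1 - p) * (expect p I (\<lambda>\<omega>. f \<omega> * g \<omega>) - expect p I f * expect p I g)
      + p * (expect p I (\<lambda>\<omega>. f1 \<omega> * g1 \<omega>) - expect p I f1 * expect p I g1)
      + (1 - p) * (p * ((expect p I f1 - expect p I f) * (expect p I g1 - expect p I g)))"
    by (simp add: expect_insert insert f1_def g1_def algebra_simps)
  have "\<bar>expect p (insert v I) (\<lambda>\<omega>. f \<omega> * g \<omega>) - expect p (insert v I) f * expect p (insert v I) g\<bar>
     \<le> (1 - p) * (\<Sum>x\<in>I. p * W I \<F>0 \<G>0 x) + p * (\<Sum>x\<in>I. p * W I \<F> \<G> x)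
       + p * W (insert v I) \<F> \<G> v"
  proof -
    have 1: "\<bar>(1 - p) * a\<bar> \<le> (1 - p) * b" if "\<bar>a\<bar> \<le> b" for a b
      using that p by (simp add: abs_mult mult_left_mono)
    have 2: "\<bar>p * a\<bar> \<le> p * b" if "\<bar>a\<bar> \<le> b" for a b
      using that p by (simp add: abs_mult mult_left_mono)
    have 3: "\<bar>(1 - p) * a\<bar> \<le> b" if "\<bar>a\<bar> \<le> b" for a b :: real
    proof -
      have "(1 - p) * \<bar>a\<bar> \<le> 1 * \<bar>a\<bar>" using p by (intro mult_right_mono) auto
      then show ?thesis using that p by (simp add: abs_mult)
    qed
    show ?thesis unfolding eq using 1[OF cov0] 2[OF cov1] 3[OF 2[OF prod]] by linarith
  qed
  also have "\<dots> = (\<Sum>x\<in>I. p * W (insert v I) \<F> \<G> x) + p * W (insert v I) \<F> \<G> v"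
  proof -
    have "(1 - p) * (\<Sum>x\<in>I. p * W I \<F>0 \<G>0 x) + p * (\<Sum>x\<in>I. p * W I \<F> \<G> x)
      = (\<Sum>x\<in>I. p * ((1 - p) * W I \<F>0 \<G>0 x + p * W I \<F> \<G> x))"
      by (simp add: sum_distrib_left sum.distrib sum_subtractf algebra_simps)
    also have "\<dots> = (\<Sum>x\<in>I. p * W (insert v I) \<F> \<G> x)" by (simp add: comb)
    finally show ?thesis by simp
  qed
  also have "\<dots> = (\<Sum>x\<in>insert v I. p * W (insert v I) \<F> \<G> x)" using insert by simp
  finally show ?case by (simp add: W_def)
qed

section \<open>The selection process\<close>

definition triples :: "nat \<Rightarrow> nat set set" where
  "triples n = {T. T \<subseteq> {..<n} \<and> card T = 3}"

definition conflicts :: "nat \<Rightarrow> nat \<Rightarrow> nat set set set" where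
  "conflicts k n = {C. tight C \<and> card C \<le> k \<and> \<Union>C \<subseteq> {..<n}}"

text \<open>A pair \<open>(X, i) \<in> \<omega>\<close> means that \<open>X\<close> is proposed in round \<open>i\<close>.\<close>
primrec sel :: "'t set set \<Rightarrow> ('t \<times> nat) set \<Rightarrow> nat \<Rightarrow> 't set" where
  "sel D \<omega> 0 = {}"
| "sel D \<omega> (Suc i) = sel D \<omega> i \<union>
     {X. (X, i) \<in> \<omega> \<and> \<not> (\<exists>C\<in>D. X \<in> C \<and> C - {X} \<subseteq> sel D \<omega> i \<union> {Y. (Y, i) \<in> \<omega>})}"

lemma sel_born: "X \<in> sel D \<omega> i \<Longrightarrow> \<exists>l<i. (X, l) \<in> \<omega>"
  by (induction i) (auto simp: less_Suc_eq)

lemma sel_subset_fst: "sel D \<omega> i \<subseteq> fst ` \<omega>"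
  using sel_born by force

lemma sel_mono: "i \<le> j \<Longrightarrow> sel D \<omega> i \<subseteq> sel D \<omega> j"
  by (induction j) (auto simp: le_Suc_eq)

lemma sel_cong:
  assumes "\<And>X l. l < i \<Longrightarrow> (X, l) \<in> \<omega> \<longleftrightarrow> (X, l) \<in> \<omega>'"
  shows "sel D \<omega> i = sel D \<omega>' i"
  using assms by (induction i) simp_all

text \<open>In the round that selects the last missing triples of \<open>C\<close>, all other
  members are selected or proposed, which forbids each of them. This is why simultaneous proposals
  must block one another.\<close>

lemma sel_conflict_free:
  assumes "C \<in> D" "C \<noteq> {}"
  shows "\<not> C \<subseteq> sel D \<omega> i"
proof (induction i)
  case (Suc i)
  show ?case
  proof
    assume C: "C \<subseteq> sel D \<omega> (Suc i)"
    obtain X where X: "X \<in> C" "X \<notin> sel D \<omega> i" using Suc by blast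
    then have "\<not> C - {X} \<subseteq> sel D \<omega> i \<union> {Y. (Y, i) \<in> \<omega>}" using C assms by auto
    then show False using C by auto
  qed
qed (use assms in auto)

text \<open>A conflict containing \<open>T\<close> can block another triple only if \<open>T\<close>
  is selected or proposed.\<close>

lemma sel_avoid:
  assumes "T \<notin> fst ` \<omega>"
  shows "sel D \<omega> i = sel {C \<in> D. T \<notin> C} \<omega> i"
proof (induction i)
  case (Suc i)
  have T: "T \<notin> sel {C \<in> D. T \<notin> C} \<omega> i" "\<And>l. (T, l) \<notin> \<omega>" using assms sel_subset_fst by force+
  have "(\<exists>C\<in>D. X \<in> C \<and> C - {X} \<subseteq> sel {C \<in> D. T \<notin> C} \<omega> i \<union> {Y. (Y, i) \<in> \<omega>}) \<longleftrightarrow>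
        (\<exists>C\<in>{C \<in> D. T \<notin> C}. X \<in> C \<and> C - {X} \<subseteq> sel {C \<in> D. T \<notin> C} \<omega> i \<union> {Y. (Y, i) \<in> \<omega>})"
    if "(X, i) \<in> \<omega>" for X
  proof -
    have "X \<noteq> T" using that T by auto
    then show ?thesis using T by blast
  qed
  then show ?case by (auto simp: Suc)
qed simp

lemma sel_image:
  assumes g: "inj g"
  shows "sel ((`) g ` D) (map_prod g id ` \<omega>) i = g ` sel D \<omega> i"
proof (induction i)
  case (Suc i)
  have m: "(Y, i) \<in> map_prod g id ` \<omega> \<longleftrightarrow> (\<exists>X. Y = g X \<and> (X, i) \<in> \<omega>)" for Y
    by (auto simp: image_iff map_prod_def split: prod.splits)
  have c: "(\<exists>C\<in>(`) g ` D. g X \<in> C \<and> C - {g X} \<subseteq> g ` sel D \<omega> i \<union> {Y. (Y, i) \<in> map_prod g id ` \<omega>}) \<longleftrightarrow>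
        (\<exists>C\<in>D. X \<in> C \<and> C - {X} \<subseteq> sel D \<omega> i \<union> {Y. (Y, i) \<in> \<omega>})" for X
  proof -
    have "g ` C - {g X} \<subseteq> g ` sel D \<omega> i \<union> {Y. (Y, i) \<in> map_prod g id ` \<omega>} \<longleftrightarrow>
        C - {X} \<subseteq> sel D \<omega> i \<union> {Y. (Y, i) \<in> \<omega>}" for C
    proof -
      have "g ` C - {g X} = g ` (C - {X})" using g by (auto simp: inj_def)
      moreover have "g ` sel D \<omega> i \<union> {Y. (Y, i) \<in> map_prod g id ` \<omega>} = g ` (sel D \<omega> i \<union> {Y. (Y, i) \<in> \<omega>})"
        using m by auto
      ultimately show ?thesis by (simp only: inj_image_subset_iff[OF g])
    qed
    then show ?thesis by (simp add: inj_image_mem_iff[OF g])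
  qed
  define Q where "Q = (\<lambda>X. \<exists>C\<in>D. X \<in> C \<and> C - {X} \<subseteq> sel D \<omega> i \<union> {Y. (Y, i) \<in> \<omega>})"
  define Q' where "Q' = (\<lambda>X. \<exists>C\<in>(`) g ` D. X \<in> C \<and>
    C - {X} \<subseteq> g ` sel D \<omega> i \<union> {Y. (Y, i) \<in> map_prod g id ` \<omega>})"
  have c': "Q' (g X) = Q X" for X unfolding Q_def Q'_def by (rule c)
  have "{Y. (Y, i) \<in> map_prod g id ` \<omega> \<and> \<not> Q' Y} = g ` {X. (X, i) \<in> \<omega> \<and> \<not> Q X}"
    unfolding m using c' by auto
  then show ?case by (simp only: sel.simps Suc Q_def Q'_def image_Un)
qed simp

section \<open>Tracing a changed decision back to the proposal that caused it\<close>

lemma lift_fst: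
  assumes "finite C" "C \<subseteq> fst ` \<omega>"
  obtains G where "G \<subseteq> \<omega>" "finite G" "fst ` G = C" "card G = card C"
proof -
  obtain G where "G \<subseteq> \<omega>" "inj_on fst G" "C = fst ` G" using assms(2) by (auto simp: subset_image_inj)
  then show ?thesis using that[of G] assms(1) by (auto simp: card_image finite_image_iff)
qed

text \<open>If the fate of \<open>X\<close> changes in a round, then some conflict at
  \<open>X\<close> changed its blocking status, so one of its members changed earlier or is
  \<open>x\<close> itself; recurse on that member. In one of the two runs the conflict was complete,
  so all its triples are proposed. Each round adds at most one conflict, hence the bound
  \<open>k * i\<close>.\<close>

lemma sel_pivotal:
  assumes D: "\<And>C. C \<in> D \<Longrightarrow> finite C \<and> card C \<le> k"
    and "(X \<in> sel D (insert x \<omega>) i) \<noteq> (X \<in> sel D \<omega> i)"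
  shows "\<exists>F\<subseteq>\<omega>. finite F \<and> card F \<le> k * i \<and> X \<in> fst ` insert x F \<and> linked D (fst ` insert x F)"
  using assms(2)
proof (induction i arbitrary: X)
  case (Suc i)
  let ?s1 = "sel D (insert x \<omega>) i" and ?s0 = "sel D \<omega> i"
  let ?P1 = "?s1 \<union> {Y. (Y, i) \<in> insert x \<omega>}" and ?P0 = "?s0 \<union> {Y. (Y, i) \<in> \<omega>}"
  show ?case
  proof (cases "(X \<in> ?s1) \<noteq> (X \<in> ?s0)")
    case True
    from Suc.IH[OF this] show ?thesis by (metis le_trans mult_le_mono2 le_SucI le_refl)
  next
    case same: False
    show ?thesis
    proof (cases "x = (X, i)")
      case True
      then show ?thesis by (intro exI[of _ "{}"]) (simp add: linked_single)
    next
      case False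
      have X: "(X, i) \<in> \<omega>" and "(\<exists>C\<in>D. X \<in> C \<and> C - {X} \<subseteq> ?P1) \<noteq> (\<exists>C\<in>D. X \<in> C \<and> C - {X} \<subseteq> ?P0)"
        using Suc.prems same False by auto
      then obtain C where C: "C \<in> D" "X \<in> C" "(C - {X} \<subseteq> ?P1) \<noteq> (C - {X} \<subseteq> ?P0)" by blast
      then obtain Y where Y: "Y \<in> C" "(Y \<in> ?P1) \<noteq> (Y \<in> ?P0)" by blast
      have P: "?P1 \<subseteq> fst ` insert x \<omega>" "?P0 \<subseteq> fst ` insert x \<omega>"
        using sel_subset_fst[of D "insert x \<omega>" i] sel_subset_fst[of D \<omega> i] by force+
      have "C - {X} \<subseteq> fst ` insert x \<omega>" using C(3) P by blast
      moreover have "X \<in> fst ` insert x \<omega>" using X by force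
      ultimately have "C \<subseteq> fst ` insert x \<omega>" by blast
      then obtain G where G: "G \<subseteq> insert x \<omega>" "finite G" "fst ` G = C" "card G = card C"
        using lift_fst D C(1) by metis
      have "\<exists>F\<subseteq>\<omega>. finite F \<and> card F \<le> k * i \<and> Y \<in> fst ` insert x F \<and> linked D (fst ` insert x F)"
      proof (cases "(Y \<in> ?s1) \<noteq> (Y \<in> ?s0)")
        case True
        then show ?thesis by (rule Suc.IH)
      next
        case False
        then have "x = (Y, i)" using Y by auto
        then show ?thesis by (intro exI[of _ "{}"]) (simp add: linked_single)
      qed
      then obtain F where F: "F \<subseteq> \<omega>" "finite F" "card F \<le> k * i" "Y \<in> fst ` insert x F" "linked D (fst ` insert x F)"
        by blast
      have eq: "fst ` insert x (F \<union> (G - {x})) = fst ` insert x F \<union> C" using G(3) by auto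
      have "linked D (fst ` insert x F \<union> C)"
        by (rule linked_Un[OF F(5) linked_conflict[OF C(1)]]) (use F(4) Y(1) in blast)
      moreover have "card (F \<union> (G - {x})) \<le> k * i + k"
        using card_Un_le[of F "G - {x}"] F(3) G(4) D[OF C(1)] card_Diff1_le[of G x] by linarith
      ultimately show ?thesis using F G C(2) eq
        by (intro exI[of _ "F \<union> (G - {x})"]) auto
    qed
  qed
qed simp

text \<open>\<open>L\<close> is the chain traced from one member of \<open>R\<close>. All of
  \<open>R\<close> may be added to the witness because it is selected, hence proposed, in one of the
  two runs.\<close>

lemma subset_sel_pivotal:
  assumes D: "\<And>C. C \<in> D \<Longrightarrow> finite C \<and> card C \<le> k" and R: "finite R"
    and ne: "(R \<subseteq> sel D (insert x \<omega>) i) \<noteq> (R \<subseteq> sel D \<omega> i)"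
  shows "\<exists>F L. F \<subseteq> \<omega> \<and> finite F \<and> card F \<le> k * i + card R \<and> fst ` insert x F = L \<union> R \<and>
    linked D L \<and> fst x \<in> L \<and> L \<inter> R \<noteq> {}"
proof -
  obtain Y where Y: "Y \<in> R" "(Y \<in> sel D (insert x \<omega>) i) \<noteq> (Y \<in> sel D \<omega> i)" using ne by blast
  obtain F where F: "F \<subseteq> \<omega>" "finite F" "card F \<le> k * i" "Y \<in> fst ` insert x F" "linked D (fst ` insert x F)"
    using sel_pivotal[OF D Y(2)] by blast
  have "R \<subseteq> fst ` insert x \<omega>"
    using ne sel_subset_fst[of D "insert x \<omega>" i] sel_subset_fst[of D \<omega> i] by auto
  then obtain G where G: "G \<subseteq> insert x \<omega>" "finite G" "fst ` G = R" "card G = card R"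
    using lift_fst R by metis
  have "fst ` insert x (F \<union> (G - {x})) = fst ` insert x F \<union> R" using G(3) by auto
  moreover have "card (F \<union> (G - {x})) \<le> k * i + card R"
    using card_Un_le[of F "G - {x}"] F(3) G(4) card_Diff1_le[of G x] by linarith
  moreover have "F \<union> (G - {x}) \<subseteq> \<omega>" "finite (F \<union> (G - {x}))" using F(1,2) G(1,2) by auto
  moreover have "fst x \<in> fst ` insert x F" "fst ` insert x F \<inter> R \<noteq> {}" using F(4) Y(1) by blast+
  ultimately show ?thesis using F(5) by blast
qed

text \<open>A conflict of \<open>E\<close> connects the traced chain to \<open>T\<close>. Since
  \<open>T\<close> may lack a slot in the witness, it is inserted separately.\<close>

lemma avoid_sel_pivotal:
  assumes D: "\<And>C. C \<in> D \<Longrightarrow> finite C \<and> card C \<le> k"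
    and E: "\<And>C. C \<in> E \<Longrightarrow> T \<in> C \<and> finite C \<and> card C \<le> k"
    and ne: "(\<exists>C\<in>E. C - {T} \<subseteq> sel D (insert x \<omega>) i) \<noteq> (\<exists>C\<in>E. C - {T} \<subseteq> sel D \<omega> i)"
  shows "\<exists>F\<subseteq>\<omega>. finite F \<and> card F \<le> k * i + k \<and> linked (D \<union> E) (insert T (fst ` insert x F))"
proof -
  obtain C where C: "C \<in> E" "(C - {T} \<subseteq> sel D (insert x \<omega>) i) \<noteq> (C - {T} \<subseteq> sel D \<omega> i)" using ne by blast
  have fin: "finite (C - {T})" using E[OF C(1)] by simp
  obtain F L where F: "F \<subseteq> \<omega>" "finite F" "card F \<le> k * i + card (C - {T})" "fst ` insert x F = L \<union> (C - {T})"
    "linked D L" "L \<inter> (C - {T}) \<noteq> {}" using subset_sel_pivotal[OF D fin C(2)] by blast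
  have "card (C - {T}) \<le> k" using E[OF C(1)] card_Diff1_le[of C T] by linarith
  moreover have "insert T (fst ` insert x F) = L \<union> C" using F(4) E[OF C(1)] by auto
  moreover have "linked (D \<union> E) (L \<union> C)"
  proof (rule linked_Un)
    show "linked (D \<union> E) L" using F(5) by (rule linked_mono) blast
    show "linked (D \<union> E) C" using C(1) by (intro linked_conflict) blast
  qed (use F(6) in blast)
  ultimately show ?thesis using F by (intro exI[of _ F]) auto
qed

section \<open>Conflict-free families are sparse partial systems\<close>

lemma conflict_free_dense:
  assumes S: "S \<subseteq> triples n" and cf: "\<And>C. C \<in> conflicts k n \<Longrightarrow> \<not> C \<subseteq> S"
  shows "C \<subseteq> S \<Longrightarrow> finite C \<Longrightarrow> 2 \<le> card C \<Longrightarrow> card C \<le> k \<Longrightarrow> card C + 3 \<le> card (\<Union>C)"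
proof (induction "card C" arbitrary: C rule: less_induct)
  case less
  show ?case
  proof (rule ccontr)
    assume c: "\<not> card C + 3 \<le> card (\<Union>C)"
    \<comment> \<open>By induction all smaller parts are sparse, so a violating \<open>C\<close> is
      minimal and therefore a conflict.\<close>
    have "card D + 3 \<le> card (\<Union>D)" if "D \<subset> C" "2 \<le> card D" for D
    proof -
      have lt: "card D < card C" using that less.prems(2) by (simp add: psubset_card_mono)
      show ?thesis
        by (rule less.hyps[OF lt]) (use that less.prems lt in \<open>auto intro: finite_subset\<close>)
    qed
    then have "tight C" using c less.prems S unfolding tight_def triples_def by auto
    moreover have "\<Union>C \<subseteq> {..<n}" using less.prems S by (auto simp: triples_def)
    ultimately show False using cf[of C] less.prems by (auto simp: conflicts_def)
  qed
qed

lemma conflict_free_imp_partial_sts: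
  assumes S: "S \<subseteq> triples n" and cf: "\<And>C. C \<in> conflicts k n \<Longrightarrow> \<not> C \<subseteq> S" and k: "2 \<le> k"
  shows "partial_steiner_triple_system {..<n} S"
proof -
  have "T = T'" if T: "T \<in> S" "T' \<in> S" and e: "e \<subseteq> T" "e \<subseteq> T'" "card e = 2" for T T' e
  proof (rule ccontr)
    assume ne: "T \<noteq> T'"
    have c: "card T = 3" "card T' = 3" using T S by (auto simp: triples_def)
    then have fin: "finite T" "finite T'" by (auto intro: card_ge_0_finite)
    have "card {T,T'} + 3 \<le> card (\<Union>{T,T'})"
      by (rule conflict_free_dense[OF S cf]) (use T ne k in auto)
    moreover have "card e \<le> card (T \<inter> T')" by (rule card_mono) (use fin e in auto)
    ultimately show False using card_Un_Int[OF fin] c e ne by simp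
  qed
  note uniq = this
  have "\<forall>e. e \<subseteq> {..<n} \<and> card e = 2 \<longrightarrow> (\<exists>\<^sub>\<le>\<^sub>1 T. T \<in> S \<and> e \<subseteq> T)"
    unfolding Uniq_def by (intro allI impI, elim conjE) (rule uniq)
  moreover have "\<forall>T\<in>S. T \<subseteq> {..<n} \<and> card T = 3" using S unfolding triples_def by blast
  ultimately show ?thesis unfolding partial_steiner_triple_system_def by simp
qed

lemma conflict_free_imp_sparse:
  assumes S: "S \<subseteq> triples n" and cf: "\<And>C. C \<in> conflicts k n \<Longrightarrow> \<not> C \<subseteq> S"
  shows "sparse_triple_system k S"
  unfolding sparse_triple_system_def
proof (rule notI, elim exE conjE)
  fix j C assume j: "2 \<le> j" "j \<le> k" "C \<subseteq> S" "configuration (j + 2) j C"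
  then have "finite C" "card C = j" "\<exists>P. finite P \<and> card P = j + 2 \<and> (\<forall>T\<in>C. T \<subseteq> P \<and> card T = 3)"
    by (simp_all add: configuration_def)
  then obtain P where P: "finite C" "card C = j" "finite P" "card P = j + 2" "\<forall>T\<in>C. T \<subseteq> P" by blast
  have "card (\<Union>C) \<le> card P" by (rule card_mono) (use P in auto)
  moreover have "card C + 3 \<le> card (\<Union>C)" by (rule conflict_free_dense[OF S cf]) (use j P in auto)
  ultimately show False using P by simp
qed

section \<open>Counting deficient sets\<close>

lemma sum_inverse_power_card:
  assumes n: "n \<ge> 1"
  shows "(\<Sum>P | P \<subseteq> {..<n} \<and> card P \<le> M. 1 / real n ^ card P) \<le> real (M + 1)"
proof -
  let ?A = "{P. P \<subseteq> {..<n} \<and> card P \<le> M}"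
  have fin: "finite ?A" by (rule finite_subset[of _ "Pow {..<n}"]) auto
  have "(\<Sum>P\<in>?A. 1 / real n ^ card P) = (\<Sum>d\<le>M. \<Sum>P | P \<in> ?A \<and> card P = d. 1 / real n ^ card P)"
    by (rule sum.group[symmetric]) (use fin in auto)
  also have "\<dots> \<le> (\<Sum>d\<le>M. 1)"
  proof (rule sum_mono)
    fix d assume "d \<in> {..M}"
    have "{P. P \<in> ?A \<and> card P = d} \<subseteq> {P. P \<subseteq> {..<n} \<and> card P = d}" by auto
    then have "card {P. P \<in> ?A \<and> card P = d} \<le> card {P. P \<subseteq> {..<n} \<and> card P = d}"
      by (rule card_mono[rotated]) (auto intro: finite_subset[of _ "Pow {..<n}"])
    also have "\<dots> = n choose d" by (simp add: n_subsets)
    also have "\<dots> \<le> n ^ d"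
    proof (cases "d \<le> n")
      case True then show ?thesis by (rule binomial_le_pow)
    next
      case False
      then have "n choose d = 0" by (intro binomial_eq_0) linarith
      then show ?thesis by linarith
    qed
    finally have "real (card {P. P \<in> ?A \<and> card P = d}) \<le> real n ^ d"
      unfolding of_nat_power[symmetric] by (rule of_nat_mono)
    moreover have "(\<Sum>P | P \<in> ?A \<and> card P = d. 1 / real n ^ card P) = real (card {P. P \<in> ?A \<and> card P = d}) / real n ^ d"
      by simp
    ultimately show "(\<Sum>P | P \<in> ?A \<and> card P = d. 1 / real n ^ card P) \<le> 1"
      using n by (simp add: divide_le_eq_1)
  qed
  also have "\<dots> = real (M + 1)" by simp
  finally show ?thesis .
qed

text \<open>There are at most \<open>n ^ d\<close> point sets of size d, each carrying at most
  \<open>N\<close> objects of weight \<open>a / n ^ d\<close>; so every size contributes a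
  constant.\<close>

lemma weighted_count:
  assumes n: "n \<ge> 1" and A: "finite A"
    and pts: "\<And>x. x \<in> A \<Longrightarrow> pts x \<subseteq> {..<n} \<and> card (pts x) \<le> M"
    and g: "\<And>x. x \<in> A \<Longrightarrow> g x \<le> a / real n ^ card (pts x)" and a: "0 \<le> a"
    and N: "\<And>P. card P \<le> M \<Longrightarrow> P \<subseteq> {..<n} \<Longrightarrow> card {x \<in> A. pts x = P} \<le> N"
  shows "sum g A \<le> a * real N * real (M + 1)"
proof -
  let ?P = "{P. P \<subseteq> {..<n} \<and> card P \<le> M}"
  have fin: "finite ?P" by (rule finite_subset[of _ "Pow {..<n}"]) auto
  have "sum g A = (\<Sum>P\<in>?P. \<Sum>x | x \<in> A \<and> pts x = P. g x)"
    by (rule sum.group[symmetric]) (use A fin pts in auto)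
  also have "\<dots> \<le> (\<Sum>P\<in>?P. a * real N * (1 / real n ^ card P))"
  proof (rule sum_mono)
    fix P assume P: "P \<in> ?P"
    have "(\<Sum>x | x \<in> A \<and> pts x = P. g x) \<le> (\<Sum>x | x \<in> A \<and> pts x = P. a / real n ^ card P)"
      by (rule sum_mono) (use g in auto)
    also have "\<dots> = real (card {x \<in> A. pts x = P}) * (a / real n ^ card P)" by simp
    also have "\<dots> \<le> real N * (a / real n ^ card P)"
      by (rule mult_right_mono) (use N[of P] P a in auto)
    finally show "(\<Sum>x | x \<in> A \<and> pts x = P. g x) \<le> a * real N * (1 / real n ^ card P)"
      by (simp add: mult.commute)
  qed
  also have "\<dots> = a * real N * (\<Sum>P\<in>?P. 1 / real n ^ card P)" by (simp add: sum_distrib_left)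
  also have "\<dots> \<le> a * real N * real (M + 1)"
    by (rule mult_left_mono[OF sum_inverse_power_card[OF n]]) (use a in auto)
  finally show ?thesis .
qed

lemma finite_triples: "finite (triples n)"
  by (rule finite_subset[of _ "Pow {..<n}"]) (auto simp: triples_def)

lemma finite_conflicts: "finite (conflicts k n)"
  by (rule finite_subset[of _ "Pow (Pow {..<n})"]) (auto simp: conflicts_def)

definition slots :: "nat \<Rightarrow> nat \<Rightarrow> (nat set \<times> nat) set" where
  "slots n r = triples n \<times> {..<r}"

lemma finite_slots: "finite (slots n r)"
  by (simp add: slots_def finite_triples)

text \<open>The first factor bounds the families of triples on \<open>T\<close> and at most
  \<open>k\<close> further points, the second the number of possible sizes of the set of further
  points.\<close>

definition conflict_const :: "nat \<Rightarrow> real" where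
  "conflict_const k = 2 ^ (2 ^ (k + 3)) * real (k + 1)"

text \<open>A conflict through \<open>T\<close> has at most \<open>card C - 1\<close> points outside
  \<open>T\<close>, so the weight balances the number of choices.\<close>

lemma conflict_sum_le:
  assumes n: "n \<ge> 1" and T: "T \<in> triples n" and a: "0 \<le> a"
    and g: "\<And>C. C \<in> conflicts k n \<Longrightarrow> T \<in> C \<Longrightarrow> g C \<le> a / real n ^ (card C - 1)"
    and A: "A \<subseteq> {C \<in> conflicts k n. T \<in> C}"
  shows "sum g A \<le> a * conflict_const k"
proof -
  have T3: "card T = 3" "finite T" using T by (auto simp: triples_def intro: card_ge_0_finite)
  have pc: "card (\<Union>C - T) \<le> card C - 1" if "C \<in> A" for C
  proof -
    have "tight C" "T \<in> C" using that A by (auto simp: conflicts_def)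
    then have "card (\<Union>C) \<le> card C + 2" "T \<subseteq> \<Union>C" using tight_le by auto
    then show ?thesis using T3 by (simp add: card_Diff_subset)
  qed
  have k: "card C - 1 \<le> k" "\<Union>C \<subseteq> {..<n}" if "C \<in> A" for C
    using that A by (auto simp: conflicts_def)
  have "sum g A \<le> a * real (2 ^ (2 ^ (k + 3))) * real (k + 1)"
  proof (rule weighted_count[where pts = "\<lambda>C. \<Union>C - T", OF n])
    show "finite A" using A finite_subset[OF _ finite_conflicts[of k n]] by blast
    fix C assume C: "C \<in> A"
    show "\<Union>C - T \<subseteq> {..<n} \<and> card (\<Union>C - T) \<le> k" using pc[OF C] k[OF C] by auto
    have "g C \<le> a / real n ^ (card C - 1)" using g C A by auto
    also have "\<dots> \<le> a / real n ^ card (\<Union>C - T)"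
      using n a pc[OF C] by (intro divide_left_mono power_increasing) auto
    finally show "g C \<le> a / real n ^ card (\<Union>C - T)" .
  next
    fix P assume P: "card P \<le> k" "P \<subseteq> {..<n}"
    have fP: "finite P" using P(2) finite_subset by blast
    have "{C \<in> A. \<Union>C - T = P} \<subseteq> Pow (Pow (P \<union> T))" by auto
    then have "card {C \<in> A. \<Union>C - T = P} \<le> card (Pow (Pow (P \<union> T)))"
      by (rule card_mono[rotated]) (use fP T3 in simp)
    also have "\<dots> = 2 ^ 2 ^ card (P \<union> T)" using fP T3 by (simp add: card_Pow)
    also have "\<dots> \<le> 2 ^ 2 ^ (k + 3)"
      using card_Un_le[of P T] P T3 by (intro power_increasing) auto
    finally show "card {C \<in> A. \<Union>C - T = P} \<le> 2 ^ 2 ^ (k + 3)" .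
  qed (rule a)
  then show ?thesis by (simp add: conflict_const_def)
qed

text \<open>First moment bound. The points of \<open>W\<close> are fixed in advance; outside them
  \<open>H\<close> has at least \<open>h + 1\<close> fewer points than slots, and each missing point
  gains a factor 1/n.\<close>

lemma deficient_sum_le:
  assumes n: "n \<ge> 1" and p: "0 \<le> p" "p \<le> 1 / real n" and W: "finite W" "card W \<le> w"
    and \<H>: "\<And>H. H \<in> \<H> \<Longrightarrow> H \<subseteq> slots n r \<and> card H \<le> M \<and> card (\<Union>(fst ` H) \<union> W) + h + 1 \<le> card W + card H"
  shows "(\<Sum>H\<in>\<H>. p ^ card H) \<le> 1 / real n ^ (h + 1) * real (2 ^ (2 ^ (M + w) * r)) * real (M + 1)"
proof (rule weighted_count[where pts = "\<lambda>H. \<Union>(fst ` H) - W", OF n])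
  have "\<H> \<subseteq> Pow (slots n r)" using \<H> by auto
  then show fin: "finite \<H>" using finite_slots by (meson finite_Pow_iff finite_subset)
  fix H assume H: "H \<in> \<H>"
  have sub: "\<Union>(fst ` H) \<subseteq> {..<n}" using \<H>[OF H] by (fastforce simp: slots_def triples_def)
  then have f: "finite (\<Union>(fst ` H))" using finite_subset by blast
  have "card (\<Union>(fst ` H) \<union> W) = card (\<Union>(fst ` H) - W) + card W"
    using card_Un_disjoint[of "\<Union>(fst ` H) - W" W] f W by (simp add: Un_Diff_cancel2 inf.commute)
  then have le: "card (\<Union>(fst ` H) - W) + h + 1 \<le> card H" using \<H>[OF H] by simp
  then show "\<Union>(fst ` H) - W \<subseteq> {..<n} \<and> card (\<Union>(fst ` H) - W) \<le> M" using sub \<H>[OF H] by auto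
  have "p ^ card H \<le> (1 / real n) ^ card H" by (rule power_mono) (use p in auto)
  also have "\<dots> \<le> (1 / real n) ^ (card (\<Union>(fst ` H) - W) + h + 1)"
    by (rule power_decreasing[OF le]) (use n in auto)
  finally show "p ^ card H \<le> 1 / real n ^ (h + 1) / real n ^ card (\<Union>(fst ` H) - W)"
    by (simp add: power_add power_one_over mult.commute)
next
  fix P assume P: "card P \<le> M" "P \<subseteq> {..<n}"
  have fP: "finite P" using P(2) finite_subset by blast
  have fin: "finite (Pow (Pow (P \<union> W) \<times> {..<r}))" using fP W by simp
  have "{H \<in> \<H>. \<Union>(fst ` H) - W = P} \<subseteq> Pow (Pow (P \<union> W) \<times> {..<r})"
    using \<H> by (fastforce simp: slots_def)
  then have "card {H \<in> \<H>. \<Union>(fst ` H) - W = P} \<le> card (Pow (Pow (P \<union> W) \<times> {..<r}))"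
    by (rule card_mono[OF fin])
  also have "\<dots> = 2 ^ (2 ^ card (P \<union> W) * r)" using fP W by (simp add: card_Pow card_cartesian_product)
  also have "\<dots> \<le> 2 ^ (2 ^ (M + w) * r)"
    using card_Un_le[of P W] P W by (intro power_increasing mult_le_mono1) auto
  finally show "card {H \<in> \<H>. \<Union>(fst ` H) - W = P} \<le> 2 ^ (2 ^ (M + w) * r)" .
qed (use n in simp)

text \<open>For \<open>H = insert x (F \<union> G)\<close> with at most \<open>2 * M + 1\<close>
  slots, the factors bound the ways to recover \<open>x\<close>, \<open>F\<close>, \<open>G\<close>
  from \<open>H\<close>, the sets of slots on given points, and the possible numbers of
  points.\<close>

definition cov_const :: "nat \<Rightarrow> nat \<Rightarrow> nat \<Rightarrow> real" where
  "cov_const M w r = real ((2 * M + 1) * 4 ^ (2 * M + 1)) * real (2 ^ (2 ^ (2 * M + 1 + w) * r)) * real (2 * M + 2)"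

lemma cov_const_nonneg: "0 \<le> cov_const M w r"
  by (simp add: cov_const_def)

text \<open>A coordinate pivotal for both functions yields two witnesses. By \<open>def\<close>
  their union is deficient relative to \<open>W\<close>, so \<open>covariance_le_witnesses\<close>
  reduces the claim to the first moment bound.\<close>

lemma covariance_small:
  fixes f g :: "(nat set \<times> nat) set \<Rightarrow> real" and n r :: nat
  defines "I \<equiv> slots n r"
  assumes n: "n \<ge> 1" and p: "0 \<le> p" "p \<le> 1 / real n" and W: "finite W" "card W \<le> w"
    and f: "\<And>\<omega>. \<omega> \<subseteq> I \<Longrightarrow> 0 \<le> f \<omega> \<and> f \<omega> \<le> 1" and g: "\<And>\<omega>. \<omega> \<subseteq> I \<Longrightarrow> 0 \<le> g \<omega> \<and> g \<omega> \<le> 1"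
    and pf: "\<And>x \<omega>. x \<in> I \<Longrightarrow> \<omega> \<subseteq> I - {x} \<Longrightarrow> f (insert x \<omega>) \<noteq> f \<omega> \<Longrightarrow> \<exists>F\<subseteq>\<omega>. card F \<le> M \<and> P x F"
    and pg: "\<And>x \<omega>. x \<in> I \<Longrightarrow> \<omega> \<subseteq> I - {x} \<Longrightarrow> g (insert x \<omega>) \<noteq> g \<omega> \<Longrightarrow> \<exists>F\<subseteq>\<omega>. card F \<le> M \<and> Q x F"
    and def: "\<And>x F G H. H \<subseteq> I \<Longrightarrow> finite H \<Longrightarrow> H = insert x (F \<union> G) \<Longrightarrow> P x F \<Longrightarrow> Q x G \<Longrightarrow>
        card (\<Union>(fst ` H) \<union> W) + h + 1 \<le> card W + card H"
  shows "\<bar>expect p I (\<lambda>\<omega>. f \<omega> * g \<omega>) - expect p I f * expect p I g\<bar> \<le> cov_const M w r / real n ^ (h + 1)"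
proof -
  have fI: "finite I" by (simp add: I_def finite_slots)
  have p1: "p \<le> 1" using p n by (smt (verit) divide_le_eq_1_pos of_nat_1 of_nat_mono)
  define \<F> where "\<F> = (\<lambda>x. {F. F \<subseteq> I - {x} \<and> card F \<le> M \<and> P x F})"
  define \<G> where "\<G> = (\<lambda>x. {F. F \<subseteq> I - {x} \<and> card F \<le> M \<and> Q x F})"
  have fin: "finite (\<F> x)" "finite (\<G> x)" for x
    by (rule finite_subset[of _ "Pow I"]; use fI in \<open>auto simp: \<F>_def \<G>_def\<close>)+
  have "\<bar>expect p I (\<lambda>\<omega>. f \<omega> * g \<omega>) - expect p I f * expect p I g\<bar>
    \<le> (\<Sum>x\<in>I. p * (\<Sum>F\<in>\<F> x. \<Sum>G\<in>\<G> x. p ^ card ((F \<union> G) \<inter> (I - {x}))))"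
  proof (rule covariance_le_witnesses[OF fI p(1) p1 fin f g])
    fix x \<omega> assume x: "x \<in> I" "\<omega> \<subseteq> I - {x}"
    show "\<exists>F\<in>\<F> x. F \<inter> (I - {x}) \<subseteq> \<omega>" if "f (insert x \<omega>) \<noteq> f \<omega>"
      using pf[OF x that] x unfolding \<F>_def by blast
    show "\<exists>F\<in>\<G> x. F \<inter> (I - {x}) \<subseteq> \<omega>" if "g (insert x \<omega>) \<noteq> g \<omega>"
      using pg[OF x that] x unfolding \<G>_def by blast
  qed
  also have "\<dots> = (\<Sum>x\<in>I. \<Sum>F\<in>\<F> x. \<Sum>G\<in>\<G> x. p ^ card (insert x (F \<union> G)))"
  proof (rule sum.cong[OF refl])
    fix x assume "x \<in> I"
    have "p * p ^ card ((F \<union> G) \<inter> (I - {x})) = p ^ card (insert x (F \<union> G))" if "F \<in> \<F> x" "G \<in> \<G> x" for F G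
    proof -
      have "(F \<union> G) \<inter> (I - {x}) = F \<union> G" "x \<notin> F \<union> G" "F \<union> G \<subseteq> I" using that by (auto simp: \<F>_def \<G>_def)
      moreover have "finite (F \<union> G)" using \<open>F \<union> G \<subseteq> I\<close> fI finite_subset by blast
      ultimately show ?thesis by (metis card_insert_disjoint power_Suc)
    qed
    then show "p * (\<Sum>F\<in>\<F> x. \<Sum>G\<in>\<G> x. p ^ card ((F \<union> G) \<inter> (I - {x})))
        = (\<Sum>F\<in>\<F> x. \<Sum>G\<in>\<G> x. p ^ card (insert x (F \<union> G)))"
      by (simp add: sum_distrib_left)
  qed
  also have "\<dots> = (\<Sum>(x, F, G)\<in>(SIGMA x:I. \<F> x \<times> \<G> x). p ^ card (insert x (F \<union> G)))"
    by (simp add: sum.Sigma fI fin sum.cartesian_product)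
  also have "\<dots> \<le> real ((2 * M + 1) * 4 ^ (2 * M + 1)) * (1 / real n ^ (h + 1) * real (2 ^ (2 ^ (2 * M + 1 + w) * r)) * real (2 * M + 1 + 1))"
  proof -
    define Z where "Z = (SIGMA x:I. \<F> x \<times> \<G> x)"
    define hh where "hh = (\<lambda>(x, F, G). insert x (F \<union> G) :: (nat set \<times> nat) set)"
    have fZ: "finite Z" unfolding Z_def using fI fin by auto
    have H: "H \<subseteq> I \<and> card H \<le> 2 * M + 1 \<and> card (\<Union>(fst ` H) \<union> W) + h + 1 \<le> card W + card H" if HZ: "H \<in> hh ` Z" for H
    proof -
      obtain z where z: "H = hh z" "z \<in> Z" using HZ by (rule imageE)
      obtain x F G where "z = (x, F, G)" by (rule prod_cases3)
      then have q: "H = insert x (F \<union> G)" "x \<in> I" "F \<in> \<F> x" "G \<in> \<G> x"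
        using z by (simp_all add: hh_def Z_def)
      then have sub: "H \<subseteq> I" by (auto simp: \<F>_def \<G>_def)
      then have fH: "finite H" using fI finite_subset by blast
      have PQ: "card F \<le> M" "card G \<le> M" "P x F" "Q x G" using q by (auto simp: \<F>_def \<G>_def)
      moreover have "card H \<le> Suc (card (F \<union> G))" unfolding q(1) using card_insert_le_m1[of "Suc (card (F \<union> G))" "F \<union> G" x] by simp
      moreover have "card (\<Union>(fst ` H) \<union> W) + h + 1 \<le> card W + card H"
        by (rule def[OF sub fH q(1) PQ(3,4)])
      ultimately show ?thesis using sub card_Un_le[of F G] by linarith
    qed
    have "(\<Sum>(x, F, G)\<in>Z. p ^ card (insert x (F \<union> G))) = (\<Sum>q\<in>Z. p ^ card (hh q))"
      by (simp add: hh_def split_def)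
    also have "\<dots> = (\<Sum>H\<in>hh ` Z. \<Sum>q | q \<in> Z \<and> hh q = H. p ^ card (hh q))"
      by (rule sum.group[symmetric]) (use fZ in auto)
    also have "\<dots> \<le> (\<Sum>H\<in>hh ` Z. real ((2 * M + 1) * 4 ^ (2 * M + 1)) * p ^ card H)"
    proof (rule sum_mono)
      fix H assume HZ: "H \<in> hh ` Z"
      have fH: "finite H" using H[OF HZ] fI finite_subset by blast
      have "{q \<in> Z. hh q = H} \<subseteq> H \<times> Pow H \<times> Pow H" by (auto simp: hh_def)
      then have "card {q \<in> Z. hh q = H} \<le> card (H \<times> Pow H \<times> Pow H)"
        by (rule card_mono[rotated]) (use fH in simp)
      also have "\<dots> = card H * 4 ^ card H"
        using fH by (simp add: card_cartesian_product card_Pow flip: power_mult_distrib)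
      also have "\<dots> \<le> (2 * M + 1) * 4 ^ (2 * M + 1)"
        using H[OF HZ] by (intro mult_le_mono power_increasing) auto
      finally have "real (card {q \<in> Z. hh q = H}) \<le> real ((2 * M + 1) * 4 ^ (2 * M + 1))" by (rule of_nat_mono)
      then have "real (card {q \<in> Z. hh q = H}) * p ^ card H \<le> real ((2 * M + 1) * 4 ^ (2 * M + 1)) * p ^ card H"
        by (rule mult_right_mono) (use p in simp)
      then show "(\<Sum>q | q \<in> Z \<and> hh q = H. p ^ card (hh q)) \<le> real ((2 * M + 1) * 4 ^ (2 * M + 1)) * p ^ card H"
        by simp
    qed
    also have "\<dots> = real ((2 * M + 1) * 4 ^ (2 * M + 1)) * (\<Sum>H\<in>hh ` Z. p ^ card H)" by (rule sum_distrib_left[symmetric])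
    also have "\<dots> \<le> real ((2 * M + 1) * 4 ^ (2 * M + 1)) * (1 / real n ^ (h + 1) * real (2 ^ (2 ^ (2 * M + 1 + w) * r)) * real (2 * M + 1 + 1))"
      by (rule mult_left_mono[OF deficient_sum_le[OF n p W]]) (use H in \<open>auto simp: I_def\<close>)
    finally show ?thesis by (simp only: Z_def)
  qed
  also have "\<dots> = cov_const M w r / real n ^ (h + 1)" by (simp add: cov_const_def)
  finally show ?thesis .
qed

section \<open>Symmetry and uncovered pairs\<close>

text \<open>A witness consists of a chain of at most \<open>k * r\<close> slots and at most
  \<open>k\<close> slots for the conflict under test; \<open>k + 3\<close> leaves room for the
  points of one conflict or of one triple.\<close>

definition cov_bound :: "nat \<Rightarrow> nat \<Rightarrow> real" where
  "cov_bound k r = cov_const (k * r + k) (k + 3) r"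

lemma cov_bound_nonneg: "0 \<le> cov_bound k r"
  by (simp add: cov_bound_def cov_const_nonneg)

text \<open>Times \<epsilon>, this bounds the expected number of conflicts at a triple having one
  other member proposed in a given round and the remaining ones at any time; see
  \<open>sum_late_le\<close>.\<close>

definition step_const :: "nat \<Rightarrow> real \<Rightarrow> real" where
  "step_const k c = real k * (1 + c) ^ k * conflict_const k"

lemma tight_inj_image:
  assumes s: "inj s" and C: "tight C"
  shows "tight ((`) s ` C)"
proof -
  have inj: "inj_on ((`) s) A" for A using s by (meson inj_image_eq_iff inj_onI)
  have c1: "card (s ` T) = card T" for T using s by (meson card_image inj_on_subset subset_UNIV)
  have c2: "card ((`) s ` D) = card D" for D by (rule card_image[OF inj])
  have U: "\<Union>((`) s ` D) = s ` \<Union>D" for D by auto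
  show ?thesis unfolding tight_def
  proof (intro conjI ballI allI impI)
    show "finite ((`) s ` C)" using tight_finite[OF C] by simp
    show "card T = 3" if "T \<in> (`) s ` C" for T using that tight_card3[OF C] c1 by auto
    show "2 \<le> card ((`) s ` C)" using tight_2[OF C] c2 by simp
    show "card (\<Union>((`) s ` C)) \<le> card ((`) s ` C) + 2" unfolding U c1 c2 using tight_le[OF C] .
    fix D assume D: "D \<subset> (`) s ` C" "2 \<le> card D"
    then obtain D' where D': "D' \<subseteq> C" "D = (`) s ` D'" by (metis subset_imageE psubset_imp_subset)
    then have "D' \<noteq> C" using D by auto
    then show "card D + 3 \<le> card (\<Union>D)"
      unfolding D'(2) U c1 c2 using tight_psub[OF C D'(1)] D(2) D'(2) c2 by simp
  qed
qed

lemma ex_permutation_image: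
  assumes "X \<in> triples n" "Y \<in> triples n"
  obtains s where "bij s" "s ` {..<n} = {..<n}" "s ` X = Y"
proof -
  have X: "finite X" "X \<subseteq> {..<n}" "card X = 3" and Y: "finite Y" "Y \<subseteq> {..<n}" "card Y = 3"
    using assms by (auto simp: triples_def intro: card_ge_0_finite)
  obtain f where f: "bij_betw f X Y" using finite_same_card_bij[of X Y] X Y by auto
  have "card ({..<n} - X) = card ({..<n} - Y)" using X Y by (simp add: card_Diff_subset)
  then obtain g where g: "bij_betw g ({..<n} - X) ({..<n} - Y)"
    using finite_same_card_bij[of "{..<n} - X" "{..<n} - Y"] by auto
  define s0 where "s0 = (\<lambda>z. if z \<in> X then f z else g z)"
  define s where "s = (\<lambda>z. if z \<in> {..<n} then s0 z else z)"
  have a: "bij_betw s0 (X \<union> ({..<n} - X)) (Y \<union> ({..<n} - Y))"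
    unfolding s0_def by (rule bij_betw_disjoint_Un[OF f g]) auto
  have XY: "X \<union> ({..<n} - X) = {..<n}" "Y \<union> ({..<n} - Y) = {..<n}" using X Y by auto
  have a: "bij_betw s0 {..<n} {..<n}" using a by (simp only: XY)
  have "bij_betw s ({..<n} \<union> - {..<n}) ({..<n} \<union> - {..<n})"
    unfolding s_def by (rule bij_betw_disjoint_Un[OF a]) (auto simp: bij_betw_def)
  moreover have "{..<n} \<union> - {..<n} = UNIV" by blast
  ultimately have "bij s" by (simp only:)
  moreover have "s ` {..<n} = {..<n}" using a unfolding s_def bij_betw_def by auto
  moreover have "s ` X = f ` X" using X unfolding s_def s0_def by (intro image_cong) auto
  then have "s ` X = Y" using f by (simp add: bij_betw_def)
  ultimately show ?thesis by (rule that)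
qed

text \<open>The three bounds in \<open>large\<close> respectively make \<open>r * p\<close> at most
  1, make two given triples both proposed with probability at most 1/n, and keep the covariance
  errors below the main terms. \<open>small\<close> keeps the expected number of new large conflicts
  per round below 1/2.\<close>

locale rounds =
  fixes n k r :: nat and \<epsilon> :: real
  assumes n3: "3 \<le> n" and k2: "2 \<le> k" and eps: "0 < \<epsilon>" "\<epsilon> \<le> 1"
    and large: "real r * \<epsilon> \<le> real n" "(real r * \<epsilon>)\<^sup>2 \<le> real n" "real k * 4 ^ k * cov_bound k r \<le> real n"
    and small: "\<epsilon> * step_const k (real r * \<epsilon>) \<le> 1 / 2"
begin

definition p :: real where "p = \<epsilon> / real n"

abbreviation c :: real where "c \<equiv> real r * \<epsilon>"

abbreviation slot_set :: "(nat set \<times> nat) set" where "slot_set \<equiv> slots n r"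

abbreviation Ex :: "((nat set \<times> nat) set \<Rightarrow> real) \<Rightarrow> real" where
  "Ex f \<equiv> expect p slot_set f"

definition Pr :: "((nat set \<times> nat) set \<Rightarrow> bool) \<Rightarrow> real" where
  "Pr E = Ex (\<lambda>\<omega>. of_bool (E \<omega>))"

definition confl :: "nat set set set" where "confl = conflicts k n"

lemma n1: "1 \<le> n" using n3 by simp

lemma p_nonneg: "0 \<le> p" and p_le: "p \<le> 1 / real n" and p_le_1: "p \<le> 1"
  and rp: "real r * p = c / real n"
proof -
  show "0 \<le> p" using eps by (simp add: p_def)
  show le: "p \<le> 1 / real n" using eps n3 by (simp add: p_def divide_right_mono)
  also have "\<dots> \<le> 1" using n3 by simp
  finally show "p \<le> 1" .
  show "real r * p = c / real n" by (simp add: p_def)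
qed

lemma c_nonneg: "0 \<le> c" using eps by simp

lemma rp_le_1: "real r * p \<le> 1" using large n3 by (simp add: rp)

lemma Pr_mono: "(\<And>\<omega>. \<omega> \<subseteq> slot_set \<Longrightarrow> E \<omega> \<Longrightarrow> E' \<omega>) \<Longrightarrow> Pr E \<le> Pr E'"
  unfolding Pr_def by (intro expect_mono p_nonneg p_le_1) auto

lemma Pr_cong: "(\<And>\<omega>. \<omega> \<subseteq> slot_set \<Longrightarrow> E \<omega> = E' \<omega>) \<Longrightarrow> Pr E = Pr E'"
  unfolding Pr_def by (rule expect_cong) simp

lemma Pr_nonneg: "0 \<le> Pr E"
  unfolding Pr_def by (intro expect_nonneg p_nonneg p_le_1) simp

lemma Pr_le_1: "Pr E \<le> 1"
  unfolding Pr_def by (intro expect_le_1 finite_slots p_nonneg p_le_1) simp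

lemma Pr_not: "Pr (\<lambda>\<omega>. \<not> E \<omega>) = 1 - Pr E"
proof -
  have "Pr (\<lambda>\<omega>. \<not> E \<omega>) = Ex (\<lambda>\<omega>. 1 - of_bool (E \<omega>))" unfolding Pr_def by (rule expect_cong) simp
  then show ?thesis by (simp add: expect_diff finite_slots Pr_def)
qed

lemma Pr_union:
  assumes "finite A" "\<And>\<omega>. \<omega> \<subseteq> slot_set \<Longrightarrow> E \<omega> \<Longrightarrow> \<exists>a\<in>A. E' a \<omega>"
  shows "Pr E \<le> (\<Sum>a\<in>A. Pr (E' a))"
proof -
  have "Pr E \<le> Ex (\<lambda>\<omega>. \<Sum>a\<in>A. of_bool (E' a \<omega>))"
    unfolding Pr_def
  proof (rule expect_mono[OF p_nonneg p_le_1])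
    fix \<omega> assume w: "\<omega> \<subseteq> slot_set"
    show "of_bool (E \<omega>) \<le> (\<Sum>a\<in>A. of_bool (E' a \<omega>) :: real)"
    proof (cases "E \<omega>")
      case True
      then obtain a where a: "a \<in> A" "E' a \<omega>" using assms(2) w by blast
      have "of_bool (E' a \<omega>) \<le> (\<Sum>a\<in>A. of_bool (E' a \<omega>) :: real)"
        by (rule member_le_sum) (use a assms in auto)
      then show ?thesis using a True by simp
    qed (simp add: sum_nonneg)
  qed
  then show ?thesis by (simp add: expect_sum Pr_def)
qed

lemma Pr_disj: "Pr (\<lambda>\<omega>. E \<omega> \<or> E' \<omega>) \<le> Pr E + Pr E'"
proof -
  have "Pr (\<lambda>\<omega>. E \<omega> \<or> E' \<omega>) \<le> Ex (\<lambda>\<omega>. of_bool (E \<omega>) + of_bool (E' \<omega>))"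
    unfolding Pr_def by (intro expect_mono p_nonneg p_le_1) auto
  then show ?thesis by (simp add: expect_add Pr_def)
qed

lemma Pr_split: "Pr E = Pr (\<lambda>\<omega>. E \<omega> \<and> E' \<omega>) + Pr (\<lambda>\<omega>. E \<omega> \<and> \<not> E' \<omega>)"
proof -
  have "Pr E = Ex (\<lambda>\<omega>. of_bool (E \<omega> \<and> E' \<omega>) + of_bool (E \<omega> \<and> \<not> E' \<omega>))"
    unfolding Pr_def by (rule expect_cong) auto
  then show ?thesis by (simp add: expect_add Pr_def)
qed

text \<open>A union bound over the round in which each triple is proposed; \<open>G\<close> collects
  the slots already chosen in the induction.\<close>

lemma Pr_proposed:
  assumes "finite R" "R \<subseteq> triples n" "G \<subseteq> slot_set" "R \<inter> fst ` G = {}"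
  shows "Pr (\<lambda>\<omega>. G \<subseteq> \<omega> \<and> R \<subseteq> fst ` \<omega>) \<le> p ^ card G * (real r * p) ^ card R"
  using assms
proof (induction R arbitrary: G rule: finite_induct)
  case empty
  then show ?case by (simp add: Pr_def expect_subset finite_slots)
next
  case (insert X R)
  have fG: "finite G" by (rule finite_subset[OF insert.prems(2) finite_slots])
  have "Pr (\<lambda>\<omega>. G \<subseteq> \<omega> \<and> insert X R \<subseteq> fst ` \<omega>) \<le>
     (\<Sum>l<r. Pr (\<lambda>\<omega>. insert (X, l) G \<subseteq> \<omega> \<and> R \<subseteq> fst ` \<omega>))"
  proof (rule Pr_union)
    fix \<omega> assume w: "\<omega> \<subseteq> slot_set" "G \<subseteq> \<omega> \<and> insert X R \<subseteq> fst ` \<omega>"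
    then obtain l where "(X, l) \<in> \<omega>" by auto
    then show "\<exists>l\<in>{..<r}. insert (X, l) G \<subseteq> \<omega> \<and> R \<subseteq> fst ` \<omega>" using w by (auto simp: slots_def)
  qed simp
  also have "\<dots> \<le> (\<Sum>l<r. p ^ Suc (card G) * (real r * p) ^ card R)"
  proof (rule sum_mono)
    fix l assume l: "l \<in> {..<r}"
    have "(X, l) \<notin> G" using insert.prems by force
    then have "card (insert (X, l) G) = Suc (card G)" using fG by simp
    moreover have "Pr (\<lambda>\<omega>. insert (X, l) G \<subseteq> \<omega> \<and> R \<subseteq> fst ` \<omega>) \<le>
        p ^ card (insert (X, l) G) * (real r * p) ^ card R"
      by (rule insert.IH) (use insert.prems insert.hyps l in \<open>auto simp: slots_def\<close>)
    ultimately show "Pr (\<lambda>\<omega>. insert (X, l) G \<subseteq> \<omega> \<and> R \<subseteq> fst ` \<omega>) \<le> p ^ Suc (card G) * (real r * p) ^ card R"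
      by simp
  qed
  also have "\<dots> = p ^ card G * (real r * p) ^ card (insert X R)" using insert.hyps by simp
  finally show ?case .
qed

lemma Pr_proposed': "finite R \<Longrightarrow> R \<subseteq> triples n \<Longrightarrow> Pr (\<lambda>\<omega>. R \<subseteq> fst ` \<omega>) \<le> (real r * p) ^ card R"
  using Pr_proposed[of R "{}"] by simp

lemma Pr_proposed1: "X \<in> triples n \<Longrightarrow> Pr (\<lambda>\<omega>. X \<in> fst ` \<omega>) \<le> c / real n"
  using Pr_proposed'[of "{X}"] by (simp add: rp)

lemma confl_finite: "C \<in> confl \<Longrightarrow> finite C" and confl_card: "C \<in> confl \<Longrightarrow> card C \<le> k"
  and confl_tight: "C \<in> confl \<Longrightarrow> tight C" and confl_triples: "C \<in> confl \<Longrightarrow> C \<subseteq> triples n"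
  and finite_confl: "finite confl"
  unfolding confl_def using finite_conflicts
  by (auto simp: conflicts_def tight_finite tight_card3 triples_def)

lemma sel_triples: "\<omega> \<subseteq> slot_set \<Longrightarrow> sel D \<omega> i \<subseteq> triples n"
  using sel_subset_fst[of D \<omega> i] by (fastforce simp: slots_def)

text \<open>A permutation of the points carrying \<open>X\<close> to \<open>Y\<close> preserves both
  the conflicts and the measure. Hence the triple \<open>{0,1,2}\<close> can represent all others in
  \<open>s\<close>.\<close>

lemma Pr_sel_eq:
  assumes X: "X \<in> triples n" "Y \<in> triples n"
  shows "Pr (\<lambda>\<omega>. X \<in> sel confl \<omega> i) = Pr (\<lambda>\<omega>. Y \<in> sel confl \<omega> i)"
proof -
  obtain s where s: "bij s" "s ` {..<n} = {..<n}" "s ` X = Y" using ex_permutation_image[OF X] .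
  have inj: "inj s" using s(1) by (rule bij_is_inj)
  have inj1: "inj ((`) s)" using inj by (meson inj_image_eq_iff injI)
  have inj2: "inj ((`) ((`) s))" using inj1 by (meson inj_image_eq_iff injI)
  have c1: "card (s ` T) = card T" for T using inj by (meson card_image inj_on_subset subset_UNIV)
  have c2: "card ((`) s ` T) = card T" for T using inj1 by (meson card_image inj_on_subset subset_UNIV)
  have "(`) ((`) s) ` confl \<subseteq> confl"
  proof (rule image_subsetI)
    fix C assume "C \<in> confl"
    then have C: "tight C" "card C \<le> k" "\<Union>C \<subseteq> {..<n}" by (auto simp: confl_def conflicts_def)
    have "\<Union>((`) s ` C) = s ` \<Union>C" by auto
    also have "\<dots> \<subseteq> {..<n}" using C(3) s(2) by blast
    finally show "(`) s ` C \<in> confl"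
      using tight_inj_image[OF inj C(1)] C(2) by (simp add: confl_def conflicts_def c2)
  qed
  then have cinv: "(`) ((`) s) ` confl = confl"
    using endo_inj_surj[OF finite_confl] inj2 by (meson inj_on_subset subset_UNIV)
  define \<phi> where "\<phi> = (map_prod ((`) s) id :: nat set \<times> nat \<Rightarrow> nat set \<times> nat)"
  have inj\<phi>: "inj \<phi>" unfolding \<phi>_def by (rule prod.inj_map[OF inj1]) simp
  have "\<phi> ` slot_set \<subseteq> slot_set"
    using s(2) by (fastforce simp: \<phi>_def slots_def triples_def c1)
  then have "\<phi> ` slot_set = slot_set"
    using endo_inj_surj[OF finite_slots] inj\<phi> by (meson inj_on_subset subset_UNIV)
  then have bij: "bij_betw \<phi> slot_set slot_set" using inj_on_subset[OF inj\<phi> subset_UNIV] unfolding bij_betw_def by blast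
  have "Y \<in> sel confl (\<phi> ` \<omega>) i \<longleftrightarrow> X \<in> sel confl \<omega> i" for \<omega>
  proof -
    have "sel confl (\<phi> ` \<omega>) i = (`) s ` sel confl \<omega> i"
      using sel_image[OF inj1, of confl \<omega> i] by (simp only: cinv \<phi>_def)
    then show ?thesis using s(3) inj1 by (metis inj_image_mem_iff)
  qed
  then show ?thesis unfolding Pr_def
    by (subst (2) expect_reindex[OF finite_slots bij]) simp
qed

definition s :: "nat \<Rightarrow> real" where "s i = Pr (\<lambda>\<omega>. {0,1,2} \<in> sel confl \<omega> i)"

lemma Pr_sel: "X \<in> triples n \<Longrightarrow> Pr (\<lambda>\<omega>. X \<in> sel confl \<omega> i) = s i"
  unfolding s_def by (rule Pr_sel_eq) (use n3 in \<open>auto simp: triples_def\<close>)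

definition ext :: "nat set \<Rightarrow> nat set set" where "ext e = {X \<in> triples n. e \<subseteq> X}"

lemma finite_ext: "finite (ext e)"
  by (simp add: ext_def finite_triples)

lemma card_ext:
  assumes e: "e \<subseteq> {..<n}" "card e = 2"
  shows "card (ext e) = n - 2"
proof -
  have fe: "finite e" using e by (auto intro: card_ge_0_finite)
  have "ext e = (\<lambda>z. insert z e) ` ({..<n} - e)"
  proof (intro equalityI subsetI)
    fix X assume "X \<in> ext e"
    then have X: "X \<subseteq> {..<n}" "card X = 3" "e \<subseteq> X" by (auto simp: ext_def triples_def)
    then have "card (X - e) = 1" using fe e by (simp add: card_Diff_subset)
    then obtain z where "X - e = {z}" by (metis card_1_singletonE)
    then have "X = insert z e" "z \<in> {..<n} - e" using X by auto
    then show "X \<in> (\<lambda>z. insert z e) ` ({..<n} - e)" by blast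
  qed (use e fe in \<open>auto simp: ext_def triples_def\<close>)
  moreover have "inj_on (\<lambda>z. insert z e) ({..<n} - e)" by (rule inj_onI) auto
  ultimately show ?thesis using fe e by (simp add: card_image card_Diff_subset)
qed

lemma two_triples_conflict:
  assumes "X \<in> triples n" "Y \<in> triples n" "X \<noteq> Y" "e \<subseteq> X" "e \<subseteq> Y" "card e = 2"
  shows "{X, Y} \<in> confl"
proof -
  have c: "card X = 3" "card Y = 3" using assms by (auto simp: triples_def)
  then have fin: "finite X" "finite Y" by (auto intro: card_ge_0_finite)
  have "card e \<le> card (X \<inter> Y)" by (rule card_mono) (use fin assms in auto)
  then have "card (X \<union> Y) \<le> 4" using card_Un_Int[OF fin] c assms by simp
  moreover have "\<not> 2 \<le> card D" if "D \<subset> {X,Y}" for D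
    using psubset_card_mono[OF _ that] assms(3) by simp
  ultimately have "tight {X,Y}" using c assms(3) unfolding tight_def by auto
  then show ?thesis using assms k2 by (simp add: confl_def conflicts_def triples_def)
qed

lemma sel_ext_unique:
  assumes "\<omega> \<subseteq> slot_set" "card e = 2" "X \<in> ext e" "Y \<in> ext e" "X \<in> sel confl \<omega> i" "Y \<in> sel confl \<omega> i"
  shows "X = Y"
proof (rule ccontr)
  assume "X \<noteq> Y"
  then have "{X, Y} \<in> confl" using two_triples_conflict[of X Y e] assms by (auto simp: ext_def)
  then show False using sel_conflict_free[of "{X,Y}" confl \<omega> i] assms by auto
qed

text \<open>At most one selected triple contains \<open>e\<close>, so the events are disjoint and
  the union bound is an equality.\<close>

lemma Pr_uncovered:
  assumes e: "e \<subseteq> {..<n}" "card e = 2"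
  shows "Pr (\<lambda>\<omega>. \<not> (\<exists>X\<in>ext e. X \<in> sel confl \<omega> i)) = 1 - real (n - 2) * s i"
proof -
  have "Pr (\<lambda>\<omega>. \<exists>X\<in>ext e. X \<in> sel confl \<omega> i) = Ex (\<lambda>\<omega>. \<Sum>X\<in>ext e. of_bool (X \<in> sel confl \<omega> i))"
    unfolding Pr_def
  proof (rule expect_cong)
    fix \<omega> assume w: "\<omega> \<subseteq> slot_set"
    show "of_bool (\<exists>X\<in>ext e. X \<in> sel confl \<omega> i) = (\<Sum>X\<in>ext e. of_bool (X \<in> sel confl \<omega> i) :: real)"
    proof (cases "\<exists>X\<in>ext e. X \<in> sel confl \<omega> i")
      case True
      then obtain X where X: "X \<in> ext e" "X \<in> sel confl \<omega> i" by blast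
      have "(\<Sum>Y\<in>ext e. of_bool (Y \<in> sel confl \<omega> i) :: real) = (\<Sum>Y\<in>ext e. if Y = X then 1 else 0)"
        by (rule sum.cong[OF refl]) (use sel_ext_unique[OF w e(2) X(1)] X in auto)
      also have "\<dots> = 1" using X finite_ext by simp
      finally show ?thesis using True by simp
    qed auto
  qed
  also have "\<dots> = (\<Sum>X\<in>ext e. s i)"
    unfolding expect_sum by (rule sum.cong) (use Pr_sel in \<open>auto simp: ext_def Pr_def\<close>)
  finally show ?thesis unfolding Pr_not by (simp add: card_ext[OF e])
qed

lemma s_nonneg: "0 \<le> s i" and s_mono: "i \<le> j \<Longrightarrow> s i \<le> s j"
  unfolding s_def by (rule Pr_nonneg) (intro Pr_mono, erule rev_subsetD[OF _ sel_mono])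

text \<open>Nonnegativity of the probability that a pair is uncovered caps \<open>s\<close>,
  whatever \<open>r\<close> and \<epsilon> are. All bounds independent of \<open>c\<close> rest on
  this one.\<close>

lemma s_le: "s i \<le> 3 / real n"
proof -
  have e: "{0,1} \<subseteq> {..<n}" "card {0,1::nat} = 2" using n3 by auto
  have "0 \<le> 1 - real (n - 2) * s i" unfolding Pr_uncovered[OF e, symmetric] by (rule Pr_nonneg)
  then have "s i \<le> 1 / real (n - 2)" using n3 by (simp add: field_simps)
  also have "\<dots> \<le> 3 / real n" using n3 by (simp add: field_simps)
  finally show ?thesis .
qed

end

section \<open>Asymptotic independence\<close>

text \<open>The excess bound in the form used by the covariance estimate: the points of
  \<open>C\<close> count as fixed, so each triple of \<open>R\<close> is a slot without new points,
  and closing the cycle saves one more point.\<close>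

lemma deficient_at_conflict:
  assumes C: "tight C" "3 \<le> card C" "C \<notin> \<D>" and \<D>: "\<forall>D\<in>\<D>. tight D" and L: "linked \<D> L"
    and H: "finite H" "\<forall>T\<in>fst ` H. card T = 3"
    and XY: "X \<in> L" "X \<in> C" "Y \<in> L" "Y \<in> C" "X \<noteq> Y"
    and eq: "L \<union> C = fst ` H \<union> C" and R: "R \<subseteq> fst ` H" "R \<subseteq> C"
  shows "card (\<Union>(fst ` H) \<union> \<Union>C) + card R + 1 \<le> card (\<Union>C) + card H"
proof -
  have fC: "finite C" by (rule tight_finite[OF C(1)])
  have sub: "L \<subseteq> fst ` H \<union> C" using eq by blast
  have fin: "finite (fst ` H \<union> C)" using H(1) fC by simp
  have L3: "\<forall>T\<in>L. card T = 3" using sub H(2) tight_card3[OF C(1)] by blast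
  have "card (\<Union>(L \<union> C)) \<le> card (L \<union> C) + 1"
    by (rule linked_through_conflict[OF finite_subset[OF sub fin] L3 C \<D> L XY])
  then have 1: "card (\<Union>(fst ` H) \<union> \<Union>C) \<le> card (fst ` H \<union> C) + 1" by (simp add: eq)
  have 2: "card (fst ` H \<union> C) + card (fst ` H \<inter> C) = card (fst ` H) + card C"
    using card_Un_Int[of "fst ` H" C] H(1) fC by simp
  have 3: "card R \<le> card (fst ` H \<inter> C)" by (rule card_mono) (use R fC in auto)
  have 4: "card (fst ` H) \<le> card H" by (rule card_image_le[OF H(1)])
  have "C \<noteq> {}" using XY by blast
  then have 5: "card C + 2 \<le> card (\<Union>C)" by (intro tight_sub[OF C(1)]) auto
  from 1 2 3 4 5 show ?thesis by linarith
qed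

context rounds
begin

lemma Pr_covariance:
  assumes W: "finite W" "card W \<le> k + 3"
    and pE: "\<And>x \<omega>. E (insert x \<omega>) \<noteq> E \<omega> \<Longrightarrow> \<exists>F\<subseteq>\<omega>. card F \<le> k * r + k \<and> P x F"
    and pE': "\<And>x \<omega>. E' (insert x \<omega>) \<noteq> E' \<omega> \<Longrightarrow> \<exists>F\<subseteq>\<omega>. card F \<le> k * r + k \<and> Q x F"
    and deficient: "\<And>x F G H. H \<subseteq> slot_set \<Longrightarrow> finite H \<Longrightarrow> H = insert x (F \<union> G) \<Longrightarrow> P x F \<Longrightarrow> Q x G \<Longrightarrow>
        card (\<Union>(fst ` H) \<union> W) + h + 1 \<le> card W + card H"
  shows "\<bar>Pr (\<lambda>\<omega>. E \<omega> \<and> E' \<omega>) - Pr E * Pr E'\<bar> \<le> cov_bound k r / real n ^ (h + 1)"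
proof -
  have "\<bar>Ex (\<lambda>\<omega>. of_bool (E \<omega>) * of_bool (E' \<omega>)) - Pr E * Pr E'\<bar> \<le> cov_bound k r / real n ^ (h + 1)"
    unfolding Pr_def cov_bound_def
  proof (rule covariance_small[OF n1 p_nonneg p_le W, where P = P and Q = Q])
    fix x \<omega>
    show "\<exists>F\<subseteq>\<omega>. card F \<le> k * r + k \<and> P x F" if "(of_bool (E (insert x \<omega>)) :: real) \<noteq> of_bool (E \<omega>)"
      by (rule pE) (use that in auto)
    show "\<exists>F\<subseteq>\<omega>. card F \<le> k * r + k \<and> Q x F" if "(of_bool (E' (insert x \<omega>)) :: real) \<noteq> of_bool (E' \<omega>)"
      by (rule pE') (use that in auto)
  qed (use deficient in \<open>simp_all\<close>)
  then show ?thesis by (simp add: Pr_def of_bool_conj)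
qed

lemma slot_triples: "H \<subseteq> slot_set \<Longrightarrow> \<forall>T\<in>fst ` H. card T = 3"
  by (auto simp: slots_def triples_def)

end

locale rounds_at = rounds +
  fixes T :: "nat set"
  assumes T: "T \<in> triples n"
begin

definition others :: "nat set set set" where "others = {C \<in> confl. T \<notin> C}"

definition large_confl :: "nat set set set" where "large_confl = {C \<in> confl. T \<in> C \<and> 3 \<le> card C}"

text \<open>Decisions in this process depend only on conflicts avoiding \<open>T\<close>, so a chain
  traced in it cannot use a conflict at \<open>T\<close>, as \<open>linked_through_conflict\<close>
  requires.\<close>

abbreviation away :: "(nat set \<times> nat) set \<Rightarrow> nat \<Rightarrow> nat set set" where "away \<omega> i \<equiv> sel others \<omega> i"

lemma others_bound: "C \<in> others \<Longrightarrow> finite C \<and> card C \<le> k"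
  by (simp add: others_def confl_finite confl_card)

lemma T_card: "card T = 3" "finite T" "T \<subseteq> {..<n}"
  using T by (auto simp: triples_def intro: card_ge_0_finite)

lemma away_eq: "T \<notin> fst ` \<omega> \<Longrightarrow> sel confl \<omega> i = away \<omega> i"
  unfolding others_def by (rule sel_avoid)

text \<open>The comparison with the true process fails only if \<open>T\<close> is proposed along
  with \<open>X\<close>, which adds at most 1/n to the 3/n of \<open>s_le\<close>.\<close>

lemma Pr_away:
  assumes X: "X \<in> triples n" "X \<noteq> T"
  shows "Pr (\<lambda>\<omega>. X \<in> away \<omega> i) \<le> 4 / real n"
proof -
  have "Pr (\<lambda>\<omega>. X \<in> away \<omega> i) \<le> Pr (\<lambda>\<omega>. X \<in> sel confl \<omega> i \<or> {X, T} \<subseteq> fst ` \<omega>)"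
  proof (rule Pr_mono)
    fix \<omega> assume X: "X \<in> away \<omega> i"
    then have "X \<in> fst ` \<omega>" by (rule subsetD[OF sel_subset_fst])
    then show "X \<in> sel confl \<omega> i \<or> {X, T} \<subseteq> fst ` \<omega>" using X away_eq[of \<omega> i] by (cases "T \<in> fst ` \<omega>") auto
  qed
  also have "\<dots> \<le> Pr (\<lambda>\<omega>. X \<in> sel confl \<omega> i) + Pr (\<lambda>\<omega>. {X, T} \<subseteq> fst ` \<omega>)" by (rule Pr_disj)
  also have "Pr (\<lambda>\<omega>. X \<in> sel confl \<omega> i) \<le> 3 / real n" using Pr_sel[OF X(1)] s_le by simp
  also have "Pr (\<lambda>\<omega>. {X, T} \<subseteq> fst ` \<omega>) \<le> (real r * p) ^ card {X, T}"
    by (rule Pr_proposed') (use X T in auto)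
  also have "\<dots> = c\<^sup>2 / (real n)\<^sup>2" using X(2) by (simp add: rp power_divide power2_eq_square)
  also have "\<dots> \<le> real n / (real n)\<^sup>2" by (rule divide_right_mono) (use large in auto)
  also have "\<dots> = 1 / real n" by (simp add: power2_eq_square)
  finally show ?thesis by simp
qed

lemma conflict_at:
  assumes "C \<in> confl" "T \<in> C"
  shows "card (C - {T}) = card C - 1" "card (\<Union>C) \<le> k + 3" "finite (\<Union>C)" "C \<notin> others" "finite (C - {T})"
    "C - {T} \<subseteq> triples n"
proof -
  have t: "tight C" using assms by (simp add: confl_tight)
  show "card (C - {T}) = card C - 1" using assms by simp
  show "card (\<Union>C) \<le> k + 3" using tight_le[OF t] confl_card[OF assms(1)] by linarith
  show "finite (\<Union>C)" using finite_Int_Union[OF t, of UNIV] by simp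
  show "C \<notin> others" using assms by (simp add: others_def)
  show "finite (C - {T})" using confl_finite assms by simp
  show "C - {T} \<subseteq> triples n" using confl_triples[OF assms(1)] by blast
qed

text \<open>A proposal pivotal for both events yields a chain of conflicts avoiding \<open>T\<close>
  from \<open>Y\<close> to a member of \<open>R\<close>, closing a cycle with \<open>C\<close>. The
  error is thus one power of n below the order of the product.\<close>

lemma Pr_away_pair:
  assumes C: "C \<in> confl" "T \<in> C" "3 \<le> card C" and i: "i \<le> r"
    and R: "R \<subseteq> C - {T}" "Y \<in> C - {T}" "Y \<notin> R"
  shows "Pr (\<lambda>\<omega>. Y \<in> away \<omega> i \<and> R \<subseteq> away \<omega> i)
    \<le> Pr (\<lambda>\<omega>. Y \<in> away \<omega> i) * Pr (\<lambda>\<omega>. R \<subseteq> away \<omega> i) + cov_bound k r / real n ^ (card R + 2)"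
proof -
  have fR: "finite R" by (rule finite_subset[OF R(1) conflict_at(5)[OF C(1,2)]])
  have cR: "card R \<le> k"
    using card_mono[OF conflict_at(5)[OF C(1,2)] R(1)] conflict_at(1)[OF C(1,2)] confl_card[OF C(1)] by linarith
  have ki: "k * i \<le> k * r" using i by simp
  have "\<bar>Pr (\<lambda>\<omega>. Y \<in> away \<omega> i \<and> R \<subseteq> away \<omega> i) - Pr (\<lambda>\<omega>. Y \<in> away \<omega> i) * Pr (\<lambda>\<omega>. R \<subseteq> away \<omega> i)\<bar>
     \<le> cov_bound k r / real n ^ ((card R + 1) + 1)"
  proof (rule Pr_covariance[where W = "\<Union>C"
        and P = "\<lambda>x F. Y \<in> fst ` insert x F \<and> linked others (fst ` insert x F)"
        and Q = "\<lambda>x G. \<exists>L. fst ` insert x G = L \<union> R \<and> linked others L \<and> fst x \<in> L \<and> L \<inter> R \<noteq> {}"])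
    fix x \<omega>
    show "\<exists>F\<subseteq>\<omega>. card F \<le> k * r + k \<and> Y \<in> fst ` insert x F \<and> linked others (fst ` insert x F)"
      if piv: "(Y \<in> away (insert x \<omega>) i) \<noteq> (Y \<in> away \<omega> i)"
    proof -
      obtain F where F: "F \<subseteq> \<omega>" "card F \<le> k * i" "Y \<in> fst ` insert x F" "linked others (fst ` insert x F)"
        using sel_pivotal[OF others_bound piv] by blast
      have "card F \<le> k * r + k" using F(2) ki by linarith
      then show ?thesis using F by blast
    qed
    show "\<exists>F\<subseteq>\<omega>. card F \<le> k * r + k \<and> (\<exists>L. fst ` insert x F = L \<union> R \<and> linked others L \<and> fst x \<in> L \<and> L \<inter> R \<noteq> {})"
      if piv: "(R \<subseteq> away (insert x \<omega>) i) \<noteq> (R \<subseteq> away \<omega> i)"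
    proof -
      obtain F L where F: "F \<subseteq> \<omega>" "card F \<le> k * i + card R"
        "fst ` insert x F = L \<union> R" "linked others L" "fst x \<in> L" "L \<inter> R \<noteq> {}"
        using subset_sel_pivotal[OF others_bound fR piv] by (metis (lifting))
      have "card F \<le> k * r + k" using F(2) ki cR by linarith
      then show ?thesis using F by (intro exI[of _ F] exI[of _ L] conjI)
    qed
  next
    fix x F G H
    assume H: "H \<subseteq> slot_set" "finite H" "H = insert x (F \<union> G)"
      and P: "Y \<in> fst ` insert x F \<and> linked others (fst ` insert x F)"
      and Q: "\<exists>L. fst ` insert x G = L \<union> R \<and> linked others L \<and> fst x \<in> L \<and> L \<inter> R \<noteq> {}"
    from Q obtain L where L: "fst ` insert x G = L \<union> R" "linked others L" "fst x \<in> L" "L \<inter> R \<noteq> {}"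
      by (elim exE conjE)
    from L(4) obtain Z where Z: "Z \<in> L" "Z \<in> R" by blast
    have eqH: "fst ` H = fst ` insert x F \<union> L \<union> R" using H(3) L(1) by auto
    have "card (\<Union>(fst ` H) \<union> \<Union>C) + card (insert Y R) + 1 \<le> card (\<Union>C) + card H"
    proof (rule deficient_at_conflict[where \<D> = others and L = "fst ` insert x F \<union> L" and X = Y and Y = Z])
      show "tight C" by (rule confl_tight[OF C(1)])
      show "\<forall>D\<in>others. tight D" by (simp add: others_def confl_tight)
      show "linked others (fst ` insert x F \<union> L)"
        by (rule linked_Un[OF conjunct2[OF P] L(2)]) (use L(3) in auto)
      show "\<forall>T\<in>fst ` H. card T = 3" by (rule slot_triples[OF H(1)])
      show "Y \<in> fst ` insert x F \<union> L" using P by blast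
      show "Z \<in> fst ` insert x F \<union> L" "Z \<in> C" using Z R(1) by blast+
      show "Y \<noteq> Z" using Z R(3) by blast
      show "insert Y R \<subseteq> C" "Y \<in> C" using R(1,2) by blast+
      show "fst ` insert x F \<union> L \<union> C = fst ` H \<union> C" using eqH R(1) by blast
      show "insert Y R \<subseteq> fst ` H" using eqH P by blast
    qed (rule C(3) conflict_at(4)[OF C(1,2)] H(2))+
    then show "card (\<Union>(fst ` H) \<union> \<Union>C) + (card R + 1) + 1 \<le> card (\<Union>C) + card H"
      using R(3) fR by simp
  qed (rule conflict_at(2,3)[OF C(1,2)])+
  then show ?thesis by simp
qed

text \<open>Triples are added one at a time. Only the lower-order error depends on \<open>r\<close>;
  the main term does not.\<close>

lemma Pr_away_all:
  assumes C: "C \<in> confl" "T \<in> C" "3 \<le> card C" and i: "i \<le> r" and R: "R \<subseteq> C - {T}"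
  shows "Pr (\<lambda>\<omega>. R \<subseteq> away \<omega> i)
    \<le> (4 / real n) ^ card R + real (card R) * 4 ^ card R * cov_bound k r / real n ^ (card R + 1)"
proof -
  have "finite R" by (rule finite_subset[OF R conflict_at(5)[OF C(1,2)]])
  then show ?thesis using R
  proof (induction R rule: finite_induct)
    case empty
    then show ?case by (simp add: Pr_le_1)
  next
    case (insert Y R)
    let ?K = "cov_bound k r" and ?m = "card R" and ?n = "real n"
    have n0: "0 < ?n" using n3 by simp
    have Y: "Y \<in> triples n" "Y \<noteq> T" using insert.prems conflict_at(6)[OF C(1,2)] by auto
    have "Pr (\<lambda>\<omega>. insert Y R \<subseteq> away \<omega> i) = Pr (\<lambda>\<omega>. Y \<in> away \<omega> i \<and> R \<subseteq> away \<omega> i)" by simp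
    also have "\<dots> \<le> Pr (\<lambda>\<omega>. Y \<in> away \<omega> i) * Pr (\<lambda>\<omega>. R \<subseteq> away \<omega> i) + ?K / ?n ^ (?m + 2)"
      by (rule Pr_away_pair[OF C i]) (use insert in auto)
    also have "\<dots> \<le> (4 / ?n) * ((4 / ?n) ^ ?m + real ?m * 4 ^ ?m * ?K / ?n ^ (?m + 1)) + ?K / ?n ^ (?m + 2)"
      by (intro add_right_mono mult_mono Pr_away[OF Y] insert.IH Pr_nonneg) (use insert.prems in auto)
    also have "\<dots> = (4 / ?n) ^ Suc ?m + (real ?m * 4 ^ Suc ?m + 1) * ?K / ?n ^ (Suc ?m + 1)"
      using n0 by (simp add: field_simps)
    also have "\<dots> \<le> (4 / ?n) ^ Suc ?m + (real (Suc ?m) * 4 ^ Suc ?m) * ?K / ?n ^ (Suc ?m + 1)"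
    proof -
      have "(1::real) \<le> 4 ^ Suc ?m" by (rule one_le_power) simp
      then have "real ?m * 4 ^ Suc ?m + 1 \<le> real (Suc ?m) * 4 ^ Suc ?m" by (simp add: algebra_simps)
      then show ?thesis using cov_bound_nonneg n0 by (intro add_left_mono divide_right_mono mult_right_mono) auto
    qed
    finally show ?case using insert.hyps by simp
  qed
qed

text \<open>\<open>4 ^ k\<close> comes from the main term of \<open>Pr_away_all\<close>, and 1
  absorbs its error. Neither \<open>r\<close> nor \<epsilon> occurs, so \<kappa> does not depend on
  \<open>c\<close>.\<close>

definition total_const :: real where "total_const = (4 ^ k + 1) * conflict_const k"

lemma sum_Pr_away_all:
  assumes i: "i \<le> r"
  shows "(\<Sum>C\<in>large_confl. Pr (\<lambda>\<omega>. C - {T} \<subseteq> away \<omega> i)) \<le> total_const"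
proof -
  let ?n = "real n"
  have n0: "0 < ?n" using n3 by simp
  have "Pr (\<lambda>\<omega>. C - {T} \<subseteq> away \<omega> i) \<le> (4 ^ k + 1) / ?n ^ (card C - 1)" if "C \<in> large_confl" for C
  proof -
    have C: "C \<in> confl" "T \<in> C" "3 \<le> card C" using that by (auto simp: large_confl_def)
    let ?m = "card (C - {T})"
    have mk: "?m \<le> k" using conflict_at(1)[OF C(1,2)] confl_card[OF C(1)] by linarith
    have "Pr (\<lambda>\<omega>. C - {T} \<subseteq> away \<omega> i) \<le> (4 / ?n) ^ ?m + real ?m * 4 ^ ?m * cov_bound k r / ?n ^ (?m + 1)"
      by (rule Pr_away_all[OF C i order_refl])
    also have "\<dots> = (4 ^ ?m + real ?m * 4 ^ ?m * cov_bound k r / ?n) / ?n ^ ?m"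
      using n0 by (simp add: field_simps)
    also have "\<dots> \<le> (4 ^ k + 1) / ?n ^ ?m"
    proof (intro divide_right_mono add_mono)
      show "(4::real) ^ ?m \<le> 4 ^ k" using mk by (rule power_increasing) simp
      have "real ?m * 4 ^ ?m * cov_bound k r \<le> real k * 4 ^ k * cov_bound k r"
        by (intro mult_right_mono mult_mono power_increasing mk cov_bound_nonneg of_nat_mono) auto
      then show "real ?m * 4 ^ ?m * cov_bound k r / ?n \<le> 1" using large(3) n0 by (simp add: divide_le_eq_1)
    qed simp
    finally show ?thesis by (simp only: conflict_at(1)[OF C(1,2)])
  qed
  then have g: "(if 3 \<le> card C then Pr (\<lambda>\<omega>. C - {T} \<subseteq> away \<omega> i) else 0) \<le> (4 ^ k + 1) / ?n ^ (card C - 1)"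
    if "C \<in> conflicts k n" "T \<in> C" for C
    using that by (auto simp: large_confl_def confl_def)
  have "(\<Sum>C\<in>large_confl. Pr (\<lambda>\<omega>. C - {T} \<subseteq> away \<omega> i))
      = (\<Sum>C\<in>large_confl. if 3 \<le> card C then Pr (\<lambda>\<omega>. C - {T} \<subseteq> away \<omega> i) else 0)"
    by (rule sum.cong) (auto simp: large_confl_def)
  also have "\<dots> \<le> (4 ^ k + 1) * conflict_const k"
    by (rule conflict_sum_le[OF n1 T _ g]) (auto simp: large_confl_def confl_def)
  finally show ?thesis by (simp add: total_const_def)
qed

text \<open>The member proposed in round \<open>i\<close> itself costs \<epsilon>/n, each further
  one c/n. The total is therefore of order \<epsilon> for fixed \<open>c\<close>.\<close>

lemma sum_late_le:
  assumes i: "i < r" and A: "A \<subseteq> {C \<in> confl. T \<in> C}"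
  shows "(\<Sum>C\<in>A. \<Sum>Y\<in>C - {T}. Pr (\<lambda>\<omega>. (Y, i) \<in> \<omega> \<and> C - {T, Y} \<subseteq> fst ` \<omega>)) \<le> \<epsilon> * step_const k c"
proof -
  let ?n = "real n"
  have n0: "0 < ?n" using n3 by simp
  let ?a = "real k * \<epsilon> * (1 + c) ^ k"
  have a0: "0 \<le> ?a" using eps c_nonneg by (intro mult_nonneg_nonneg zero_le_power) auto
  have g: "(\<Sum>Y\<in>C - {T}. Pr (\<lambda>\<omega>. (Y, i) \<in> \<omega> \<and> C - {T, Y} \<subseteq> fst ` \<omega>)) \<le> ?a / ?n ^ (card C - 1)"
    if C': "C \<in> conflicts k n" "T \<in> C" for C
  proof -
    have C: "C \<in> confl" "T \<in> C" using that by (auto simp: confl_def)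
    have c2: "2 \<le> card C" using tight_2[OF confl_tight[OF C(1)]] .
    have ck: "card C \<le> k" by (rule confl_card[OF C(1)])
    have fC: "finite C" by (rule confl_finite[OF C(1)])
    have "Pr (\<lambda>\<omega>. (Y, i) \<in> \<omega> \<and> C - {T, Y} \<subseteq> fst ` \<omega>) \<le> \<epsilon> * (1 + c) ^ k / ?n ^ (card C - 1)"
      if Y: "Y \<in> C - {T}" for Y
    proof -
      have cc: "card (C - {T, Y}) = card C - 2"
      proof -
        have "T \<noteq> Y" "{T, Y} \<subseteq> C" using Y C(2) by blast+
        moreover from this have "card {T, Y} = 2" by simp
        ultimately show ?thesis using card_Diff_subset[of "{T, Y}" C] by simp
      qed
      have "Pr (\<lambda>\<omega>. {(Y, i)} \<subseteq> \<omega> \<and> C - {T, Y} \<subseteq> fst ` \<omega>) \<le> p ^ card {(Y, i)} * (real r * p) ^ card (C - {T, Y})"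
        by (rule Pr_proposed) (use fC Y confl_triples[OF C(1)] i in \<open>auto simp: slots_def\<close>)
      also have "\<dots> = (\<epsilon> / ?n) * (c / ?n) ^ (card C - 2)" unfolding rp cc by (simp add: p_def)
      also have "\<dots> = \<epsilon> * c ^ (card C - 2) / (?n * ?n ^ (card C - 2))" by (simp add: power_divide)
      also have "?n * ?n ^ (card C - 2) = ?n ^ (card C - 1)"
        using c2 by (metis Suc_diff_Suc Suc_1 Suc_le_lessD power_Suc One_nat_def)
      also have "\<epsilon> * c ^ (card C - 2) / ?n ^ (card C - 1) \<le> \<epsilon> * (1 + c) ^ k / ?n ^ (card C - 1)"
      proof (intro divide_right_mono mult_left_mono)
        have "c ^ (card C - 2) \<le> (1 + c) ^ (card C - 2)" by (rule power_mono) (use c_nonneg in auto)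
        also have "\<dots> \<le> (1 + c) ^ k" by (rule power_increasing) (use ck c_nonneg in auto)
        finally show "c ^ (card C - 2) \<le> (1 + c) ^ k" .
      qed (use eps in auto)
      finally show ?thesis by simp
    qed
    then have "(\<Sum>Y\<in>C - {T}. Pr (\<lambda>\<omega>. (Y, i) \<in> \<omega> \<and> C - {T, Y} \<subseteq> fst ` \<omega>))
        \<le> (\<Sum>Y\<in>C - {T}. \<epsilon> * (1 + c) ^ k / ?n ^ (card C - 1))" by (rule sum_mono)
    also have "\<dots> = real (card (C - {T})) * (\<epsilon> * (1 + c) ^ k / ?n ^ (card C - 1))" by simp
    also have "\<dots> \<le> real k * (\<epsilon> * (1 + c) ^ k / ?n ^ (card C - 1))"
    proof (rule mult_right_mono)
      show "real (card (C - {T})) \<le> real k" using conflict_at(1)[OF C] ck by simp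
      show "0 \<le> \<epsilon> * (1 + c) ^ k / ?n ^ (card C - 1)"
        using eps c_nonneg by (intro divide_nonneg_nonneg mult_nonneg_nonneg zero_le_power) auto
    qed
    finally show ?thesis by simp
  qed
  have "(\<Sum>C\<in>A. \<Sum>Y\<in>C - {T}. Pr (\<lambda>\<omega>. (Y, i) \<in> \<omega> \<and> C - {T, Y} \<subseteq> fst ` \<omega>)) \<le> ?a * conflict_const k"
    by (rule conflict_sum_le[OF n1 T a0 g]) (use A in \<open>simp_all add: confl_def\<close>)
  then show ?thesis by (simp add: step_const_def mult_ac)
qed

end

section \<open>Conflicts with at least three triples\<close>

lemma exp_minus_two_mult_le:
  fixes x :: real
  assumes "0 \<le> x" "x \<le> 1 / 2"
  shows "exp (- 2 * x) \<le> 1 - x"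
proof -
  have "1 + 2 * x \<le> exp (2 * x)" by (rule exp_ge_add_one_self)
  then have "1 / exp (2 * x) \<le> 1 / (1 + 2 * x)" using assms by (intro divide_left_mono) auto
  also have "\<dots> \<le> 1 - x"
  proof -
    have "x * (2 * x) \<le> x * 1" using assms by (intro mult_left_mono) auto
    then have "1 \<le> (1 - x) * (1 + 2 * x)" by (simp add: algebra_simps)
    then show ?thesis using assms by (simp add: pos_divide_le_eq)
  qed
  finally show ?thesis by (simp add: exp_minus inverse_eq_divide)
qed

context rounds_at
begin

text \<open>The event that \<open>\<E>\<close> leaves \<open>T\<close> selectable after
  \<open>i\<close> rounds, judged by the process that ignores conflicts at \<open>T\<close>.\<close>

definition quiet :: "nat \<Rightarrow> nat set set set \<Rightarrow> (nat set \<times> nat) set \<Rightarrow> bool" where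
  "quiet i \<E> \<omega> \<longleftrightarrow> \<not> (\<exists>C\<in>\<E>. C - {T} \<subseteq> away \<omega> i)"

lemma quiet_pivotal:
  assumes E: "\<E> \<subseteq> {C \<in> confl. T \<in> C}" and i: "i \<le> r"
    and ne: "quiet i \<E> (insert x \<omega>) \<noteq> quiet i \<E> \<omega>"
  shows "\<exists>F\<subseteq>\<omega>. card F \<le> k * r + k \<and> linked (others \<union> \<E>) (insert T (fst ` insert x F))"
proof -
  have ki: "k * i \<le> k * r" using i by simp
  have 1: "T \<in> C \<and> finite C \<and> card C \<le> k" if "C \<in> \<E>" for C
    using that E confl_finite confl_card by auto
  have 2: "(\<exists>C\<in>\<E>. C - {T} \<subseteq> away (insert x \<omega>) i) \<noteq> (\<exists>C\<in>\<E>. C - {T} \<subseteq> away \<omega> i)"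
    using ne unfolding quiet_def by argo
  obtain F where F: "F \<subseteq> \<omega>" "card F \<le> k * i + k" "linked (others \<union> \<E>) (insert T (fst ` insert x F))"
    using avoid_sel_pivotal[OF others_bound 1 2] by blast
  have "card F \<le> k * r + k" using F(2) ki by linarith
  then show ?thesis using F by blast
qed

definition completes :: "nat \<Rightarrow> nat set set \<Rightarrow> (nat set \<times> nat) set \<Rightarrow> bool" where
  "completes i C \<omega> \<longleftrightarrow> C - {T} \<subseteq> away \<omega> (Suc i) \<and> \<not> C - {T} \<subseteq> away \<omega> i"

lemma completes_pivotal:
  assumes C: "C \<in> confl" "T \<in> C" and i: "i < r"
    and ne: "completes i C (insert x \<omega>) \<noteq> completes i C \<omega>"
  shows "\<exists>F\<subseteq>\<omega>. card F \<le> k * r + k \<and>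
    (\<exists>L. fst ` insert x F = L \<union> (C - {T}) \<and> linked others L \<and> fst x \<in> L \<and> L \<inter> (C - {T}) \<noteq> {})"
proof -
  obtain j where j: "j \<le> Suc i" "(C - {T} \<subseteq> away (insert x \<omega>) j) \<noteq> (C - {T} \<subseteq> away \<omega> j)"
    using ne unfolding completes_def by (metis le_SucI order_refl)
  have kj: "k * j \<le> k * r" using j i by simp
  have cC: "card (C - {T}) \<le> k" using conflict_at(1)[OF C] confl_card[OF C(1)] by linarith
  obtain F L where F: "F \<subseteq> \<omega>" "card F \<le> k * j + card (C - {T})" "fst ` insert x F = L \<union> (C - {T})"
    "linked others L" "fst x \<in> L" "L \<inter> (C - {T}) \<noteq> {}"
    using subset_sel_pivotal[OF others_bound conflict_at(5)[OF C] j(2)] by (metis (lifting))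
  have "card F \<le> k * r + k" using F(2) kj cC by linarith
  then show ?thesis using F by (intro exI[of _ F] exI[of _ L] conjI)
qed

text \<open>\<open>C\<close> is dropped from the quiet family so that both traced chains avoid it.
  They reach \<open>T\<close> and another member of \<open>C\<close> respectively, and together
  close a cycle with \<open>C\<close>.\<close>

lemma Pr_quiet_completes:
  assumes C: "C \<in> large_confl" and i: "i < r"
  shows "Pr (\<lambda>\<omega>. quiet i (large_confl - {C}) \<omega> \<and> completes i C \<omega>)
    \<le> Pr (quiet i (large_confl - {C})) * Pr (completes i C) + cov_bound k r / real n ^ card C"
proof -
  have C': "C \<in> confl" "T \<in> C" "3 \<le> card C" using C by (auto simp: large_confl_def)
  let ?E = "large_confl - {C}"
  have E: "?E \<subseteq> {C \<in> confl. T \<in> C}" by (auto simp: large_confl_def)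
  have "\<bar>Pr (\<lambda>\<omega>. quiet i ?E \<omega> \<and> completes i C \<omega>) - Pr (quiet i ?E) * Pr (completes i C)\<bar>
     \<le> cov_bound k r / real n ^ ((card C - 1) + 1)"
  proof (rule Pr_covariance[where W = "\<Union>C"
        and P = "\<lambda>x F. linked (others \<union> ?E) (insert T (fst ` insert x F))"
        and Q = "\<lambda>x G. \<exists>L. fst ` insert x G = L \<union> (C - {T}) \<and> linked others L \<and> fst x \<in> L \<and> L \<inter> (C - {T}) \<noteq> {}"])
    fix x \<omega>
    show "\<exists>F\<subseteq>\<omega>. card F \<le> k * r + k \<and> linked (others \<union> ?E) (insert T (fst ` insert x F))"
      if "quiet i ?E (insert x \<omega>) \<noteq> quiet i ?E \<omega>"
      by (rule quiet_pivotal[OF E less_imp_le[OF i] that])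
    show "\<exists>F\<subseteq>\<omega>. card F \<le> k * r + k \<and>
        (\<exists>L. fst ` insert x F = L \<union> (C - {T}) \<and> linked others L \<and> fst x \<in> L \<and> L \<inter> (C - {T}) \<noteq> {})"
      if "completes i C (insert x \<omega>) \<noteq> completes i C \<omega>"
      by (rule completes_pivotal[OF C'(1,2) i that])
  next
    fix x F G H
    assume H: "H \<subseteq> slot_set" "finite H" "H = insert x (F \<union> G)"
      and P: "linked (others \<union> ?E) (insert T (fst ` insert x F))"
      and Q: "\<exists>L. fst ` insert x G = L \<union> (C - {T}) \<and> linked others L \<and> fst x \<in> L \<and> L \<inter> (C - {T}) \<noteq> {}"
    from Q obtain L where L: "fst ` insert x G = L \<union> (C - {T})" "linked others L" "fst x \<in> L" "L \<inter> (C - {T}) \<noteq> {}"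
      by (elim exE conjE)
    from L(4) obtain Z where Z: "Z \<in> L" "Z \<in> C - {T}" by blast
    have "fst ` H = fst ` insert x F \<union> fst ` insert x G" using H(3) by auto
    then have eqH: "fst ` H = fst ` insert x F \<union> L \<union> (C - {T})" by (simp only: L(1) Un_assoc)
    have "card (\<Union>(fst ` H) \<union> \<Union>C) + card (C - {T}) + 1 \<le> card (\<Union>C) + card H"
    proof (rule deficient_at_conflict[where \<D> = "others \<union> ?E" and L = "insert T (fst ` insert x F) \<union> L" and X = T and Y = Z])
      show "tight C" by (rule confl_tight[OF C'(1)])
      show "\<forall>D\<in>others \<union> ?E. tight D" by (auto simp: others_def large_confl_def confl_tight)
      show "linked (others \<union> ?E) (insert T (fst ` insert x F) \<union> L)"
        by (rule linked_Un[OF P linked_mono[OF L(2)]]) (use L(3) in auto)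
      show "\<forall>T\<in>fst ` H. card T = 3" by (rule slot_triples[OF H(1)])
      show "insert T (fst ` insert x F) \<union> L \<union> C = fst ` H \<union> C" using eqH C'(2) by blast
      show "C - {T} \<subseteq> fst ` H" using eqH by blast
      show "Z \<in> insert T (fst ` insert x F) \<union> L" "Z \<in> C" "T \<noteq> Z" using Z by blast+
      show "C \<notin> others \<union> ?E" using conflict_at(4)[OF C'(1,2)] by blast
    qed (use C' H in simp_all)
    then show "card (\<Union>(fst ` H) \<union> \<Union>C) + (card C - 1) + 1 \<le> card (\<Union>C) + card H"
      by (simp only: conflict_at(1)[OF C'(1,2)])
  qed (rule conflict_at(2,3)[OF C'(1,2)])+
  moreover have "card C - 1 + 1 = card C" using C'(3) by simp
  ultimately show ?thesis by simp
qed

text \<open>The hazard of round \<open>i\<close>. By \<open>sum_\<Delta>\<close> the hazards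
  telescope, and \<open>sum_Pr_away_all\<close> bounds their total.\<close>

definition \<Delta> :: "nat \<Rightarrow> real" where "\<Delta> i = (\<Sum>C\<in>large_confl. Pr (completes i C))"

lemma finite_large: "finite large_confl"
  by (rule finite_subset[OF _ finite_confl]) (auto simp: large_confl_def)

lemma sum_\<Delta>: "(\<Sum>l<i. \<Delta> l) = (\<Sum>C\<in>large_confl. Pr (\<lambda>\<omega>. C - {T} \<subseteq> away \<omega> i))"
proof (induction i)
  case 0
  have "Pr (\<lambda>\<omega>. C - {T} \<subseteq> away \<omega> 0) = 0" if "C \<in> large_confl" for C
  proof -
    have C: "C \<in> confl" "T \<in> C" "3 \<le> card C" using that by (auto simp: large_confl_def)
    have "card (C - {T}) \<noteq> 0" using conflict_at(1)[OF C(1,2)] C(3) by linarith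
    then have "C - {T} \<noteq> {}" by (metis card.empty)
    then have "Pr (\<lambda>\<omega>. C - {T} \<subseteq> away \<omega> 0) = Pr (\<lambda>\<omega>. False)" by (intro Pr_cong) simp
    then show ?thesis by (simp add: Pr_def finite_slots)
  qed
  then show ?case by simp
next
  case (Suc i)
  have "Pr (\<lambda>\<omega>. C - {T} \<subseteq> away \<omega> (Suc i)) = Pr (\<lambda>\<omega>. C - {T} \<subseteq> away \<omega> i) + Pr (completes i C)" for C
  proof -
    have "Pr (\<lambda>\<omega>. C - {T} \<subseteq> away \<omega> (Suc i)) =
       Pr (\<lambda>\<omega>. C - {T} \<subseteq> away \<omega> (Suc i) \<and> C - {T} \<subseteq> away \<omega> i) +
       Pr (\<lambda>\<omega>. C - {T} \<subseteq> away \<omega> (Suc i) \<and> \<not> C - {T} \<subseteq> away \<omega> i)" by (rule Pr_split)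
    moreover have "Pr (\<lambda>\<omega>. C - {T} \<subseteq> away \<omega> (Suc i) \<and> C - {T} \<subseteq> away \<omega> i) = Pr (\<lambda>\<omega>. C - {T} \<subseteq> away \<omega> i)"
    proof (rule Pr_cong)
      fix \<omega>
      have "away \<omega> i \<subseteq> away \<omega> (Suc i)" by (rule sel_mono) simp
      then show "(C - {T} \<subseteq> away \<omega> (Suc i) \<and> C - {T} \<subseteq> away \<omega> i) = (C - {T} \<subseteq> away \<omega> i)" by blast
    qed
    moreover have "completes i C = (\<lambda>\<omega>. C - {T} \<subseteq> away \<omega> (Suc i) \<and> \<not> C - {T} \<subseteq> away \<omega> i)"
      by (rule ext) (simp only: completes_def)
    ultimately show ?thesis by simp
  qed
  then show ?case using Suc by (simp only: sum.lessThan_Suc sum.distrib \<Delta>_def)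
qed

lemma \<Delta>_nonneg: "0 \<le> \<Delta> i"
  unfolding \<Delta>_def by (intro sum_nonneg Pr_nonneg)

lemma \<Delta>_le_half: 
  assumes i: "i < r" 
  shows "\<Delta> i \<le> 1 / 2"
proof -
  have "\<Delta> i \<le> (\<Sum>C\<in>large_confl. \<Sum>Y\<in>C - {T}. Pr (\<lambda>\<omega>. (Y, i) \<in> \<omega> \<and> C - {T, Y} \<subseteq> fst ` \<omega>))"
    unfolding \<Delta>_def
  proof (rule sum_mono, rule Pr_union)
    fix C assume C: "C \<in> large_confl"
    then show "finite (C - {T})" using confl_finite by (simp add: large_confl_def)
    fix \<omega> assume "completes i C \<omega>"
    then have w: "C - {T} \<subseteq> away \<omega> (Suc i)" "\<not> C - {T} \<subseteq> away \<omega> i"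
      unfolding completes_def by blast+
    then obtain Y where Y: "Y \<in> C - {T}" "Y \<notin> away \<omega> i" by blast
    then have "Y \<in> away \<omega> (Suc i)" using w by blast
    then have "(Y, i) \<in> \<omega>" using Y by simp
    moreover have "C - {T, Y} \<subseteq> fst ` \<omega>" using w(1) sel_subset_fst[of others \<omega> "Suc i"] by blast
    ultimately show "\<exists>Y\<in>C - {T}. (Y, i) \<in> \<omega> \<and> C - {T, Y} \<subseteq> fst ` \<omega>" using Y(1) by blast
  qed
  also have "\<dots> \<le> \<epsilon> * step_const k c" by (rule sum_late_le[OF i]) (auto simp: large_confl_def)
  also have "\<dots> \<le> 1 / 2" by (rule small)
  finally show ?thesis .
qed

definition err :: real where "err = (c + cov_bound k r * conflict_const k) / real n"

lemma conflict_const_nonneg: "0 \<le> conflict_const k"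
  by (simp add: conflict_const_def)

text \<open>Dropping \<open>C\<close> from the quiet family matters only if all its other triples
  are proposed, at cost c/n. Near-independence then turns the union bound over completed conflicts
  into the factor \<open>1 - \<Delta> i\<close>.\<close>

lemma quiet_step:
  assumes i: "i < r"
  shows "Pr (quiet i large_confl) * (1 - \<Delta> i) - err \<le> Pr (quiet (Suc i) large_confl)"
proof -
  let ?q = "Pr (quiet i large_confl)"
  have n0: "0 < real n" using n3 by simp
  have "?q = Pr (\<lambda>\<omega>. quiet i large_confl \<omega> \<and> quiet (Suc i) large_confl \<omega>) +
      Pr (\<lambda>\<omega>. quiet i large_confl \<omega> \<and> \<not> quiet (Suc i) large_confl \<omega>)" by (rule Pr_split)
  also have "Pr (\<lambda>\<omega>. quiet i large_confl \<omega> \<and> quiet (Suc i) large_confl \<omega>) \<le> Pr (quiet (Suc i) large_confl)"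
    by (rule Pr_mono) simp
  also have "Pr (\<lambda>\<omega>. quiet i large_confl \<omega> \<and> \<not> quiet (Suc i) large_confl \<omega>)
     \<le> (\<Sum>C\<in>large_confl. Pr (\<lambda>\<omega>. quiet i (large_confl - {C}) \<omega> \<and> completes i C \<omega>))"
  proof (rule Pr_union[OF finite_large])
    fix \<omega> assume q: "quiet i large_confl \<omega> \<and> \<not> quiet (Suc i) large_confl \<omega>"
    then obtain C where C: "C \<in> large_confl" "C - {T} \<subseteq> away \<omega> (Suc i)" by (metis quiet_def)
    have "completes i C \<omega>" using q C unfolding completes_def quiet_def by metis
    moreover have "quiet i (large_confl - {C}) \<omega>" using q unfolding quiet_def by (metis DiffD1)
    ultimately show "\<exists>C\<in>large_confl. quiet i (large_confl - {C}) \<omega> \<and> completes i C \<omega>"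
      using C(1) by metis
  qed
  also have "\<dots> \<le> (\<Sum>C\<in>large_confl. (?q + c / real n) * Pr (completes i C) + cov_bound k r / real n / real n ^ (card C - 1))"
  proof (rule sum_mono)
    fix C assume C: "C \<in> large_confl"
    then have C': "C \<in> confl" "T \<in> C" "3 \<le> card C" by (auto simp: large_confl_def)
    have "Pr (quiet i (large_confl - {C})) \<le> Pr (\<lambda>\<omega>. quiet i large_confl \<omega> \<or> C - {T} \<subseteq> fst ` \<omega>)"
    proof (rule Pr_mono)
      fix \<omega> assume "quiet i (large_confl - {C}) \<omega>"
      then show "quiet i large_confl \<omega> \<or> C - {T} \<subseteq> fst ` \<omega>"
        unfolding quiet_def using sel_subset_fst[of others \<omega> i] by blast
    qed
    also have "\<dots> \<le> ?q + Pr (\<lambda>\<omega>. C - {T} \<subseteq> fst ` \<omega>)" by (rule Pr_disj)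
    also have "Pr (\<lambda>\<omega>. C - {T} \<subseteq> fst ` \<omega>) \<le> (real r * p) ^ card (C - {T})"
      by (rule Pr_proposed'[OF conflict_at(5,6)[OF C'(1,2)]])
    also have "\<dots> \<le> (real r * p) ^ 1"
      by (rule power_decreasing) (use conflict_at(1)[OF C'(1,2)] C'(3) rp_le_1 p_nonneg in auto)
    finally have q: "Pr (quiet i (large_confl - {C})) \<le> ?q + c / real n" by (simp add: rp)
    have "cov_bound k r / real n ^ card C = cov_bound k r / real n / real n ^ (card C - 1)"
    proof -
      have "real n ^ card C = real n * real n ^ (card C - 1)" using C'(3) by (metis power_minus_mult mult.commute le_trans zero_less_numeral order_less_le_trans)
      then show ?thesis by simp
    qed
    then show "Pr (\<lambda>\<omega>. quiet i (large_confl - {C}) \<omega> \<and> completes i C \<omega>)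
      \<le> (?q + c / real n) * Pr (completes i C) + cov_bound k r / real n / real n ^ (card C - 1)"
      using Pr_quiet_completes[OF C i] mult_right_mono[OF q Pr_nonneg[of "completes i C"]] by linarith
  qed
  also have "\<dots> = (?q + c / real n) * \<Delta> i + (\<Sum>C\<in>large_confl. cov_bound k r / real n / real n ^ (card C - 1))"
    by (simp only: sum.distrib sum_distrib_left \<Delta>_def)
  also have "(\<Sum>C\<in>large_confl. cov_bound k r / real n / real n ^ (card C - 1)) \<le> cov_bound k r / real n * conflict_const k"
    by (rule conflict_sum_le[OF n1 T]) (use cov_bound_nonneg in \<open>auto simp: large_confl_def confl_def\<close>)
  also have "(?q + c / real n) * \<Delta> i \<le> ?q * \<Delta> i + c / real n"
  proof -
    have "c / real n * \<Delta> i \<le> c / real n * 1"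
      using \<Delta>_le_half[OF i] c_nonneg n0 by (intro mult_left_mono) auto
    then show ?thesis by (simp add: algebra_simps)
  qed
  finally have "?q \<le> Pr (quiet (Suc i) large_confl) + (?q * \<Delta> i + c / real n + cov_bound k r / real n * conflict_const k)"
    by simp
  then show ?thesis by (simp add: err_def algebra_simps add_divide_distrib)
qed

lemma err_nonneg: "0 \<le> err"
  using add_nonneg_nonneg[OF c_nonneg mult_nonneg_nonneg[OF cov_bound_nonneg conflict_const_nonneg]]
  by (simp add: err_def)

text \<open>\<open>exp_minus_two_mult_le\<close> applies because every hazard is at most 1/2; the
  errors of the rounds simply add up.\<close>

lemma Pr_quiet_ge_sum: "i \<le> r \<Longrightarrow> exp (- 2 * (\<Sum>l<i. \<Delta> l)) - real i * err \<le> Pr (quiet i large_confl)"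
proof (induction i)
  case 0
  have "Pr (quiet 0 large_confl) = Pr (\<lambda>\<omega>. True)"
  proof (rule Pr_cong)
    fix \<omega> :: "(nat set \<times> nat) set"
    have "C - {T} \<noteq> {}" if "C \<in> large_confl" for C
    proof -
      have C: "C \<in> confl" "T \<in> C" "3 \<le> card C" using that by (auto simp: large_confl_def)
      have "card (C - {T}) \<noteq> 0" using conflict_at(1)[OF C(1,2)] C(3) by linarith
      then show ?thesis by (metis card.empty)
    qed
    then show "quiet 0 large_confl \<omega> = True" by (simp add: quiet_def)
  qed
  then show ?case by (simp add: Pr_def finite_slots)
next
  case (Suc i)
  then have i: "i < r" by simp
  have d: "0 \<le> \<Delta> i" "\<Delta> i \<le> 1 / 2" using \<Delta>_nonneg \<Delta>_le_half[OF i] by auto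
  have "exp (- 2 * (\<Sum>l<Suc i. \<Delta> l)) = exp (- 2 * (\<Sum>l<i. \<Delta> l)) * exp (- 2 * \<Delta> i)"
    by (simp add: exp_add[symmetric] algebra_simps)
  also have "\<dots> \<le> exp (- 2 * (\<Sum>l<i. \<Delta> l)) * (1 - \<Delta> i)"
    by (rule mult_left_mono[OF exp_minus_two_mult_le[OF d]]) simp
  finally have 1: "exp (- 2 * (\<Sum>l<Suc i. \<Delta> l)) \<le> exp (- 2 * (\<Sum>l<i. \<Delta> l)) * (1 - \<Delta> i)" .
  have "(exp (- 2 * (\<Sum>l<i. \<Delta> l)) - real i * err) * (1 - \<Delta> i) \<le> Pr (quiet i large_confl) * (1 - \<Delta> i)"
    by (rule mult_right_mono) (use Suc d in auto)
  moreover have "real i * err * (1 - \<Delta> i) \<le> real i * err * 1"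
    by (rule mult_left_mono) (use d err_nonneg in auto)
  ultimately show ?case using 1 quiet_step[OF i] by (simp add: algebra_simps)
qed

definition \<kappa> :: real where "\<kappa> = exp (- 2 * total_const)"

lemma Pr_quiet_ge: "i \<le> r \<Longrightarrow> \<kappa> - real r * err \<le> Pr (quiet i large_confl)"
proof -
  assume i: "i \<le> r"
  have "\<kappa> \<le> exp (- 2 * (\<Sum>l<i. \<Delta> l))"
    unfolding \<kappa>_def sum_\<Delta> using sum_Pr_away_all[OF i] by simp
  moreover have "real i * err \<le> real r * err" using i err_nonneg by (intro mult_right_mono) auto
  ultimately show ?thesis using Pr_quiet_ge_sum[OF i] by linarith
qed

end

section \<open>Uncovered pairs become rare\<close>

text \<open>The lower bounds \<open>a - d\<close> and \<open>b - e\<close> may be negative, so they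
  cannot be multiplied directly.\<close>

lemma mult_lower_bound:
  fixes x y a b d e :: real
  assumes "a - d \<le> x" "b - e \<le> y" "0 \<le> a" "a \<le> 1" "0 \<le> y" "y \<le> 1" "0 \<le> d" "0 \<le> e"
  shows "a * b - (d + e) \<le> x * y"
proof -
  have "a * (b - y) \<le> e"
  proof (cases "b \<le> y")
    case True
    then have "a * (b - y) \<le> 0" using assms by (intro mult_nonneg_nonpos) auto
    then show ?thesis using assms by linarith
  next
    case False
    then have "a * (b - y) \<le> 1 * (b - y)" using assms by (intro mult_right_mono) auto
    also have "1 * (b - y) \<le> e" using assms(2) by simp
    finally show ?thesis .
  qed
  moreover have "(a - x) * y \<le> d"
  proof (cases "a \<le> x")
    case True
    then have "(a - x) * y \<le> 0" using assms by (intro mult_nonpos_nonneg) auto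
    then show ?thesis using assms by linarith
  next
    case False
    then have "(a - x) * y \<le> (a - x) * 1" using assms by (intro mult_left_mono) auto
    also have "(a - x) * 1 \<le> d" using assms(1) by simp
    finally show ?thesis .
  qed
  ultimately show ?thesis by (simp add: algebra_simps)
qed

context rounds
begin

text \<open>By \<open>Pr_uncovered\<close>, the probability that a pair is uncovered after
  \<open>i\<close> rounds, the same for all pairs.\<close>

definition unc :: "nat \<Rightarrow> real" where "unc i = 1 - real (n - 2) * s i"

lemma unc_bounds: "0 \<le> unc i" "unc i \<le> 1" "i \<le> j \<Longrightarrow> unc j \<le> unc i"
proof -
  have e: "{0,1} \<subseteq> {..<n}" "card {0,1::nat} = 2" using n3 by auto
  show "0 \<le> unc i" unfolding unc_def Pr_uncovered[OF e, symmetric] by (rule Pr_nonneg)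
  show "unc i \<le> 1" unfolding unc_def using s_nonneg by simp
  show "unc j \<le> unc i" if "i \<le> j" unfolding unc_def using s_mono[OF that] by (simp add: mult_left_mono)
qed

end

context rounds_at
begin

section \<open>Pair conflicts at a fixed triple and the growth of its selection probability\<close>

definition edge_confl :: "nat set \<Rightarrow> nat set set set" where
  "edge_confl e = (\<lambda>Y. {T, Y}) ` (ext e - {T})"

definition all_confl :: "nat set set set" where "all_confl = {C \<in> confl. T \<in> C}"

lemma edge_confl_sub:
  assumes "e \<subseteq> T" "card e = 2"
  shows "edge_confl e \<subseteq> all_confl"
proof
  fix C assume "C \<in> edge_confl e"
  then obtain Y where Y: "C = {T, Y}" "Y \<in> triples n" "e \<subseteq> Y" "Y \<noteq> T"
    by (auto simp: edge_confl_def ext_def)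
  have "{T, Y} \<in> confl" by (rule two_triples_conflict[OF T Y(2) Y(4)[symmetric] assms(1) Y(3) assms(2)])
  then show "C \<in> all_confl" by (simp add: all_confl_def Y(1))
qed

lemma quiet_edge: "quiet i (edge_confl e) \<omega> \<longleftrightarrow> (\<forall>Y\<in>ext e - {T}. Y \<notin> away \<omega> i)"
proof -
  have "{T, Y} - {T} \<subseteq> away \<omega> i \<longleftrightarrow> Y \<in> away \<omega> i" if "Y \<in> ext e - {T}" for Y
    using that by auto
  then show ?thesis unfolding quiet_def edge_confl_def by simp
qed

lemma quiet_Un: "quiet i (E \<union> E') \<omega> \<longleftrightarrow> quiet i E \<omega> \<and> quiet i E' \<omega>"
  unfolding quiet_def by (simp add: ball_Un)

text \<open>A proposal pivotal for both events links \<open>T\<close> to another triple through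
  \<open>e\<close>, and by \<open>nE\<close> not by a direct pair conflict over \<open>e\<close>. So
  \<open>linked_through_edge\<close> saves a point.\<close>

lemma Pr_edge_covariance:
  assumes e: "e \<subseteq> T" "card e = 2" and i: "i \<le> r" and E: "E \<subseteq> all_confl"
    and nE: "\<And>Y. e \<subseteq> Y \<Longrightarrow> {T, Y} \<notin> E"
  shows "Pr (quiet i (edge_confl e)) * Pr (quiet i E) - cov_bound k r / real n \<le> Pr (quiet i (edge_confl e \<union> E))"
proof -
  have ki: "k * i \<le> k * r" using i by simp
  have E': "E \<subseteq> {C \<in> confl. T \<in> C}" using E by (simp add: all_confl_def)
  have "\<bar>Pr (\<lambda>\<omega>. quiet i (edge_confl e) \<omega> \<and> quiet i E \<omega>) - Pr (quiet i (edge_confl e)) * Pr (quiet i E)\<bar>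
     \<le> cov_bound k r / real n ^ (0 + 1)"
  proof (rule Pr_covariance[where W = T
        and P = "\<lambda>x F. \<exists>Y. e \<subseteq> Y \<and> Y \<noteq> T \<and> Y \<in> fst ` insert x F \<and> linked others (fst ` insert x F)"
        and Q = "\<lambda>x F. linked (others \<union> E) (insert T (fst ` insert x F))"])
    fix x \<omega>
    show "\<exists>F\<subseteq>\<omega>. card F \<le> k * r + k \<and> linked (others \<union> E) (insert T (fst ` insert x F))"
      if "quiet i E (insert x \<omega>) \<noteq> quiet i E \<omega>"
      by (rule quiet_pivotal[OF E' i that])
    show "\<exists>F\<subseteq>\<omega>. card F \<le> k * r + k \<and> (\<exists>Y. e \<subseteq> Y \<and> Y \<noteq> T \<and> Y \<in> fst ` insert x F \<and> linked others (fst ` insert x F))"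
      if piv: "quiet i (edge_confl e) (insert x \<omega>) \<noteq> quiet i (edge_confl e) \<omega>"
    proof -
      obtain Y where Y: "Y \<in> ext e - {T}" "(Y \<in> away (insert x \<omega>) i) \<noteq> (Y \<in> away \<omega> i)"
        using piv unfolding quiet_edge by metis
      obtain F where F: "F \<subseteq> \<omega>" "card F \<le> k * i" "Y \<in> fst ` insert x F" "linked others (fst ` insert x F)"
        using sel_pivotal[OF others_bound Y(2)] by blast
      have "card F \<le> k * r + k" using F(2) ki by linarith
      moreover have "e \<subseteq> Y" "Y \<noteq> T" using Y(1) by (simp_all add: ext_def)
      ultimately show ?thesis using F by (intro exI[of _ F] exI[of _ Y] conjI)
    qed
  next
    fix x F G H
    assume H: "H \<subseteq> slot_set" "finite H" "H = insert x (F \<union> G)"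
      and P: "\<exists>Y. e \<subseteq> Y \<and> Y \<noteq> T \<and> Y \<in> fst ` insert x F \<and> linked others (fst ` insert x F)"
      and Q: "linked (others \<union> E) (insert T (fst ` insert x G))"
    from P obtain Y where Y: "e \<subseteq> Y" "Y \<noteq> T" "Y \<in> fst ` insert x F" "linked others (fst ` insert x F)"
      by (elim exE conjE)
    have eqH: "fst ` H = fst ` insert x F \<union> fst ` insert x G" using H(3) by auto
    have "linked (others \<union> E) (fst ` insert x F \<union> insert T (fst ` insert x G))"
      by (rule linked_Un[OF linked_mono[OF Y(4)] Q]) auto
    moreover have "fst ` insert x F \<union> insert T (fst ` insert x G) = insert T (fst ` H)" using eqH by simp
    ultimately have l: "linked (others \<union> E) (insert T (fst ` H))" by (simp only:)
    have "card (\<Union>(insert T (fst ` H))) \<le> card (insert T (fst ` H)) + 1"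
    proof (rule linked_through_edge[OF _ _ _ l _ _ Y(2) e(1) Y(1) e(2)])
      show "finite (insert T (fst ` H))" using H(2) by simp
      show "\<forall>T\<in>insert T (fst ` H). card T = 3" using slot_triples[OF H(1)] T_card(1) by simp
      show "\<forall>D\<in>others \<union> E. tight D" using E by (auto simp: others_def all_confl_def confl_tight)
      show "T \<in> insert T (fst ` H)" by simp
      show "Y \<in> insert T (fst ` H)" using eqH Y(3) by blast
      show "{T, T'} \<notin> others \<union> E" if "e \<subseteq> T'" for T' using nE[OF that] by (simp add: others_def)
    qed
    \<comment> \<open>\<open>T\<close> need not have a slot in \<open>H\<close>: it may add one
      triple, whose points form the fixed set \<open>W\<close>.\<close>
    moreover have "card (insert T (fst ` H)) \<le> card H + 1"
      using card_insert_le_m1[of "Suc (card (fst ` H))" "fst ` H" T] card_image_le[OF H(2), of fst] by simp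
    moreover have "\<Union>(insert T (fst ` H)) = \<Union>(fst ` H) \<union> T" by auto
    ultimately show "card (\<Union>(fst ` H) \<union> T) + 0 + 1 \<le> card T + card H" using T_card(1) by simp
  qed (use T_card in simp_all)
  moreover have "quiet i (edge_confl e \<union> E) = (\<lambda>\<omega>. quiet i (edge_confl e) \<omega> \<and> quiet i E \<omega>)"
    by (rule HOL.ext) (rule quiet_Un)
  ultimately show ?thesis by simp
qed

lemma Pr_quiet_edge:
  assumes e: "e \<subseteq> T" "card e = 2"
  shows "unc i - c / real n \<le> Pr (quiet i (edge_confl e))"
proof -
  have e': "e \<subseteq> {..<n}" using e(1) T_card(3) by blast
  have "unc i = Pr (\<lambda>\<omega>. \<not> (\<exists>X\<in>ext e. X \<in> sel confl \<omega> i))"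
    unfolding unc_def by (rule Pr_uncovered[OF e' e(2), symmetric])
  also have "\<dots> \<le> Pr (\<lambda>\<omega>. quiet i (edge_confl e) \<omega> \<or> T \<in> fst ` \<omega>)"
  proof (rule Pr_mono)
    fix \<omega> assume "\<not> (\<exists>X\<in>ext e. X \<in> sel confl \<omega> i)"
    then show "quiet i (edge_confl e) \<omega> \<or> T \<in> fst ` \<omega>"
      unfolding quiet_edge using away_eq[of \<omega> i] by auto
  qed
  also have "\<dots> \<le> Pr (quiet i (edge_confl e)) + Pr (\<lambda>\<omega>. T \<in> fst ` \<omega>)" by (rule Pr_disj)
  also have "Pr (\<lambda>\<omega>. T \<in> fst ` \<omega>) \<le> c / real n" by (rule Pr_proposed1[OF T])
  finally show ?thesis by simp
qed

text \<open>The conflicts at \<open>T\<close> are the large ones and one class for each pair in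
  \<open>T\<close>. Each pair class peeled off gives a factor \<open>unc r\<close> and one
  covariance error; \<open>unc r\<close> serves all rounds because \<open>unc\<close>
  decreases.\<close>

lemma Pr_quiet_all:
  assumes i: "i \<le> r"
  shows "unc r ^ 3 * \<kappa> - (3 * (c + cov_bound k r) / real n + real r * err) \<le> Pr (quiet i all_confl)"
proof -
  obtain x y z where xyz: "T = {x, y, z}" "x \<noteq> y" "y \<noteq> z" "x \<noteq> z"
    using T_card(1) card_3_iff[of T] by blast
  let ?e1 = "{x, y}" and ?e2 = "{y, z}" and ?e3 = "{x, z}" and ?K = "cov_bound k r / real n" and ?d = "c / real n"
  have e: "?e1 \<subseteq> T" "card ?e1 = 2" "?e2 \<subseteq> T" "card ?e2 = 2" "?e3 \<subseteq> T" "card ?e3 = 2"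
    using xyz by auto
  have K0: "0 \<le> ?K" using cov_bound_nonneg by simp
  have d0: "0 \<le> ?d" using c_nonneg by (intro divide_nonneg_nonneg) auto
  \<comment> \<open>A triple containing two of the pairs is \<open>T\<close> itself, so the classes
    are disjoint, as \<open>Pr_edge_covariance\<close> demands.\<close>
  have ne: "{T, Y} \<notin> edge_confl e'" if "e \<subseteq> Y" "T \<subseteq> e \<union> e'" for e e' Y
  proof
    assume "{T, Y} \<in> edge_confl e'"
    then obtain Z where Z: "{T, Y} = {T, Z}" "Z \<in> triples n" "e' \<subseteq> Z" "Z \<noteq> T"
      by (auto simp: edge_confl_def ext_def)
    then have "Y = Z" by (metis doubleton_eq_iff)
    then have "T \<subseteq> Z" using Z that by blast
    moreover have "card Z = 3" "finite Z" using Z(2) by (auto simp: triples_def intro: card_ge_0_finite)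
    ultimately show False using Z(4) T_card(1) card_subset_eq[of Z T] by simp
  qed
  have nl: "{T, Y} \<notin> large_confl" for Y
  proof -
    have "card {T, Y} \<le> 2" by (simp add: card_insert_if)
    then show ?thesis by (auto simp: large_confl_def)
  qed
  have sub: "edge_confl ?e1 \<subseteq> all_confl" "edge_confl ?e2 \<subseteq> all_confl" "edge_confl ?e3 \<subseteq> all_confl"
    "large_confl \<subseteq> all_confl"
    using edge_confl_sub e by (auto simp: large_confl_def all_confl_def)
  have u: "unc r - ?d \<le> Pr (quiet i (edge_confl e'))" if "e' \<subseteq> T" "card e' = 2" for e'
    using Pr_quiet_edge[OF that, of i] unc_bounds(3)[OF i] by linarith
  note ub = unc_bounds(1)[of r] unc_bounds(2)[of r]
  have re0: "0 \<le> real r * err" using err_nonneg by simp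
  let ?E3 = "edge_confl ?e3 \<union> large_confl"
  let ?E2 = "edge_confl ?e2 \<union> ?E3"
  let ?E1 = "edge_confl ?e1 \<union> ?E2"
  have 3: "unc r * \<kappa> - (?d + real r * err + ?K) \<le> Pr (quiet i ?E3)"
  proof -
    have "unc r * \<kappa> - (?d + real r * err) \<le> Pr (quiet i (edge_confl ?e3)) * Pr (quiet i large_confl)"
      by (rule mult_lower_bound[OF u[OF e(5,6)] Pr_quiet_ge[OF i] ub Pr_nonneg Pr_le_1 d0 re0])
    moreover have "Pr (quiet i (edge_confl ?e3)) * Pr (quiet i large_confl) - ?K \<le> Pr (quiet i ?E3)"
      by (rule Pr_edge_covariance[OF e(5,6) i sub(4) nl])
    ultimately show ?thesis by linarith
  qed
  have 2: "unc r * (unc r * \<kappa>) - (?d + (?d + real r * err + ?K) + ?K) \<le> Pr (quiet i ?E2)"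
  proof -
    have "unc r * (unc r * \<kappa>) - (?d + (?d + real r * err + ?K)) \<le> Pr (quiet i (edge_confl ?e2)) * Pr (quiet i ?E3)"
      by (rule mult_lower_bound[OF u[OF e(3,4)] 3 ub Pr_nonneg Pr_le_1 d0]) (rule add_nonneg_nonneg d0 re0 K0)+
    moreover have "Pr (quiet i (edge_confl ?e2)) * Pr (quiet i ?E3) - ?K \<le> Pr (quiet i ?E2)"
    proof (rule Pr_edge_covariance[OF e(3,4) i])
      show "?E3 \<subseteq> all_confl" using sub by simp
      show "{T, Y} \<notin> ?E3" if "?e2 \<subseteq> Y" for Y using ne[OF that, of ?e3] nl xyz(1) by auto
    qed
    ultimately show ?thesis by linarith
  qed
  have 1: "unc r * (unc r * (unc r * \<kappa>)) - (?d + (?d + (?d + real r * err + ?K) + ?K) + ?K) \<le> Pr (quiet i ?E1)"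
  proof -
    have "unc r * (unc r * (unc r * \<kappa>)) - (?d + (?d + (?d + real r * err + ?K) + ?K)) \<le> Pr (quiet i (edge_confl ?e1)) * Pr (quiet i ?E2)"
      by (rule mult_lower_bound[OF u[OF e(1,2)] 2 ub Pr_nonneg Pr_le_1 d0]) (rule add_nonneg_nonneg d0 re0 K0)+
    moreover have "Pr (quiet i (edge_confl ?e1)) * Pr (quiet i ?E2) - ?K \<le> Pr (quiet i ?E1)"
    proof (rule Pr_edge_covariance[OF e(1,2) i])
      show "?E2 \<subseteq> all_confl" using sub by simp
      show "{T, Y} \<notin> ?E2" if "?e1 \<subseteq> Y" for Y using ne[OF that, of ?e2] ne[OF that, of ?e3] nl xyz(1) by auto
    qed
    ultimately show ?thesis by linarith
  qed
  have "all_confl \<subseteq> ?E1"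
  proof
    fix C assume C: "C \<in> all_confl"
    then have C': "C \<in> confl" "T \<in> C" by (simp_all add: all_confl_def)
    show "C \<in> ?E1"
    proof (cases "3 \<le> card C")
      case True
      then show ?thesis using C' by (simp add: large_confl_def)
    next
      case False
      then have "card C = 2" using tight_2[OF confl_tight[OF C'(1)]] by linarith
      then obtain A B where "C = {A, B}" "A \<noteq> B" by (metis card_2_iff)
      then obtain Y where Y: "C = {T, Y}" "Y \<noteq> T" using C'(2) by auto
      have Yt: "Y \<in> triples n" using confl_triples[OF C'(1)] Y(1) by simp
      then have cY: "card Y = 3" "finite Y" by (auto simp: triples_def intro: card_ge_0_finite)
      have "card (\<Union>C) \<le> 4" using tight_le[OF confl_tight[OF C'(1)]] \<open>card C = 2\<close> by simp
      then have two: "2 \<le> card (T \<inter> Y)" using card_Un_Int[OF T_card(2) cY(2)] T_card(1) cY(1) Y(1) by simp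
      have "?e1 \<subseteq> Y \<or> ?e2 \<subseteq> Y \<or> ?e3 \<subseteq> Y"
      proof (rule ccontr)
        assume "\<not> (?e1 \<subseteq> Y \<or> ?e2 \<subseteq> Y \<or> ?e3 \<subseteq> Y)"
        then have "T \<inter> Y \<subseteq> {x} \<or> T \<inter> Y \<subseteq> {y} \<or> T \<inter> Y \<subseteq> {z}" using xyz(1) by auto
        then have "card (T \<inter> Y) \<le> 1" by (metis card_mono card_1_singleton_iff finite.emptyI finite.insertI One_nat_def)
        then show False using two by simp
      qed
      then have "Y \<in> ext ?e1 - {T} \<or> Y \<in> ext ?e2 - {T} \<or> Y \<in> ext ?e3 - {T}"
        using Yt Y(2) by (simp add: ext_def)
      then show ?thesis unfolding Y(1) edge_confl_def by blast
    qed
  qed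
  then have "Pr (quiet i ?E1) \<le> Pr (quiet i all_confl)"
    by (intro Pr_mono) (unfold quiet_def, metis subsetD)
  moreover have "3 * (a + b) / m = a / m + a / m + a / m + b / m + b / m + b / m" for a b m :: real
    by (simp add: divide_inverse algebra_simps)
  then have "3 * (c + cov_bound k r) / real n = ?d + ?d + ?d + ?K + ?K + ?K" .
  moreover have "unc r ^ 3 * \<kappa> = unc r * (unc r * (unc r * \<kappa>))" by (simp add: power3_eq_cube)
  ultimately show ?thesis using 1 by linarith
qed

lemma finite_all: "finite all_confl"
  by (rule finite_subset[OF _ finite_confl]) (auto simp: all_confl_def)

text \<open>The event that \<open>T\<close> is proposed in round \<open>i\<close> is independent of
  \<open>h\<close>, and \<open>h\<close> bounds from below the indicator that such a proposal
  succeeds.\<close>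

lemma selection_step:
  assumes i: "i < r"
  shows "p * (Pr (quiet i all_confl) - c / real n - \<epsilon> * step_const k c) \<le> s (Suc i) - s i"
proof -
  \<comment> \<open>Counting the conflicts that use simultaneous proposals, instead of indicating
    one, keeps the expectation a plain sum. Excluding \<open>T\<close> from the members keeps it
    independent of the slot \<open>(T, i)\<close>.\<close>
  define late where "late = (\<lambda>\<omega>. \<Sum>C\<in>all_confl. \<Sum>Y\<in>C - {T}. of_bool ((Y, i) \<in> \<omega> \<and> C - {T, Y} \<subseteq> fst ` \<omega>) :: real)"
  define free where "free = (\<lambda>\<omega>. T \<notin> sel confl \<omega> i \<and> \<not> (\<exists>C\<in>all_confl. C - {T} \<subseteq> sel confl \<omega> i))"
  define h where "h = (\<lambda>\<omega>. of_bool (free \<omega>) - late \<omega>)"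
  have late0: "0 \<le> late \<omega>" for \<omega> unfolding late_def by (intro sum_nonneg) simp
  have sl: "(T, i) \<in> slot_set" using T i by (simp add: slots_def)
  have ind: "h (insert (T, i) \<omega>) = h \<omega>" for \<omega>
  proof -
    have "sel confl (insert (T, i) \<omega>) i = sel confl \<omega> i" by (rule sel_cong) simp
    then have "free (insert (T, i) \<omega>) = free \<omega>" by (simp add: free_def)
    moreover have "late (insert (T, i) \<omega>) = late \<omega>" unfolding late_def
    proof (intro sum.cong refl)
      fix C Y assume "Y \<in> C - {T}"
      then have "(Y, i) \<in> insert (T, i) \<omega> \<longleftrightarrow> (Y, i) \<in> \<omega>" by auto
      moreover have "C - {T, Y} \<subseteq> fst ` insert (T, i) \<omega> \<longleftrightarrow> C - {T, Y} \<subseteq> fst ` \<omega>" by auto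
      ultimately show "of_bool ((Y, i) \<in> insert (T, i) \<omega> \<and> C - {T, Y} \<subseteq> fst ` insert (T, i) \<omega>) =
          (of_bool ((Y, i) \<in> \<omega> \<and> C - {T, Y} \<subseteq> fst ` \<omega>) :: real)" by simp
    qed
    ultimately show ?thesis by (simp add: h_def)
  qed
  have "p * Ex h = Ex (\<lambda>\<omega>. of_bool ((T, i) \<in> \<omega>) * h \<omega>)"
    by (rule expect_indep[where f = h, OF finite_slots sl ind, symmetric])
  also have "\<dots> \<le> Ex (\<lambda>\<omega>. of_bool (T \<in> sel confl \<omega> (Suc i)) - of_bool (T \<in> sel confl \<omega> i))"
  proof (rule expect_mono[OF p_nonneg p_le_1])
    fix \<omega> :: "(nat set \<times> nat) set"
    have mono: "T \<in> sel confl \<omega> i \<Longrightarrow> T \<in> sel confl \<omega> (Suc i)" by simp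
    show "of_bool ((T, i) \<in> \<omega>) * h \<omega> \<le> of_bool (T \<in> sel confl \<omega> (Suc i)) - of_bool (T \<in> sel confl \<omega> i)"
    proof (cases "(T, i) \<in> \<omega> \<and> free \<omega> \<and> T \<notin> sel confl \<omega> (Suc i)")
      case False
      have "h \<omega> \<le> of_bool (free \<omega>)" using late0 by (simp add: h_def)
      moreover have "free \<omega> \<Longrightarrow> T \<notin> sel confl \<omega> i" by (simp add: free_def)
      ultimately show ?thesis using False mono by (cases "(T, i) \<in> \<omega>"; cases "free \<omega>") auto
    next
      case True
      then have "\<exists>C\<in>confl. T \<in> C \<and> C - {T} \<subseteq> sel confl \<omega> i \<union> {Y. (Y, i) \<in> \<omega>}" by simp
      then obtain C where C: "C \<in> all_confl" "C - {T} \<subseteq> sel confl \<omega> i \<union> {Y. (Y, i) \<in> \<omega>}"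
        by (auto simp: all_confl_def)
      have "\<not> C - {T} \<subseteq> sel confl \<omega> i" using True C(1) unfolding free_def by metis
      then obtain Y where Y: "Y \<in> C - {T}" "Y \<notin> sel confl \<omega> i" by blast
      then have Yi: "(Y, i) \<in> \<omega>" using C(2) by blast
      have "sel confl \<omega> i \<union> {Y. (Y, i) \<in> \<omega>} \<subseteq> fst ` \<omega>" using sel_subset_fst[of confl \<omega> i] by force
      then have "C - {T, Y} \<subseteq> fst ` \<omega>" using C(2) by blast
      then have "1 \<le> (of_bool ((Y, i) \<in> \<omega> \<and> C - {T, Y} \<subseteq> fst ` \<omega>) :: real)" using Yi by simp
      also have "\<dots> \<le> (\<Sum>Y\<in>C - {T}. of_bool ((Y, i) \<in> \<omega> \<and> C - {T, Y} \<subseteq> fst ` \<omega>))"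
        by (rule member_le_sum[OF Y(1)]) (use C(1) confl_finite in \<open>auto simp: all_confl_def\<close>)
      also have "\<dots> \<le> late \<omega>" unfolding late_def
        by (rule member_le_sum[OF C(1)]) (auto intro: sum_nonneg finite_all)
      finally have "h \<omega> \<le> 0" by (simp add: h_def)
      moreover have "T \<notin> sel confl \<omega> i" using True by (simp add: free_def)
      ultimately show ?thesis using True by simp
    qed
  qed
  also have "\<dots> = s (Suc i) - s i"
    unfolding expect_diff by (simp only: Pr_sel[OF T, unfolded Pr_def])
  finally have 1: "p * Ex h \<le> s (Suc i) - s i" .
  have "Ex h = Pr free - (\<Sum>C\<in>all_confl. \<Sum>Y\<in>C - {T}. Pr (\<lambda>\<omega>. (Y, i) \<in> \<omega> \<and> C - {T, Y} \<subseteq> fst ` \<omega>))"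
    unfolding h_def expect_diff late_def expect_sum by (simp only: Pr_def)
  moreover have "(\<Sum>C\<in>all_confl. \<Sum>Y\<in>C - {T}. Pr (\<lambda>\<omega>. (Y, i) \<in> \<omega> \<and> C - {T, Y} \<subseteq> fst ` \<omega>)) \<le> \<epsilon> * step_const k c"
    by (rule sum_late_le[OF i]) (simp add: all_confl_def)
  moreover have "Pr (quiet i all_confl) \<le> Pr (\<lambda>\<omega>. free \<omega> \<or> T \<in> fst ` \<omega>)"
  proof (rule Pr_mono)
    fix \<omega> assume q: "quiet i all_confl \<omega>"
    show "free \<omega> \<or> T \<in> fst ` \<omega>"
    proof (cases "T \<in> fst ` \<omega>")
      case False
      then have "T \<notin> sel confl \<omega> i" using sel_subset_fst[of confl \<omega> i] by blast
      then show ?thesis using q unfolding free_def quiet_def away_eq[OF False] by simp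
    qed simp
  qed
  moreover have "\<dots> \<le> Pr free + c / real n"
    using Pr_disj[of free "\<lambda>\<omega>. T \<in> fst ` \<omega>"] Pr_proposed1[OF T] by linarith
  ultimately have "Pr (quiet i all_confl) - c / real n - \<epsilon> * step_const k c \<le> Ex h" by linarith
  then show ?thesis using 1 p_nonneg by (meson mult_left_mono order_trans)
qed

definition final_err :: real where
  "final_err = 3 * (c + cov_bound k r) + real r * (c + cov_bound k r * conflict_const k) + c"

text \<open>The gains of the \<open>r\<close> rounds telescope to at most \<open>s r\<close>, capped
  by 3/n, while \<open>r * p\<close> is c/n.\<close>

lemma uncovered_small: "c * (unc r ^ 3 * \<kappa> - \<epsilon> * step_const k c - final_err / real n) \<le> 3"
proof -
  let ?B = "unc r ^ 3 * \<kappa> - \<epsilon> * step_const k c - final_err / real n"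
  have n0: "0 < real n" using n3 by simp
  have fe: "final_err / real n = 3 * (c + cov_bound k r) / real n + real r * err + c / real n"
  proof -
    have "(a + d * b + e) / m = a / m + d * (b / m) + e / m" for a b d e m :: real
      by (simp add: add_divide_distrib)
    then show ?thesis unfolding final_err_def err_def .
  qed
  have B: "p * ?B \<le> s (Suc i) - s i" if "i < r" for i
  proof -
    have "?B \<le> Pr (quiet i all_confl) - c / real n - \<epsilon> * step_const k c"
      using Pr_quiet_all[of i] that fe by linarith
    then have "p * ?B \<le> p * (Pr (quiet i all_confl) - c / real n - \<epsilon> * step_const k c)"
      by (rule mult_left_mono[OF _ p_nonneg])
    then show ?thesis using selection_step[OF that] by linarith
  qed
  have "real r * p * ?B = (\<Sum>i<r. p * ?B)" by simp
  also have "\<dots> \<le> (\<Sum>i<r. s (Suc i) - s i)" by (rule sum_mono) (use B in simp)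
  also have "\<dots> = s r - s 0" by (rule sum_lessThan_telescope)
  also have "\<dots> \<le> 3 / real n" using s_le[of r] s_nonneg[of 0] by linarith
  finally have "c * ?B / real n \<le> 3 / real n" by (simp add: rp)
  then show ?thesis using n0 by (simp add: divide_le_cancel)
qed

end

section \<open>Convergence\<close>

lemma real_choose_two: "real (n choose 2) = real n * (real n - 1) / 2"
  by (induction n) (simp_all add: numeral_2_eq_2 field_simps)

lemma real_choose_three: "real (n choose 3) = real n * (real n - 1) * (real n - 2) / 6"
proof (induction n)
  case (Suc n)
  have "Suc n choose 3 = (n choose 2) + (n choose 3)" 
    unfolding numeral_3_eq_3 numeral_2_eq_2 by (rule binomial_Suc_Suc)
  then show ?case using Suc real_choose_two[of n] by (simp add: field_simps)
qed simp

context rounds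
begin

lemma uncovered_bound:
  "c * (unc r ^ 3 * exp (- 2 * ((4 ^ k + 1) * conflict_const k)) - \<epsilon> * step_const k c
     - (3 * (c + cov_bound k r) + real r * (c + cov_bound k r * conflict_const k) + c) / real n) \<le> 3"
proof -
  interpret at: rounds_at n k r \<epsilon> "{0,1,2}"
    by unfold_locales (use n3 in \<open>auto simp: triples_def\<close>)
  show ?thesis using at.uncovered_small unfolding at.\<kappa>_def at.total_const_def at.final_err_def .
qed

text \<open>Some outcome is at least as large as the mean, and by symmetry the mean is the number of
  triples times \<open>s r\<close>.\<close>

lemma ex_large_selection:
  "\<exists>S. S \<subseteq> triples n \<and> (\<forall>C\<in>conflicts k n. \<not> C \<subseteq> S) \<and> real n * (real n - 1) * (1 - unc r) / 6 \<le> real (card S)"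
proof -
  let ?f = "\<lambda>\<omega>. real (card (sel confl \<omega> r))"
  have fin: "finite (?f ` Pow slot_set)" "?f ` Pow slot_set \<noteq> {}" using finite_slots by auto
  obtain \<omega> where w: "\<omega> \<subseteq> slot_set" "?f \<omega> = Max (?f ` Pow slot_set)" using Max_in[OF fin] by auto
  have "Ex ?f \<le> Ex (\<lambda>_. ?f \<omega>)"
    by (rule expect_mono[OF p_nonneg p_le_1]) (use w(2) Max_ge[OF fin(1)] in auto)
  then have le: "Ex ?f \<le> ?f \<omega>" by (simp add: finite_slots)
  have "Ex ?f = Ex (\<lambda>\<omega>. \<Sum>X\<in>triples n. of_bool (X \<in> sel confl \<omega> r))"
  proof (rule expect_cong)
    fix \<omega> assume "\<omega> \<subseteq> slot_set"
    then have "triples n \<inter> {X. X \<in> sel confl \<omega> r} = sel confl \<omega> r"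
      using sel_triples[of \<omega> confl r] by auto
    then show "?f \<omega> = (\<Sum>X\<in>triples n. of_bool (X \<in> sel confl \<omega> r))"
      by (simp add: sum_of_bool_eq finite_triples)
  qed
  also have "\<dots> = (\<Sum>X\<in>triples n. s r)"
    unfolding expect_sum by (rule sum.cong) (simp_all add: Pr_sel[unfolded Pr_def])
  also have "\<dots> = real (n choose 3) * s r"
    using n_subsets[of "{..<n}" 3] by (simp add: triples_def)
  also have "\<dots> = real n * (real n - 1) * (1 - unc r) / 6"
    using n3 by (simp add: real_choose_three unc_def of_nat_diff)
  finally have "real n * (real n - 1) * (1 - unc r) / 6 \<le> ?f \<omega>" using le by simp
  moreover have "\<forall>C\<in>conflicts k n. \<not> C \<subseteq> sel confl \<omega> r"
  proof
    fix C assume C: "C \<in> conflicts k n"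
    then have "C \<noteq> {}" by (auto simp: conflicts_def tight_def)
    then show "\<not> C \<subseteq> sel confl \<omega> r" using C by (intro sel_conflict_free) (simp_all add: confl_def)
  qed
  ultimately show ?thesis using sel_triples[OF w(1)] by (intro exI[of _ "sel confl \<omega> r"] conjI)
qed

end

lemma ex_nat_ge_1: "\<exists>m::nat. 1 \<le> m \<and> x \<le> real m"
  by (metis le_cases order_trans of_nat_le_iff real_arch_simple)

text \<open>The order of choices is \<delta>, \<open>c\<close>, \<epsilon>, \<open>r\<close> and
  finally \<open>N\<close>, since the covariance errors depend on all earlier constants. Three error
  terms of at most \<open>A / 4\<close> each leave \<open>unc r ^ 3 * \<kappa>\<close> below
  \<open>A\<close>.\<close>

lemma ex_dense_conflict_free:
  fixes \<delta> :: real
  assumes k: "2 \<le> k" and \<delta>: "0 < \<delta>"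
  shows "\<exists>N. \<forall>n\<ge>N. \<exists>S. S \<subseteq> triples n \<and> (\<forall>C\<in>conflicts k n. \<not> C \<subseteq> S) \<and>
    real n * (real n - 1) * (1 - \<delta>) / 6 \<le> real (card S)"
proof -
  define \<kappa> where "\<kappa> = exp (- 2 * ((4 ^ k + 1) * conflict_const k))"
  define A where "A = \<delta> ^ 3 * \<kappa>"
  have A: "0 < A" using \<delta> by (simp add: A_def \<kappa>_def)
  obtain c :: nat where c: "1 \<le> c" "12 / A \<le> real c" using ex_nat_ge_1 by blast
  define St where "St = step_const k (real c)"
  have St: "0 \<le> St" by (simp add: St_def step_const_def conflict_const_def)
  \<comment> \<open>The first summand ensures \<epsilon> * St \<le> 1/2 as the locale requires, the
    second \<epsilon> * St \<le> A/4.\<close>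
  obtain m :: nat where m: "1 \<le> m" "2 * St + 4 * St / A \<le> real m" using ex_nat_ge_1 by blast
  define \<epsilon> where "\<epsilon> = 1 / real m"
  define r where "r = c * m"
  have cr: "real r * \<epsilon> = real c" using m by (simp add: r_def \<epsilon>_def)
  have "St \<le> real m / 2" "St \<le> A / 4 * real m"
  proof -
    have "0 \<le> 4 * St / A" using St A by simp
    then show "St \<le> real m / 2" using m(2) by linarith
    have "4 * St / A \<le> real m" using m(2) St by linarith
    then show "St \<le> A / 4 * real m" using A by (simp add: field_simps)
  qed
  then have eSt: "\<epsilon> * St \<le> 1 / 2" "\<epsilon> * St \<le> A / 4" using m by (simp_all add: \<epsilon>_def field_simps)
  define K where "K = 3 * (real c + cov_bound k r) + real r * (real c + cov_bound k r * conflict_const k) + real c"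
  obtain N :: nat where N: "3 + real c + (real c)\<^sup>2 + \<bar>real k * 4 ^ k * cov_bound k r\<bar> + \<bar>4 * K / A\<bar> \<le> real N"
    using real_arch_simple by blast
  show ?thesis
  proof (intro exI[of _ N] allI impI)
    fix n assume "N \<le> n"
    then have n: "3 + real c + (real c)\<^sup>2 + \<bar>real k * 4 ^ k * cov_bound k r\<bar> + \<bar>4 * K / A\<bar> \<le> real n"
      using N by (meson of_nat_le_iff order_trans)
    have pos: "0 \<le> real c" "0 \<le> (real c)\<^sup>2" by auto
    have n3: "3 \<le> real n" and n_le: "real c \<le> real n" "(real c)\<^sup>2 \<le> real n"
      "real k * 4 ^ k * cov_bound k r \<le> real n" "4 * K / A \<le> real n" using n pos by linarith+
    interpret rounds n k r \<epsilon>
    proof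
      show "3 \<le> n" using n3 by linarith
      show "0 < \<epsilon>" "\<epsilon> \<le> 1" using m(1) by (simp_all add: \<epsilon>_def)
      show "real r * \<epsilon> \<le> real n" "(real r * \<epsilon>)\<^sup>2 \<le> real n" unfolding cr using n_le(1,2) .
      show "\<epsilon> * step_const k (real r * \<epsilon>) \<le> 1 / 2" unfolding cr using eSt(1) by (simp only: St_def)
    qed (use k n_le(3) in simp_all)
    have "K / real n \<le> A / 4" using n_le(4) A n3 by (simp add: field_simps)
    moreover have "3 / real c \<le> A / 4" using c A by (simp add: field_simps)
    moreover have "unc r ^ 3 * \<kappa> - \<epsilon> * St - K / real n \<le> 3 / real c"
    proof -
      have "real c * (unc r ^ 3 * \<kappa> - \<epsilon> * St - K / real n) \<le> 3"
        using uncovered_bound unfolding cr \<kappa>_def St_def K_def .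
      then show ?thesis using c by (simp add: pos_le_divide_eq mult.commute)
    qed
    ultimately have "unc r ^ 3 * \<kappa> < A" using eSt(2) A by linarith
    then have "unc r ^ 3 < \<delta> ^ 3" by (simp add: A_def \<kappa>_def)
    then have "unc r \<le> \<delta>" using \<delta> power_less_imp_less_base[of "unc r" 3 \<delta>] by simp
    then have "real n * (real n - 1) * (1 - \<delta>) / 6 \<le> real n * (real n - 1) * (1 - unc r) / 6"
      using n3 by (intro divide_right_mono mult_left_mono) auto
    then show "\<exists>S. S \<subseteq> triples n \<and> (\<forall>C\<in>conflicts k n. \<not> C \<subseteq> S) \<and>
        real n * (real n - 1) * (1 - \<delta>) / 6 \<le> real (card S)"
      using ex_large_selection by (meson order_trans)
  qed
qed

section \<open>The upper bound by counting pairs, and the limit\<close>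

lemma card_partial_sts_le:
  assumes "partial_steiner_triple_system {..<n} S"
  shows "real (card S) \<le> (real n)\<^sup>2 / 6"
proof -
  have S: "\<And>T. T \<in> S \<Longrightarrow> T \<subseteq> {..<n} \<and> card T = 3"
    and u: "\<And>e T T'. e \<subseteq> {..<n} \<Longrightarrow> card e = 2 \<Longrightarrow> T \<in> S \<Longrightarrow> e \<subseteq> T \<Longrightarrow> T' \<in> S \<Longrightarrow> e \<subseteq> T' \<Longrightarrow> T = T'"
    using assms unfolding partial_steiner_triple_system_def Uniq_def by metis+
  let ?p = "\<lambda>T. {e. e \<subseteq> T \<and> card e = 2}"
  have fS: "finite S" by (rule finite_subset[of _ "Pow {..<n}"]) (use S in auto)
  have fT: "finite T" if "T \<in> S" for T using S[OF that] by (auto intro: card_ge_0_finite)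
  have "card (\<Union>T\<in>S. ?p T) = (\<Sum>T\<in>S. card (?p T))"
  proof (rule card_UN_disjoint[OF fS])
    show "\<forall>T\<in>S. finite (?p T)" using fT by simp
    show "\<forall>T\<in>S. \<forall>T'\<in>S. T \<noteq> T' \<longrightarrow> ?p T \<inter> ?p T' = {}"
    proof (intro ballI impI equals0I)
      fix T T' e assume a: "T \<in> S" "T' \<in> S" "T \<noteq> T'" "e \<in> ?p T \<inter> ?p T'"
      then have "e \<subseteq> T" "e \<subseteq> T'" "card e = 2" by auto
      moreover have "e \<subseteq> {..<n}" using S[OF a(1)] \<open>e \<subseteq> T\<close> by (meson order_trans)
      ultimately show False using u a(1-3) by metis
    qed
  qed
  also have "\<dots> = (\<Sum>T\<in>S. 3)"
  proof (rule sum.cong[OF refl])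
    fix T assume T: "T \<in> S"
    have "card (?p T) = card T choose 2" by (rule n_subsets[OF fT[OF T]])
    then show "card (?p T) = 3" using S[OF T] by (simp add: choose_two)
  qed
  finally have "3 * card S = card (\<Union>T\<in>S. ?p T)" by simp
  also have "\<dots> \<le> card {e. e \<subseteq> {..<n} \<and> card e = 2}"
  proof (rule card_mono)
    show "(\<Union>T\<in>S. ?p T) \<subseteq> {e. e \<subseteq> {..<n} \<and> card e = 2}"
    proof
      fix e assume "e \<in> (\<Union>T\<in>S. ?p T)"
      then obtain T where "T \<in> S" "e \<subseteq> T" "card e = 2" by auto
      then show "e \<in> {e. e \<subseteq> {..<n} \<and> card e = 2}" using S[of T] by (simp add: order_trans[of e T])
    qed
  qed simp
  also have "\<dots> = n choose 2" using n_subsets[of "{..<n}" 2] by simp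
  finally have "3 * real (card S) \<le> real n * (real n - 1) / 2"
    unfolding real_choose_two[symmetric] by linarith
  also have "\<dots> \<le> (real n)\<^sup>2 / 2" by (simp add: power2_eq_square algebra_simps)
  finally show ?thesis by simp
qed

theorem theorem1p2:
  fixes k :: nat
  shows "\<exists>S :: nat \<Rightarrow> nat set set.
    (\<forall>n. partial_steiner_triple_system {..<n} (S n) \<and> sparse_triple_system k (S n)) \<and>
    (\<lambda>n. real (card (S n)) / real n ^ 2) \<longlonglongrightarrow> 1 / 6"
proof -
  define P where "P = (\<lambda>n (S :: nat set set). partial_steiner_triple_system {..<n} S \<and> sparse_triple_system k S)"
  \<comment> \<open>Only from 2 on do the conflicts include two triples sharing a pair; a larger
    value strengthens sparseness.\<close>
  define k' where "k' = max k 2"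
  have k': "2 \<le> k'" "k \<le> k'" unfolding k'_def by (rule max.cobounded2, rule max.cobounded1)
  \<comment> \<open>A system of maximum size for each n serves all \<open>e\<close> at once, and
    also the small n.\<close>
  have "\<exists>S. P n S \<and> (\<forall>S'. P n S' \<longrightarrow> card S' \<le> card S)" for n
  proof (rule ex_has_greatest_nat)
    have "\<not> C \<subseteq> {}" if "configuration (j + 2) j C" "2 \<le> j" for j and C :: "nat set set"
      using that by (auto simp: configuration_def)
    then show "P n {}"
      by (auto simp: P_def partial_steiner_triple_system_def sparse_triple_system_def Uniq_def)
    show "\<forall>S. P n S \<longrightarrow> card S < Suc (card (Pow {..<n}))"
    proof (intro allI impI)
      fix S assume "P n S"
      then have "S \<subseteq> Pow {..<n}" by (auto simp: P_def partial_steiner_triple_system_def)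
      then show "card S < Suc (card (Pow {..<n}))" by (simp add: less_Suc_eq_le card_mono)
    qed
  qed
  then obtain S where S: "\<And>n. P n (S n)" "\<And>n S'. P n S' \<Longrightarrow> card S' \<le> card (S n)" by metis
  have "(\<lambda>n. real (card (S n)) / real n ^ 2) \<longlonglongrightarrow> 1 / 6"
  proof (rule LIMSEQ_I)
    fix e :: real assume e: "0 < e"
    obtain N where N: "\<And>n. N \<le> n \<Longrightarrow> \<exists>S. S \<subseteq> triples n \<and> (\<forall>C\<in>conflicts k' n. \<not> C \<subseteq> S) \<and>
        real n * (real n - 1) * (1 - e) / 6 \<le> real (card S)"
      using ex_dense_conflict_free[OF k'(1) e] by blast
    obtain N' :: nat where N': "1 \<le> N'" "1 / e \<le> real N'" using ex_nat_ge_1 by blast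
    show "\<exists>N. \<forall>n\<ge>N. norm (real (card (S n)) / real n ^ 2 - 1 / 6) < e"
    proof (intro exI[of _ "max N N'"] allI impI)
      fix n assume n: "max N N' \<le> n"
      then have n1: "1 \<le> real n" "1 / e \<le> real n" using N' by (auto intro: order_trans)
      obtain S' where S': "S' \<subseteq> triples n" "\<And>C. C \<in> conflicts k' n \<Longrightarrow> \<not> C \<subseteq> S'"
        "real n * (real n - 1) * (1 - e) / 6 \<le> real (card S')" using N[of n] n by auto
      have "partial_steiner_triple_system {..<n} S'"
        by (rule conflict_free_imp_partial_sts[OF S'(1,2) k'(1)])
      moreover have "sparse_triple_system k' S'" by (rule conflict_free_imp_sparse[OF S'(1,2)])
      then have "sparse_triple_system k S'"
        unfolding sparse_triple_system_def by (meson k'(2) order_trans)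
      ultimately have "card S' \<le> card (S n)" by (intro S(2)) (simp add: P_def)
      then have lo: "real n * (real n - 1) * (1 - e) / 6 \<le> real (card (S n))" using S'(3) by linarith
      have hi: "real (card (S n)) \<le> (real n)\<^sup>2 / 6"
        by (rule card_partial_sts_le) (use S(1)[of n] in \<open>simp add: P_def\<close>)
      have n0: "0 < (real n)\<^sup>2" using n1 by simp
      \<comment> \<open>One \<open>e\<close> is the density loss; the other absorbs the difference
        between n (n - 1) and n squared, using \<open>1 \<le> e * n\<close>.\<close>
      have "(1 - 2 * e) / 6 \<le> real (card (S n)) / (real n)\<^sup>2"
      proof -
        have "1 \<le> e * real n" using n1(2) e by (simp add: field_simps)
        then have "real n * (1 - e) \<le> real n * (e * real n)" using n1 e by (intro mult_left_mono) auto
        then have "(1 - 2 * e) * (real n)\<^sup>2 \<le> real n * (real n - 1) * (1 - e)"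
          by (simp add: power2_eq_square algebra_simps)
        then have "(1 - 2 * e) / 6 * (real n)\<^sup>2 \<le> real (card (S n))" using lo by simp
        then show ?thesis using n0 by (simp add: pos_le_divide_eq)
      qed
      moreover have "real (card (S n)) / (real n)\<^sup>2 \<le> 1 / 6" using hi n0 by (simp add: pos_divide_le_eq)
      ultimately show "norm (real (card (S n)) / real n ^ 2 - 1 / 6) < e" using e by (simp add: abs_if)
    qed
  qed
  then show ?thesis using S(1) unfolding P_def by blast
qed

end
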